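(* Let $d\ge 1$, let $W$ be a strict contraction on $\mathbb{C}^d$, let $\Theta$ be a pure inner function with values in $\mathcal{L}(\mathbb{C}^d)$, let $\Theta'(\lambda)=-W+D_{W^*}(I-\Theta(\lambda)W^* )^{-1}\Theta(\lambda)D_W$, and let $J_W:K_\Theta\to K_{\Theta'}$ be the unitary operator $(J_Wf)(\lambda)=D_{W^*}(I-\Theta(\lambda)W^* )^{-1}f(\lambda)$. Let $\mathcal{T}_\Theta$ and $\mathcal{T}_{\Theta'}$ be the spaces of (bounded) matrix-valued truncated Toeplitz operators on $K_\Theta$ and $K_{\Theta'}$ respectively. Then $$\mathcal{T}_\Theta=J_W^*\,\mathcal{T}_{\Theta'}\,J_W=\{J_W^*AJ_W: A\in\mathcal{T}_{\Theta'}\}.$$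
   Context: $\mathcal{L}(\mathbb{C}^d)$ is the algebra of linear operators on the Hilbert space $\mathbb{C}^d$, $\mathbb{D}$ is the open unit disc, $\mathbb{T}$ the unit circle. $H^2(\mathbb{C}^d)$ is the Hardy space of $\mathbb{C}^d$-valued functions: the subspace of $L^2(\mathbb{T};\mathbb{C}^d)$ of functions with vanishing negative Fourier coefficients, identified with analytic functions on $\mathbb{D}$. An inner function is an element $\Theta\in H^2(\mathcal{L}(\mathbb{C}^d))$ whose boundary values are unitary a.e. on $\mathbb{T}$; it is pure if $\|\Theta(0)\|<1$. The model space is $K_\Theta=H^2(\mathbb{C}^d)\ominus\Theta H^2(\mathbb{C}^d)$, and $P_\Theta$ is the orthogonal projection onto $K_\Theta$. A strict contraction is an operator $W$ with $\|W\|<1$; $D_W=(I-W^*W)^{1/2}$, $D_{W^*}=(I-WW^* )^{1/2}$. The function $\Theta'$ is again a pure inner function, and $J_W$ is a unitary operator from $K_\Theta$ onto $K_{\Theta'}$. Matrix-valued truncated Toeplitz operators are compressions of multiplication operators to model spaces: a bounded operator $A$ on $K_\Theta$ belongs to $\mathcal{T}_\Theta$ if there is $\Phi\in L^2(\mathbb{T};\mathcal{L}(\mathbb{C}^d))$ such that $Af=P_\Theta(\Phi f)$ for all bounded functions $f\in K_\Theta$ (these are dense in $K_\Theta$). $\mathcal{T}_{\Theta'}$ is defined in the same way with $\Theta'$ in place of $\Theta$. *)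

theory Defs
  imports "HOL-Analysis.Analysis"
begin

section \<open>Operators on \<open>\<complex>\<^sup>d\<close>\<close>

text \<open>
  Operators on \<open>\<complex>\<^sup>d\<close> are matrices of type \<open>complex^'d^'d\<close>. The library inner product on
  \<open>complex^'d\<close> is only the real part of the Hermitian one, so the latter is defined here
  (linear in the first argument); both induce the library norm.
\<close>

definition hinner :: "complex^'d \<Rightarrow> complex^'d \<Rightarrow> complex" where
  "hinner u v = (\<Sum>i\<in>UNIV. u $ i * cnj (v $ i))"

definition adj :: "complex^'d^'d \<Rightarrow> complex^'d^'d" where
  "adj A = (\<chi> i j. cnj (A $ j $ i))"

definition unitary :: "complex^'d^'d \<Rightarrow> bool" where
  "unitary U \<longleftrightarrow> adj U ** U = mat 1 \<and> U ** adj U = mat 1"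

text \<open>The operator norm; \<open>norm A\<close> for a matrix \<open>A\<close> would be the Frobenius norm.\<close>

definition opnorm :: "complex^'d^'d \<Rightarrow> real" where
  "opnorm A = onorm (\<lambda>v. A *v v)"

definition positive_op :: "complex^'d^'d \<Rightarrow> bool" where
  "positive_op A \<longleftrightarrow> adj A = A \<and> (\<forall>v. 0 \<le> Re (hinner (A *v v) v))"

definition sqrt_op :: "complex^'d^'d \<Rightarrow> complex^'d^'d" where
  "sqrt_op A = (THE S. positive_op S \<and> S ** S = A)"

definition defect_op :: "complex^'d^'d \<Rightarrow> complex^'d^'d" where
  "defect_op W = sqrt_op (mat 1 - adj W ** W)"

definition strict_contraction :: "complex^'d^'d \<Rightarrow> bool" where
  "strict_contraction W \<longleftrightarrow> opnorm W < 1"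


section \<open>\<open>L\<^sup>2\<close> of the circle\<close>

text \<open>
  Normalized arc length, as a Borel measure on the plane carried by the unit circle. Functions on
  the circle are functions on \<open>complex\<close>, whose values off the circle are irrelevant.
\<close>

definition circle_measure :: "complex measure" where
  "circle_measure = distr (uniform_measure lborel {0..2 * pi}) borel cis"

text \<open>
  For matrix-valued functions the norm is the Frobenius norm; as it is equivalent to the
  operator norm, both give the same space.
\<close>

definition L2_circle :: "(complex \<Rightarrow> 'a::euclidean_space) set" where
  "L2_circle = {g \<in> borel_measurable circle_measure.
                  integrable circle_measure (\<lambda>\<zeta>. (norm (g \<zeta>))\<^sup>2)}"

definition L2_inner :: "(complex \<Rightarrow> complex^'d) \<Rightarrow> (complex \<Rightarrow> complex^'d) \<Rightarrow> complex" where
  "L2_inner g h = (LINT \<zeta>|circle_measure. hinner (g \<zeta>) (h \<zeta>))"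

definition fourier_coeff :: "(complex \<Rightarrow> complex) \<Rightarrow> int \<Rightarrow> complex" where
  "fourier_coeff g n = (LINT \<zeta>|circle_measure. g \<zeta> * \<zeta> powi (- n))"


section \<open>Hardy spaces\<close>

text \<open>
  An element of \<open>H\<^sup>2\<close> is a class of functions \<open>g\<close> in \<open>L\<^sup>2\<close> of the circle with vanishing negative
  Fourier coefficients, identified with the analytic function \<open>f\<close> on the disc whose Taylor
  coefficients are the Fourier coefficients of \<open>g\<close>. We represent it by \<open>f\<close>, extended by \<open>0\<close> off the
  disc, so that equality in \<open>H\<^sup>2\<close> is equality of functions. The function \<open>g\<close>, unique up to null
  sets (and a.e. the radial limit of \<open>f\<close>), is recovered by \<open>bdry\<close>.
  The vector- and matrix-valued spaces are obtained entrywise.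
\<close>

definition boundary_of :: "(complex \<Rightarrow> complex) \<Rightarrow> (complex \<Rightarrow> complex) \<Rightarrow> bool" where
  "boundary_of f g \<longleftrightarrow>
     g \<in> L2_circle \<and> (\<forall>n<0. fourier_coeff g n = 0) \<and>
     (\<forall>z\<in>ball 0 1. (\<lambda>n. fourier_coeff g (int n) * z ^ n) sums f z) \<and>
     (\<forall>z. z \<notin> ball 0 1 \<longrightarrow> f z = 0)"

definition H2 :: "(complex \<Rightarrow> complex) set" where
  "H2 = {f. \<exists>g. boundary_of f g}"

definition bdry :: "(complex \<Rightarrow> complex) \<Rightarrow> complex \<Rightarrow> complex" where
  "bdry f = (SOME g. boundary_of f g)"

definition H2_vec :: "(complex \<Rightarrow> complex^'d) set" where
  "H2_vec = {f. \<forall>i. (\<lambda>z. f z $ i) \<in> H2}"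

definition bdry_vec :: "(complex \<Rightarrow> complex^'d) \<Rightarrow> complex \<Rightarrow> complex^'d" where
  "bdry_vec f \<zeta> = (\<chi> i. bdry (\<lambda>z. f z $ i) \<zeta>)"

definition H2_mat :: "(complex \<Rightarrow> complex^'d^'d) set" where
  "H2_mat = {F. \<forall>i j. (\<lambda>z. F z $ i $ j) \<in> H2}"

definition bdry_mat :: "(complex \<Rightarrow> complex^'d^'d) \<Rightarrow> complex \<Rightarrow> complex^'d^'d" where
  "bdry_mat F \<zeta> = (\<chi> i j. bdry (\<lambda>z. F z $ i $ j) \<zeta>)"

definition H2_inner :: "(complex \<Rightarrow> complex^'d) \<Rightarrow> (complex \<Rightarrow> complex^'d) \<Rightarrow> complex" where
  "H2_inner f h = L2_inner (bdry_vec f) (bdry_vec h)"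

definition H2_norm :: "(complex \<Rightarrow> complex^'d) \<Rightarrow> real" where
  "H2_norm f = sqrt (LINT \<zeta>|circle_measure. (norm (bdry_vec f \<zeta>))\<^sup>2)"


section \<open>Inner functions and model spaces\<close>

definition inner_function :: "(complex \<Rightarrow> complex^'d^'d) \<Rightarrow> bool" where
  "inner_function \<Theta> \<longleftrightarrow> \<Theta> \<in> H2_mat \<and> (AE \<zeta> in circle_measure. unitary (bdry_mat \<Theta> \<zeta>))"

definition pure_inner :: "(complex \<Rightarrow> complex^'d^'d) \<Rightarrow> bool" where
  "pure_inner \<Theta> \<longleftrightarrow> inner_function \<Theta> \<and> opnorm (\<Theta> 0) < 1"

definition model_space :: "(complex \<Rightarrow> complex^'d^'d) \<Rightarrow> (complex \<Rightarrow> complex^'d) set" where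
  "model_space \<Theta> = {f \<in> H2_vec. \<forall>h\<in>H2_vec. H2_inner f (\<lambda>z. \<Theta> z *v h z) = 0}"

text \<open>The orthogonal projection from \<open>L\<^sup>2\<close> of the circle onto the model space.\<close>

definition model_proj ::
    "(complex \<Rightarrow> complex^'d^'d) \<Rightarrow> (complex \<Rightarrow> complex^'d) \<Rightarrow> complex \<Rightarrow> complex^'d" where
  "model_proj \<Theta> g = (THE h. h \<in> model_space \<Theta> \<and>
     (\<forall>k\<in>model_space \<Theta>. L2_inner (\<lambda>\<zeta>. g \<zeta> - bdry_vec h \<zeta>) (bdry_vec k) = 0))"


section \<open>Truncated Toeplitz operators\<close>

text \<open>
  Operators on a subspace \<open>K\<close> are extensional functions (\<open>undefined\<close> off \<open>K\<close>), so that equality of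
  operators is equality of functions.
\<close>

definition bounded_op_on ::
    "(complex \<Rightarrow> complex^'d) set \<Rightarrow> ((complex \<Rightarrow> complex^'d) \<Rightarrow> complex \<Rightarrow> complex^'d) \<Rightarrow> bool" where
  "bounded_op_on K A \<longleftrightarrow>
     A \<in> K \<rightarrow>\<^sub>E K \<and>
     (\<forall>f\<in>K. \<forall>h\<in>K. A (\<lambda>z. f z + h z) = (\<lambda>z. A f z + A h z)) \<and>
     (\<forall>c. \<forall>f\<in>K. A (\<lambda>z. c *s f z) = (\<lambda>z. c *s A f z)) \<and>
     (\<exists>C. \<forall>f\<in>K. H2_norm (A f) \<le> C * H2_norm f)"

definition truncated_toeplitz ::
    "(complex \<Rightarrow> complex^'d^'d) \<Rightarrow> ((complex \<Rightarrow> complex^'d) \<Rightarrow> complex \<Rightarrow> complex^'d) set" where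
  "truncated_toeplitz \<Theta> = {A. bounded_op_on (model_space \<Theta>) A \<and>
     (\<exists>\<Phi>::complex \<Rightarrow> complex^'d^'d. \<Phi> \<in> L2_circle \<and>
        (\<forall>f\<in>model_space \<Theta>. bounded (f ` ball 0 1) \<longrightarrow>
            A f = model_proj \<Theta> (\<lambda>\<zeta>. \<Phi> \<zeta> *v bdry_vec f \<zeta>)))}"


section \<open>The Crofoot transform\<close>

definition crofoot_inner ::
    "complex^'d^'d \<Rightarrow> (complex \<Rightarrow> complex^'d^'d) \<Rightarrow> complex \<Rightarrow> complex^'d^'d" where
  "crofoot_inner W \<Theta> z =
     (if z \<in> ball 0 1
      then - W + defect_op (adj W) ** matrix_inv (mat 1 - \<Theta> z ** adj W) ** \<Theta> z ** defect_op W
      else 0)"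

definition crofoot ::
    "complex^'d^'d \<Rightarrow> (complex \<Rightarrow> complex^'d^'d) \<Rightarrow> (complex \<Rightarrow> complex^'d) \<Rightarrow> complex \<Rightarrow> complex^'d" where
  "crofoot W \<Theta> = (\<lambda>f\<in>model_space \<Theta>. \<lambda>z.
     if z \<in> ball 0 1
     then (defect_op (adj W) ** matrix_inv (mat 1 - \<Theta> z ** adj W)) *v f z
     else 0)"

text \<open>The Hilbert space adjoint of an operator \<open>J\<close> from \<open>K\<close> to \<open>K'\<close>.\<close>

definition adjoint_op ::
    "(complex \<Rightarrow> complex^'d) set \<Rightarrow> (complex \<Rightarrow> complex^'d) set \<Rightarrow>
     ((complex \<Rightarrow> complex^'d) \<Rightarrow> complex \<Rightarrow> complex^'d) \<Rightarrow>
     ((complex \<Rightarrow> complex^'d) \<Rightarrow> complex \<Rightarrow> complex^'d)" where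
  "adjoint_op K K' J = (\<lambda>g\<in>K'. THE h. h \<in> K \<and> (\<forall>f\<in>K. H2_inner (J f) g = H2_inner f h))"

end

theory Submission
  imports Defs
begin

text \<open>
  The Crofoot transform \<open>J\<close> is multiplication by \<open>M = D\<^sub>*(I - \<Theta> W\<^sup>*)\<^sup>-\<^sup>1\<close>, where \<open>D\<^sub>*\<close> is the defect
  operator of \<open>W\<^sup>*\<close>. As \<open>\<Theta>\<close> is contractive and \<open>W\<close> is a strict contraction, \<open>M\<close> and \<open>M\<^sup>-\<^sup>1\<close> are
  bounded analytic functions. Multiplication by \<open>M\<close> is isometric on the model space \<open>K\<close> of \<open>\<Theta>\<close>
  (\<open>J_isometric\<close>) and maps it onto the model space \<open>K'\<close> of \<open>\<Theta>'\<close> (\<open>J_in_K'\<close>, \<open>J_inv_in_K\<close>); the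
  latter comes from the identity \<open>M\<^sup>* \<Theta>' h = (I - \<Theta> W\<^sup>*)\<^sup>-\<^sup>1 \<Theta> D h\<close> on the circle
  (\<open>J_adjoint_identity\<close>), with \<open>D\<close> the defect operator of \<open>W\<close>.

  Hence the projections onto the two model spaces satisfy \<open>P' g = J P (M\<^sup>* g)\<close> for \<open>g \<in> L\<^sup>2\<close>
  (\<open>model_proj_crofoot\<close>), so that for bounded \<open>f \<in> K\<close>
  \<open>J\<^sup>* P' (\<Phi> J f) = P (M\<^sup>* \<Phi> M f)\<close> (\<open>model_proj_symbol\<close>). Since \<open>f\<close> is bounded if and only if \<open>J f\<close> is,
  conjugation with \<open>J\<close> turns an operator on \<open>K'\<close> with symbol \<open>\<Phi>\<close> into one on \<open>K\<close> with symbol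
  \<open>M\<^sup>* \<Phi> M\<close>, and every symbol in \<open>L\<^sup>2\<close> has this form. No intrinsic characterization of truncated
  Toeplitz operators is needed.

  What precedes this is the theory of \<open>H\<^sup>2\<close> that it rests on: uniqueness of Fourier coefficients
  (\<open>fourier_unique\<close>, by the Stone--Weierstrass theorem), existence of the Riesz projection
  (\<open>Riesz_projection_exists\<close>, by completeness of \<open>L\<^sup>2\<close>), boundary values of products
  (\<open>boundary_of_mult\<close>), the equivalence of boundedness in the disc and on the circle
  (\<open>boundary_bound_imp_bound\<close>, \<open>bound_imp_boundary_bound\<close>), and boundary values of
  \<open>(I - \<Theta> W\<^sup>*)\<^sup>-\<^sup>1\<close> via the Neumann series (\<open>resolvent_boundary\<close>). The defect operators are handled
  by an iteration for positive square roots (\<open>positive_sqrt_exists\<close>) and a Sylvester equation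
  (\<open>Sylvester_zero\<close>), which gives their uniqueness and the relation \<open>D\<^sub>* W = W D\<close>.
\<close>

abbreviation (input) "\<mu> \<equiv> circle_measure"

abbreviation (input) "coef \<equiv> fourier_coeff"

abbreviation (input) "sq_norm g \<equiv> LINT \<zeta>|circle_measure. (norm (g \<zeta>))\<^sup>2"

section \<open>Integration on the circle\<close>

lemma sets_circle [measurable_cong, simp]: "sets \<mu> = sets borel"
  by (simp add: circle_measure_def)

lemma space_circle [simp]: "space \<mu> = UNIV"
  by (simp add: circle_measure_def)

lemma borel_measurable_circle [simp]: "borel_measurable \<mu> = borel_measurable borel"
  by (rule measurable_cong_sets) simp_all

lemma inverse_eq_cnj: "norm z = 1 \<Longrightarrow> inverse z = cnj z"
  by (simp add: complex_div_cnj[of 1] divide_inverse[symmetric] inverse_eq_divide)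

lemma cis_measurable [measurable]: "cis \<in> borel_measurable borel"
  by (intro borel_measurable_continuous_onI continuous_intros)

lemma uniform_measure_circle_density:
  "uniform_measure lborel {0..2*pi} = density lborel (\<lambda>t. ennreal (indicator {0..2*pi} t / (2*pi)))"
  unfolding uniform_measure_def
proof (rule density_cong)
  have "1 / ennreal (2 * pi) = ennreal (1 / (2 * pi))"
    by (metis ennreal_1 divide_ennreal pi_gt_zero zero_le_one mult_pos_pos zero_less_numeral)
  then show "AE t in lborel. indicator {0..2 * pi} t / emeasure lborel {0..2 * pi}
      = ennreal (indicator {0..2 * pi} t / (2 * pi))"
    by (auto simp: indicator_def split: if_splits)
qed auto

lemma integral_circle:
  fixes f :: "complex \<Rightarrow> 'a::{banach, second_countable_topology}"
  assumes [measurable]: "f \<in> borel_measurable borel"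
  shows "(LINT \<zeta>|\<mu>. f \<zeta>) = (1/(2*pi)) *\<^sub>R (LINT t|lborel. indicator {0..2*pi} t *\<^sub>R f (cis t))"
proof -
  have "(LINT \<zeta>|\<mu>. f \<zeta>) = (LINT t|uniform_measure lborel {0..2*pi}. f (cis t))"
    unfolding circle_measure_def by (rule integral_distr) (auto)
  also have "\<dots> = (LINT t|lborel. (indicator {0..2*pi} t / (2*pi)) *\<^sub>R f (cis t))"
    unfolding uniform_measure_circle_density by (rule integral_density) auto
  also have "\<dots> = (LINT t|lborel. (1/(2*pi)) *\<^sub>R (indicator {0..2*pi} t *\<^sub>R f (cis t)))"
    by (rule Bochner_Integration.integral_cong) auto
  also have "\<dots> = (1/(2*pi)) *\<^sub>R (LINT t|lborel. indicator {0..2*pi} t *\<^sub>R f (cis t))"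
    by (rule integral_scaleR_right)
  finally show ?thesis .
qed

lemma emeasure_circle_UNIV: "emeasure \<mu> UNIV = 1"
proof -
  have e: "emeasure lborel {0..2*pi} = ennreal (2*pi)" by simp
  have "emeasure (uniform_measure lborel {0..2*pi}) {0..2*pi} = 1"
    by (rule emeasure_uniform_measure_1) (simp_all add: e)
  then have "emeasure (uniform_measure lborel {0..2*pi}) UNIV = 1" by simp
  then show ?thesis unfolding circle_measure_def
    by (subst emeasure_distr) auto
qed

interpretation circle: finite_measure \<mu>
  by standard (simp add: emeasure_circle_UNIV)

lemma measure_circle_UNIV [simp]: "measure \<mu> UNIV = 1"
  by (simp add: measure_def emeasure_circle_UNIV)

lemma AE_circle_norm_1: "AE \<zeta> in \<mu>. norm \<zeta> = 1"
  unfolding circle_measure_def by (subst AE_distr_iff) auto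

lemma powi_measurable [measurable]: "(\<lambda>\<zeta>::complex. \<zeta> powi n) \<in> borel_measurable borel"
  by (cases n) (auto simp: power_int_def)

lemma integral_circle_powi:
  "(LINT \<zeta>|\<mu>. \<zeta> powi n) = (if n = 0 then 1 else 0)"
proof -
  have "(LINT t|lborel. indicator {0..2*pi} t *\<^sub>R (cis t powi n)) = (if n = 0 then of_real (2*pi) else 0)"
  proof (cases "n = 0")
    case True
    then show ?thesis by (simp add: scaleR_conv_of_real)
  next
    case False
    define F where "F = (\<lambda>t::real. - \<i> / of_int n * exp (\<i> * of_int n * of_real t))"
    have c: "cis t powi n = exp (\<i> * of_int n * of_real t)" for t
      unfolding cis_power_int by (simp add: cis_conv_exp mult_ac)
    have "((\<lambda>z. - \<i> / of_int n * exp (\<i> * of_int n * z)) has_field_derivative (cis t powi n)) (at (of_real t))" for t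
      unfolding c using False by (auto intro!: derivative_eq_intros)
    from has_vector_derivative_real_field[OF this]
    have d: "(F has_vector_derivative (cis t powi n)) (at t within {0..2*pi})" for t
      unfolding F_def .
    have "(LINT t|lborel. indicator {0..2*pi} t *\<^sub>R (cis t powi n)) = F (2*pi) - F 0"
      unfolding c by (rule integral_FTC_atLeastAtMost) (auto intro!: d[unfolded c] continuous_intros)
    also have "exp (\<i> * of_int n * of_real (2*pi)) = 1"
      by (auto simp: exp_eq_1 intro!: exI[of _ n])
    then have "F (2*pi) - F 0 = 0" by (simp add: F_def)
    finally show ?thesis using False by simp
  qed
  then show ?thesis by (simp add: integral_circle scaleR_conv_of_real)
qed

section \<open>Square-integrable functions on the circle\<close>

lemma L2_circle_iff:
  "g \<in> L2_circle \<longleftrightarrow> g \<in> borel_measurable borel \<and> integrable \<mu> (\<lambda>\<zeta>. (norm (g \<zeta>))\<^sup>2)"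
  by (simp add: L2_circle_def)

lemma L2_measurable: "g \<in> L2_circle \<Longrightarrow> g \<in> borel_measurable borel"
  by (simp add: L2_circle_def)

lemma L2_dominated:
  fixes g :: "complex \<Rightarrow> 'a::euclidean_space" and h :: "complex \<Rightarrow> 'b::euclidean_space"
  assumes h: "h \<in> L2_circle" and [measurable]: "g \<in> borel_measurable borel"
    and le: "AE \<zeta> in \<mu>. norm (g \<zeta>) \<le> C * norm (h \<zeta>)"
  shows "g \<in> L2_circle"
proof -
  have "integrable \<mu> (\<lambda>\<zeta>. (norm (g \<zeta>))\<^sup>2)"
  proof (rule Bochner_Integration.integrable_bound)
    show "integrable \<mu> (\<lambda>\<zeta>. C\<^sup>2 * (norm (h \<zeta>))\<^sup>2)"
      using h by (simp add: L2_circle_iff)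
    show "AE \<zeta> in \<mu>. norm ((norm (g \<zeta>))\<^sup>2) \<le> norm (C\<^sup>2 * (norm (h \<zeta>))\<^sup>2)"
      using le by eventually_elim (auto simp: power_mult_distrib[symmetric] intro: power_mono)
  qed simp
  then show ?thesis by (simp add: L2_circle_iff)
qed

lemma L2_bounded:
  fixes g :: "complex \<Rightarrow> 'a::euclidean_space"
  assumes "g \<in> borel_measurable borel" "AE \<zeta> in \<mu>. norm (g \<zeta>) \<le> C"
  shows "g \<in> L2_circle"
proof (rule L2_dominated[where h="\<lambda>_. 1::real"])
  show "(\<lambda>_. 1::real) \<in> L2_circle" by (simp add: L2_circle_iff)
qed (use assms in auto)

lemma norm_add_power2_le: "(norm (a + b))\<^sup>2 \<le> 2 * (norm a)\<^sup>2 + 2 * (norm (b::'a::real_normed_vector))\<^sup>2"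
proof -
  have "(norm (a + b))\<^sup>2 \<le> (norm a + norm b)\<^sup>2"
    by (intro power_mono norm_triangle_ineq) auto
  also have "\<dots> \<le> 2 * (norm a)\<^sup>2 + 2 * (norm b)\<^sup>2"
    using sum_squares_bound[of "norm a" "norm b"] by (simp add: power2_sum)
  finally show ?thesis .
qed

lemma L2_add:
  fixes g h :: "complex \<Rightarrow> 'a::euclidean_space"
  assumes g: "g \<in> L2_circle" and h: "h \<in> L2_circle"
  shows "(\<lambda>\<zeta>. g \<zeta> + h \<zeta>) \<in> L2_circle"
proof -
  have [measurable]: "g \<in> borel_measurable borel" "h \<in> borel_measurable borel"
    using g h by (auto simp: L2_circle_iff)
  have "integrable \<mu> (\<lambda>\<zeta>. (norm (g \<zeta> + h \<zeta>))\<^sup>2)"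
  proof (rule Bochner_Integration.integrable_bound)
    show "integrable \<mu> (\<lambda>\<zeta>. 2 * (norm (g \<zeta>))\<^sup>2 + 2 * (norm (h \<zeta>))\<^sup>2)"
      using g h by (simp add: L2_circle_iff)
  qed (auto intro!: AE_I2 order_trans[OF norm_add_power2_le])
  then show ?thesis by (simp add: L2_circle_iff)
qed

lemma L2_cmult:
  fixes g :: "complex \<Rightarrow> complex"
  assumes "g \<in> L2_circle" shows "(\<lambda>\<zeta>. c * g \<zeta>) \<in> L2_circle"
  using assms by (auto simp: L2_circle_iff norm_mult power_mult_distrib)

lemma L2_uminus:
  fixes g :: "complex \<Rightarrow> 'a::euclidean_space"
  assumes "g \<in> L2_circle" shows "(\<lambda>\<zeta>. - g \<zeta>) \<in> L2_circle"
  using assms by (auto simp: L2_circle_iff)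

lemma L2_diff:
  fixes g h :: "complex \<Rightarrow> 'a::euclidean_space"
  assumes "g \<in> L2_circle" "h \<in> L2_circle"
  shows "(\<lambda>\<zeta>. g \<zeta> - h \<zeta>) \<in> L2_circle"
  using L2_add[OF assms(1) L2_uminus[OF assms(2)]] by simp

lemma L2_zero [simp]: "(\<lambda>_. 0) \<in> L2_circle"
  by (simp add: L2_circle_iff)

lemma L2_sum:
  fixes g :: "'i \<Rightarrow> complex \<Rightarrow> 'a::euclidean_space"
  assumes "\<And>i. i \<in> I \<Longrightarrow> g i \<in> L2_circle"
  shows "(\<lambda>\<zeta>. \<Sum>i\<in>I. g i \<zeta>) \<in> L2_circle"
  using assms by (induction I rule: infinite_finite_induct) (auto intro!: L2_add)

lemma L2_powi: "(\<lambda>\<zeta>::complex. \<zeta> powi n) \<in> L2_circle"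
proof (rule L2_bounded)
  show "AE \<zeta>::complex in \<mu>. norm (\<zeta> powi n) \<le> 1"
    using AE_circle_norm_1 by eventually_elim (simp add: norm_power_int)
qed measurable

lemma cnj_measurable [measurable]: "cnj \<in> borel_measurable borel"
  by (intro borel_measurable_continuous_onI continuous_intros)

lemma L2_cnj: "g \<in> L2_circle \<Longrightarrow> (\<lambda>\<zeta>. cnj (g \<zeta>)) \<in> L2_circle"
  by (auto simp: L2_circle_iff)

lemma L2_mult_integrable:
  fixes g h :: "complex \<Rightarrow> complex"
  assumes g: "g \<in> L2_circle" and h: "h \<in> L2_circle"
  shows "integrable \<mu> (\<lambda>\<zeta>. g \<zeta> * h \<zeta>)"
proof -
  have [measurable]: "g \<in> borel_measurable borel" "h \<in> borel_measurable borel"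
    using g h by (auto simp: L2_circle_iff)
  show ?thesis
  proof (rule Bochner_Integration.integrable_bound)
    show "integrable \<mu> (\<lambda>\<zeta>. (norm (g \<zeta>))\<^sup>2 + (norm (h \<zeta>))\<^sup>2)"
      using g h by (simp add: L2_circle_iff)
    show "AE \<zeta> in \<mu>. norm (g \<zeta> * h \<zeta>) \<le> norm ((norm (g \<zeta>))\<^sup>2 + (norm (h \<zeta>))\<^sup>2)"
    proof (rule AE_I2)
      fix \<zeta>
      have "2 * norm (g \<zeta>) * norm (h \<zeta>) \<le> (norm (g \<zeta>))\<^sup>2 + (norm (h \<zeta>))\<^sup>2"
        by (rule sum_squares_bound)
      moreover have "0 \<le> norm (g \<zeta>) * norm (h \<zeta>)" by simp
      ultimately show "norm (g \<zeta> * h \<zeta>) \<le> norm ((norm (g \<zeta>))\<^sup>2 + (norm (h \<zeta>))\<^sup>2)"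
        unfolding norm_mult real_norm_def by linarith
    qed
  qed simp
qed

lemma L2_integrable:
  fixes g :: "complex \<Rightarrow> complex"
  assumes "g \<in> L2_circle" shows "integrable \<mu> g"
  using L2_mult_integrable[OF assms L2_powi[of 0]] by simp

lemma Cauchy_Schwarz_circle:
  fixes g h :: "complex \<Rightarrow> complex"
  assumes g: "g \<in> L2_circle" and h: "h \<in> L2_circle"
  shows "(norm (LINT \<zeta>|\<mu>. g \<zeta> * h \<zeta>))\<^sup>2
     \<le> sq_norm g * sq_norm h"
proof -
  have [measurable]: "g \<in> borel_measurable borel" "h \<in> borel_measurable borel"
    using g h by (auto simp: L2_circle_iff)
  have i: "integrable \<mu> (\<lambda>\<zeta>. norm (g \<zeta>) * norm (h \<zeta>))"
    using L2_mult_integrable[OF g h] by (simp add: norm_mult[symmetric])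
  have 1: "(\<integral>\<^sup>+\<zeta>. ennreal (norm (g \<zeta>)) * ennreal (norm (h \<zeta>)) \<partial>\<mu>)
     = ennreal (LINT \<zeta>|\<mu>. norm (g \<zeta>) * norm (h \<zeta>))"
    by (subst nn_integral_eq_integral[symmetric, OF i]) (auto simp: ennreal_mult)
  have 2: "(\<integral>\<^sup>+\<zeta>. ennreal (norm (f \<zeta>)) ^ 2 \<partial>\<mu>) = ennreal (sq_norm f)"
    if "f \<in> L2_circle" for f :: "complex \<Rightarrow> complex"
    using that by (subst nn_integral_eq_integral[symmetric]) (auto simp: L2_circle_iff ennreal_power)
  have "ennreal ((LINT \<zeta>|\<mu>. norm (g \<zeta>) * norm (h \<zeta>))\<^sup>2)
     \<le> ennreal (sq_norm g * sq_norm h)"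
    using Cauchy_Schwarz_nn_integral[of "\<lambda>\<zeta>. ennreal (norm (g \<zeta>))" \<mu> "\<lambda>\<zeta>. ennreal (norm (h \<zeta>))"]
    by (simp add: 1 2 g h ennreal_mult ennreal_power[symmetric])
  then have "(LINT \<zeta>|\<mu>. norm (g \<zeta>) * norm (h \<zeta>))\<^sup>2
     \<le> sq_norm g * sq_norm h"
    by (subst (asm) ennreal_le_iff) auto
  moreover have "norm (LINT \<zeta>|\<mu>. g \<zeta> * h \<zeta>) \<le> (LINT \<zeta>|\<mu>. norm (g \<zeta>) * norm (h \<zeta>))"
    using integral_norm_bound[of \<mu> "\<lambda>\<zeta>. g \<zeta> * h \<zeta>"] by (simp add: norm_mult)
  ultimately show ?thesis
    by (meson norm_ge_zero order_trans power_mono)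
qed

lemma L1_norm_le_L2_norm:
  fixes g :: "complex \<Rightarrow> complex"
  assumes "g \<in> L2_circle"
  shows "(LINT \<zeta>|\<mu>. norm (g \<zeta>))\<^sup>2 \<le> sq_norm g"
proof -
  have "(\<lambda>\<zeta>. of_real (norm (g \<zeta>)) :: complex) \<in> L2_circle"
    using assms by (auto simp: L2_circle_iff)
  from Cauchy_Schwarz_circle[OF this L2_powi[of 0]] show ?thesis by simp
qed

text \<open>Completeness: an \<open>L\<^sup>2\<close> Cauchy sequence is Cauchy in \<open>L\<^sup>1\<close>, hence has a subsequence
  converging almost everywhere; Fatou's lemma turns this into convergence in \<open>L\<^sup>2\<close>.\<close>

lemma L2_complete:
  fixes u :: "nat \<Rightarrow> complex \<Rightarrow> complex"
  assumes u: "\<And>n. u n \<in> L2_circle"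
    and cau: "\<And>e. e > 0 \<Longrightarrow> \<exists>N. \<forall>m\<ge>N. \<forall>n\<ge>N. (sq_norm (\<lambda>\<zeta>. u m \<zeta> - u n \<zeta>)) < e"
  obtains g where "g \<in> L2_circle" "(\<lambda>n. LINT \<zeta>|\<mu>. (norm (u n \<zeta> - g \<zeta>))\<^sup>2) \<longlonglongrightarrow> 0"
proof -
  have [measurable]: "u n \<in> borel_measurable borel" for n using u by (auto simp: L2_circle_iff)
  have d: "(\<lambda>\<zeta>. u m \<zeta> - u n \<zeta>) \<in> L2_circle" for m n by (rule L2_diff[OF u u])
  have "\<exists>N. \<forall>i\<ge>N. \<forall>j\<ge>N. (LINT \<zeta>|\<mu>. norm (u i \<zeta> - u j \<zeta>)) < e" if "e > 0" for e :: real
  proof -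
    obtain N where N: "\<And>m n. m \<ge> N \<Longrightarrow> n \<ge> N \<Longrightarrow> (sq_norm (\<lambda>\<zeta>. u m \<zeta> - u n \<zeta>)) < e\<^sup>2"
      using cau[of "e\<^sup>2"] \<open>e > 0\<close> by auto
    have "(LINT \<zeta>|\<mu>. norm (u i \<zeta> - u j \<zeta>)) < e" if "i \<ge> N" "j \<ge> N" for i j
    proof -
      have "(LINT \<zeta>|\<mu>. norm (u i \<zeta> - u j \<zeta>))\<^sup>2 < e\<^sup>2"
        using L1_norm_le_L2_norm[OF d[of i j]] N[OF that] by linarith
      then show ?thesis using \<open>e > 0\<close> power_less_imp_less_base by fastforce
    qed
    then show ?thesis by blast
  qed
  then obtain r where r: "strict_mono r" "AE \<zeta> in \<mu>. Cauchy (\<lambda>i. u (r i) \<zeta>)"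
    using cauchy_L1_AE_cauchy_subseq[of \<mu> u] L2_integrable[OF u] by blast
  define g where "g = (\<lambda>\<zeta>. lim (\<lambda>i. u (r i) \<zeta>))"
  have gm [measurable]: "g \<in> borel_measurable borel" unfolding g_def by measurable
  have lim: "AE \<zeta> in \<mu>. (\<lambda>i. u (r i) \<zeta>) \<longlonglongrightarrow> g \<zeta>"
    using r(2) by eventually_elim (simp add: g_def Cauchy_convergent_iff convergent_LIMSEQ_iff)
  have key: "\<exists>N. \<forall>n\<ge>N. (\<integral>\<^sup>+\<zeta>. ennreal ((norm (u n \<zeta> - g \<zeta>))\<^sup>2) \<partial>\<mu>) \<le> ennreal e" if "e > 0" for e
  proof -
    obtain N where N: "\<And>m n. m \<ge> N \<Longrightarrow> n \<ge> N \<Longrightarrow> (sq_norm (\<lambda>\<zeta>. u m \<zeta> - u n \<zeta>)) < e"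
      using cau[OF \<open>e > 0\<close>] by auto
    have "(\<integral>\<^sup>+\<zeta>. ennreal ((norm (u n \<zeta> - g \<zeta>))\<^sup>2) \<partial>\<mu>) \<le> ennreal e" if n: "n \<ge> N" for n
    proof -
      have "(\<integral>\<^sup>+\<zeta>. ennreal ((norm (u n \<zeta> - g \<zeta>))\<^sup>2) \<partial>\<mu>)
        = (\<integral>\<^sup>+\<zeta>. liminf (\<lambda>i. ennreal ((norm (u n \<zeta> - u (r i) \<zeta>))\<^sup>2)) \<partial>\<mu>)"
      proof (rule nn_integral_cong_AE)
        show "AE \<zeta> in \<mu>. ennreal ((norm (u n \<zeta> - g \<zeta>))\<^sup>2)
           = liminf (\<lambda>i. ennreal ((norm (u n \<zeta> - u (r i) \<zeta>))\<^sup>2))"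
          using lim
        proof eventually_elim
          case (elim \<zeta>)
          have "(\<lambda>i. ennreal ((norm (u n \<zeta> - u (r i) \<zeta>))\<^sup>2)) \<longlonglongrightarrow> ennreal ((norm (u n \<zeta> - g \<zeta>))\<^sup>2)"
            by (intro tendsto_ennrealI tendsto_intros elim)
          then show ?case by (rule lim_imp_Liminf[symmetric, rotated]) simp
        qed
      qed
      also have "\<dots> \<le> liminf (\<lambda>i. \<integral>\<^sup>+\<zeta>. ennreal ((norm (u n \<zeta> - u (r i) \<zeta>))\<^sup>2) \<partial>\<mu>)"
        by (rule nn_integral_liminf) measurable
      also have "\<dots> \<le> liminf (\<lambda>i. ennreal e)"
      proof (rule Liminf_mono, rule eventually_sequentiallyI[of N])
        fix i assume "i \<ge> N"
        then have "r i \<ge> N" using seq_suble[OF r(1), of i] by linarith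
        from N[OF n this]
        show "(\<integral>\<^sup>+\<zeta>. ennreal ((norm (u n \<zeta> - u (r i) \<zeta>))\<^sup>2) \<partial>\<mu>) \<le> ennreal e"
          using d[of n "r i"] by (subst nn_integral_eq_integral) (auto simp: L2_circle_iff intro!: ennreal_leI)
      qed
      also have "\<dots> = ennreal e" by (simp add: Liminf_const)
      finally show ?thesis .
    qed
    then show ?thesis by blast
  qed
  obtain N1 where N1: "\<And>n. n \<ge> N1 \<Longrightarrow> (\<integral>\<^sup>+\<zeta>. ennreal ((norm (u n \<zeta> - g \<zeta>))\<^sup>2) \<partial>\<mu>) \<le> ennreal 1"
    using key[of 1] by auto
  have "(\<lambda>\<zeta>. u N1 \<zeta> - g \<zeta>) \<in> L2_circle"
    using N1[of N1] by (auto simp: L2_circle_iff intro!: integrableI_bounded intro: le_less_trans)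
  from L2_diff[OF u[of N1] this] have gL: "g \<in> L2_circle" by simp
  have "(\<lambda>n. LINT \<zeta>|\<mu>. (norm (u n \<zeta> - g \<zeta>))\<^sup>2) \<longlonglongrightarrow> 0"
  proof (rule LIMSEQ_I)
    fix e :: real assume e: "0 < e"
    obtain N where N: "\<And>n. n \<ge> N \<Longrightarrow> (\<integral>\<^sup>+\<zeta>. ennreal ((norm (u n \<zeta> - g \<zeta>))\<^sup>2) \<partial>\<mu>) \<le> ennreal (e/2)"
      using key[of "e/2"] e by auto
    have "norm ((sq_norm (\<lambda>\<zeta>. u n \<zeta> - g \<zeta>)) - 0) < e" if "n \<ge> N" for n
    proof -
      have "sq_norm (\<lambda>\<zeta>. u n \<zeta> - g \<zeta>) \<le> e/2"
        using N[OF that] L2_diff[OF u[of n] gL] e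
        by (subst (asm) nn_integral_eq_integral) (auto simp: L2_circle_iff)
      then show ?thesis using e by simp
    qed
    then show "\<exists>N. \<forall>n\<ge>N. norm ((sq_norm (\<lambda>\<zeta>. u n \<zeta> - g \<zeta>)) - 0) < e" by blast
  qed
  with gL show ?thesis using that by blast
qed

section \<open>Fourier coefficients\<close>

lemma fourier_integrable:
  assumes "integrable \<mu> g"
  shows "integrable \<mu> (\<lambda>\<zeta>. g \<zeta> * \<zeta> powi n)"
proof (rule Bochner_Integration.integrable_bound[OF assms])
  show "AE \<zeta> in \<mu>. norm (g \<zeta> * \<zeta> powi n) \<le> norm (g \<zeta>)"
    using AE_circle_norm_1 by eventually_elim (simp add: norm_mult norm_power_int)
  show "(\<lambda>\<zeta>. g \<zeta> * \<zeta> powi n) \<in> borel_measurable \<mu>"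
    using borel_measurable_integrable[OF assms] by measurable
qed

lemma fourier_norm_le:
  assumes "integrable \<mu> g"
  shows "norm (coef g n) \<le> (LINT \<zeta>|\<mu>. norm (g \<zeta>))"
proof -
  have "norm (coef g n) \<le> (LINT \<zeta>|\<mu>. norm (g \<zeta> * \<zeta> powi (-n)))"
    unfolding fourier_coeff_def by (rule integral_norm_bound)
  also have "\<dots> = (LINT \<zeta>|\<mu>. norm (g \<zeta>))"
  proof (rule integral_cong_AE)
    show "AE \<zeta> in \<mu>. norm (g \<zeta> * \<zeta> powi (-n)) = norm (g \<zeta>)"
      using AE_circle_norm_1 by eventually_elim (simp add: norm_mult norm_power_int)
    show "(\<lambda>\<zeta>. norm (g \<zeta> * \<zeta> powi (-n))) \<in> borel_measurable \<mu>"
      using borel_measurable_integrable[OF fourier_integrable[OF assms]] by measurable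
    show "(\<lambda>\<zeta>. norm (g \<zeta>)) \<in> borel_measurable \<mu>"
      using borel_measurable_integrable[OF assms] by measurable
  qed
  finally show ?thesis .
qed

lemma fourier_add:
  assumes "integrable \<mu> g" "integrable \<mu> h"
  shows "coef (\<lambda>\<zeta>. g \<zeta> + h \<zeta>) n = coef g n + coef h n"
  unfolding fourier_coeff_def
  using assms by (simp add: distrib_right fourier_integrable)

lemma fourier_diff:
  assumes "integrable \<mu> g" "integrable \<mu> h"
  shows "coef (\<lambda>\<zeta>. g \<zeta> - h \<zeta>) n = coef g n - coef h n"
  unfolding fourier_coeff_def
  using assms by (simp add: left_diff_distrib fourier_integrable)

lemma fourier_cmult: "coef (\<lambda>\<zeta>. c * g \<zeta>) n = c * coef g n"
  unfolding fourier_coeff_def by (simp add: mult.assoc)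

lemma fourier_zero: "coef (\<lambda>\<zeta>. 0) n = 0"
  unfolding fourier_coeff_def by simp

lemma fourier_sum:
  assumes "\<And>i. i \<in> I \<Longrightarrow> integrable \<mu> (g i)"
  shows "coef (\<lambda>\<zeta>. \<Sum>i\<in>I. g i \<zeta>) n = (\<Sum>i\<in>I. coef (g i) n)"
  using assms by (induction I rule: infinite_finite_induct)
    (auto simp: fourier_zero fourier_add)

lemma fourier_coeff_cong_AE:
  assumes "g \<in> borel_measurable borel" "h \<in> borel_measurable borel" "AE \<zeta> in \<mu>. g \<zeta> = h \<zeta>"
  shows "coef g n = coef h n"
  unfolding fourier_coeff_def
proof (rule integral_cong_AE)
  show "(\<lambda>\<zeta>. g \<zeta> * \<zeta> powi - n) \<in> borel_measurable \<mu>"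
       "(\<lambda>\<zeta>. h \<zeta> * \<zeta> powi - n) \<in> borel_measurable \<mu>" using assms(1,2) by simp_all
qed (use assms(3) in \<open>eventually_elim, simp\<close>)

lemma circle_powi_mult: "AE \<zeta>::complex in \<mu>. \<zeta> powi m * \<zeta> powi n = \<zeta> powi (m + n)"
  using AE_circle_norm_1 by eventually_elim (subst power_int_add, auto)

lemma fourier_powi_shift:
  assumes [measurable]: "g \<in> borel_measurable borel"
  shows "coef (\<lambda>\<zeta>. \<zeta> powi k * g \<zeta>) n = coef g (n - k)"
  unfolding fourier_coeff_def
proof (rule integral_cong_AE)
  show "AE \<zeta> in \<mu>. \<zeta> powi k * g \<zeta> * \<zeta> powi - n = g \<zeta> * \<zeta> powi - (n - k)"
    using circle_powi_mult[of k "-n"] by eventually_elim (simp add: algebra_simps)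
qed measurable

lemma fourier_powi: "coef (\<lambda>\<zeta>. \<zeta> powi k) n = (if n = k then 1 else 0)"
  using fourier_powi_shift[of "\<lambda>_. 1" k n] by (simp add: fourier_coeff_def integral_circle_powi)

text \<open>On the circle the coordinate functions are combinations of \<open>\<zeta>\<close> and \<open>\<zeta>\<^sup>-\<^sup>1\<close>, multiplication by
  which only shifts Fourier coefficients. The functions all of whose coefficients vanish are
  therefore stable under multiplication by real polynomials.\<close>

lemma polynomial_preserves_fourier_zero:
  fixes p :: "complex \<Rightarrow> real"
  assumes "real_polynomial_function p"
    and "integrable \<mu> h" "\<And>n. coef h n = 0"
  shows "integrable \<mu> (\<lambda>\<zeta>. of_real (p \<zeta>) * h \<zeta>) \<and>
         (\<forall>n. coef (\<lambda>\<zeta>. of_real (p \<zeta>) * h \<zeta>) n = 0)"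
  using assms
proof (induction arbitrary: h rule: real_polynomial_function.induct)
  case (linear f)
  interpret f: bounded_linear f by (rule linear(1))
  have [measurable]: "h \<in> borel_measurable borel"
    using borel_measurable_integrable[OF linear(2)] by simp
  have [measurable]: "f \<in> borel_measurable borel"
    by (intro borel_measurable_continuous_onI linear_continuous_on linear)
  define a b where "a = (of_real (f 1) - \<i> * of_real (f \<i>)) / 2" and "b = (of_real (f 1) + \<i> * of_real (f \<i>)) / 2"
  have f: "of_real (f \<zeta>) = a * \<zeta> + b * inverse \<zeta>" if "norm \<zeta> = 1" for \<zeta>
  proof -
    have "\<zeta> = Re \<zeta> *\<^sub>R 1 + Im \<zeta> *\<^sub>R \<i>" by (simp add: complex_eq_iff)
    then have 1: "f \<zeta> = Re \<zeta> * f 1 + Im \<zeta> * f \<i>"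
      by (metis f.add f.scaleR real_scaleR_def)
    have "inverse \<zeta> = cnj \<zeta>" using that by (rule inverse_eq_cnj)
    moreover have "of_real (f \<zeta>) = a * \<zeta> + b * cnj \<zeta>"
      by (simp add: 1 a_def b_def complex_eq_iff field_simps)
    ultimately show ?thesis by simp
  qed
  have eq: "AE \<zeta> in \<mu>. a * (\<zeta> powi 1 * h \<zeta>) + b * (\<zeta> powi (-1) * h \<zeta>) = of_real (f \<zeta>) * h \<zeta>"
    using AE_circle_norm_1 by eventually_elim (simp add: f algebra_simps power_int_minus)
  have i: "integrable \<mu> (\<lambda>\<zeta>. \<zeta> powi k * h \<zeta>)" for k
    using fourier_integrable[OF linear(2), of k] by (simp add: mult.commute)
  have "integrable \<mu> (\<lambda>\<zeta>. a * (\<zeta> powi k * h \<zeta>) + b * (\<zeta> powi l * h \<zeta>))"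
    "coef (\<lambda>\<zeta>. a * (\<zeta> powi k * h \<zeta>) + b * (\<zeta> powi l * h \<zeta>)) n = 0" for k l n
    by (auto simp: i fourier_add fourier_cmult fourier_powi_shift linear(3))
  note Z = this[of 1 "-1"]
  have "integrable \<mu> (\<lambda>\<zeta>. of_real (f \<zeta>) * h \<zeta>)"
    by (rule integrable_cong_AE_imp[OF Z(1) _ eq]) simp
  moreover have "coef (\<lambda>\<zeta>. of_real (f \<zeta>) * h \<zeta>) n = 0" for n
    unfolding Z(2)[of n, symmetric]
    by (rule fourier_coeff_cong_AE) (use eq in \<open>measurable, eventually_elim, simp\<close>)
  ultimately show ?case by blast
next
  case (const c)
  then show ?case by (auto simp: fourier_cmult)
next
  case (add f g)
  then show ?case by (auto simp: distrib_right fourier_add)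
next
  case (mult f g)
  have "integrable \<mu> (\<lambda>\<zeta>. of_real (g \<zeta>) * h \<zeta>) \<and> (\<forall>n. coef (\<lambda>\<zeta>. of_real (g \<zeta>) * h \<zeta>) n = 0)"
    by (rule mult.IH(2)[OF mult.prems])
  then have "integrable \<mu> (\<lambda>\<zeta>. of_real (f \<zeta>) * (of_real (g \<zeta>) * h \<zeta>)) \<and>
     (\<forall>n. coef (\<lambda>\<zeta>. of_real (f \<zeta>) * (of_real (g \<zeta>) * h \<zeta>)) n = 0)"
    by (intro mult.IH(1)) auto
  then show ?case by (simp add: mult.assoc)
qed

text \<open>Polynomials approximate continuous functions uniformly on the circle, and these approximate
  indicators of closed sets boundedly and pointwise.\<close>

lemma fourier_zero_imp_set_integral_zero:
  assumes g: "integrable \<mu> g" and z: "\<And>n. coef g n = 0" and F: "closed F"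
  shows "(LINT \<zeta>:F|\<mu>. g \<zeta>) = 0"
proof (cases "F = {}")
  case True
  then show ?thesis by (simp add: set_lebesgue_integral_def)
next
  case False
  have [measurable]: "g \<in> borel_measurable borel" "F \<in> sets borel"
    using borel_measurable_integrable[OF g] F by auto
  \<comment> \<open>continuous functions decreasing to the indicator of \<open>F\<close>\<close>
  define \<phi> where "\<phi> = (\<lambda>k::nat. \<lambda>\<zeta>. max 0 (1 - real k * infdist \<zeta> F))"
  have "\<exists>p. real_polynomial_function p \<and> (\<forall>\<zeta>\<in>sphere 0 1. \<bar>\<phi> k \<zeta> - p \<zeta>\<bar> < 1 / real (Suc k))" for k
  proof -
    have "continuous_on (sphere 0 1) (\<phi> k)" unfolding \<phi>_def by (intro continuous_intros)
    from Stone_Weierstrass_real_polynomial_function[OF compact_sphere this, of "1 / real (Suc k)"]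
    show ?thesis by (metis of_nat_0_less_iff zero_less_Suc zero_less_divide_1_iff)
  qed
  then obtain p where p: "\<And>k. real_polynomial_function (p k)"
    and pc: "\<And>k \<zeta>. norm \<zeta> = 1 \<Longrightarrow> \<bar>\<phi> k \<zeta> - p k \<zeta>\<bar> < 1 / real (Suc k)"
    by (metis dist_0_norm mem_sphere)
  have [measurable]: "p k \<in> borel_measurable borel" for k
    by (intro borel_measurable_continuous_onI continuous_on_polymonial_function)
      (use p real_polynomial_function_eq in blast)
  have ind: "(\<lambda>k. \<phi> k \<zeta>) \<longlonglongrightarrow> indicator F \<zeta>" for \<zeta>
  proof (cases "\<zeta> \<in> F")
    case True
    then have "infdist \<zeta> F = 0" by simp
    then show ?thesis using True by (simp add: \<phi>_def)
  next
    case nF: False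
    then have pos: "infdist \<zeta> F > 0" using infdist_pos_not_in_closed[OF F False] by simp
    obtain N :: nat where N: "real N * infdist \<zeta> F > 1" using reals_Archimedean3[OF pos] by blast
    have "\<phi> k \<zeta> = 0" if "k \<ge> N" for k
    proof -
      have "real N * infdist \<zeta> F \<le> real k * infdist \<zeta> F" using that pos by (intro mult_right_mono) auto
      then show ?thesis using N by (simp add: \<phi>_def)
    qed
    then have "eventually (\<lambda>k. \<phi> k \<zeta> = indicator F \<zeta>) sequentially"
      using nF by (auto simp: eventually_sequentially)
    then show ?thesis by (rule tendsto_eventually)
  qed
  have lim: "(\<lambda>k. p k \<zeta>) \<longlonglongrightarrow> indicator F \<zeta>" if "norm \<zeta> = 1" for \<zeta>
  proof -
    have "(\<lambda>k. p k \<zeta> - \<phi> k \<zeta>) \<longlonglongrightarrow> 0"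
    proof (rule tendsto_0_le[where K=1])
      show "(\<lambda>k. 1 / real (Suc k)) \<longlonglongrightarrow> 0" using LIMSEQ_inverse_real_of_nat by (simp add: inverse_eq_divide)
      show "\<forall>\<^sub>F k in sequentially. norm (p k \<zeta> - \<phi> k \<zeta>) \<le> norm (1 / real (Suc k)) * 1"
        using pc[OF that] by (intro always_eventually allI) (simp add: abs_minus_commute less_imp_le)
    qed
    from tendsto_add[OF this ind[of \<zeta>]] show ?thesis by simp
  qed
  have bd: "\<bar>p k \<zeta>\<bar> \<le> 2" if "norm \<zeta> = 1" for k \<zeta>
  proof -
    have "\<bar>\<phi> k \<zeta>\<bar> \<le> 1" unfolding \<phi>_def using infdist_nonneg[of \<zeta> F] by auto
    moreover have "1 / real (Suc k) \<le> 1" by simp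
    ultimately show ?thesis using pc[OF that, of k] by linarith
  qed
  have "(\<lambda>k. LINT \<zeta>|\<mu>. of_real (p k \<zeta>) * g \<zeta>) \<longlonglongrightarrow> (LINT \<zeta>|\<mu>. of_real (indicator F \<zeta>) * g \<zeta>)"
  proof (rule integral_dominated_convergence[where w="\<lambda>\<zeta>. 2 * norm (g \<zeta>)"])
    show "AE \<zeta> in \<mu>. (\<lambda>k. of_real (p k \<zeta>) * g \<zeta>) \<longlonglongrightarrow> of_real (indicator F \<zeta>) * g \<zeta>"
      using AE_circle_norm_1 by eventually_elim (intro tendsto_intros lim)
    show "AE \<zeta> in \<mu>. norm (of_real (p k \<zeta>) * g \<zeta>) \<le> 2 * norm (g \<zeta>)" for k
      using AE_circle_norm_1 by eventually_elim (auto simp: norm_mult intro!: mult_right_mono bd)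
  qed (use g in auto)
  moreover have "(LINT \<zeta>|\<mu>. of_real (p k \<zeta>) * g \<zeta>) = 0" for k
    using polynomial_preserves_fourier_zero[OF p g z, of k]
    by (auto simp: fourier_coeff_def dest: spec[of _ 0])
  ultimately have "(LINT \<zeta>|\<mu>. of_real (indicator F \<zeta>) * g \<zeta>) = 0"
    by (simp add: LIMSEQ_const_iff)
  then show ?thesis by (simp add: set_lebesgue_integral_def scaleR_conv_of_real)
qed

theorem fourier_unique_zero:
  assumes g: "integrable \<mu> g" and z: "\<And>n. coef g n = 0"
  shows "AE \<zeta> in \<mu>. g \<zeta> = 0"
proof (rule circle.density_zero[OF g])
  fix A assume "A \<in> sets \<mu>"
  then have A: "A \<in> sigma_sets UNIV (Collect closed)"
    by (simp add: borel_eq_closed)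
  have stable: "Int_stable (Collect closed :: complex set set)" by (auto simp: Int_stable_def)
  have sb: "B \<in> sets borel" if "B \<in> sigma_sets UNIV (Collect closed)" for B :: "complex set"
    using that by (simp add: borel_eq_closed)
  have si: "set_integrable \<mu> B g" if "B \<in> sets borel" for B
    unfolding set_integrable_def using that g by (intro integrable_mult_indicator) auto
  show "(LINT \<zeta>:A|\<mu>. g \<zeta>) = 0"
  proof (rule sigma_sets_induct_disjoint[OF stable _ A])
    fix B :: "complex set" assume "B \<in> Collect closed"
    then show "(LINT \<zeta>:B|\<mu>. g \<zeta>) = 0"
      using fourier_zero_imp_set_integral_zero[OF g z] by simp
  next
    fix B :: "complex set" assume B: "B \<in> sigma_sets UNIV (Collect closed)" "(LINT \<zeta>:B|\<mu>. g \<zeta>) = 0"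
    have [simp]: "B \<in> sets borel" using B sb by blast
    have "(LINT \<zeta>:UNIV|\<mu>. g \<zeta>) = 0"
      using fourier_zero_imp_set_integral_zero[OF g z, of UNIV] by simp
    moreover have "(LINT \<zeta>:B \<union> (UNIV - B)|\<mu>. g \<zeta>)
       = (LINT \<zeta>:B|\<mu>. g \<zeta>) + (LINT \<zeta>:(UNIV - B)|\<mu>. g \<zeta>)"
      by (rule set_integral_Un) (auto intro!: si)
    ultimately show "(LINT \<zeta>:(UNIV - B)|\<mu>. g \<zeta>) = 0" using B by simp
  next
    fix B :: "nat \<Rightarrow> complex set"
    assume B: "disjoint_family B" "range B \<subseteq> sigma_sets UNIV (Collect closed)"
      "\<And>i. (LINT \<zeta>:B i|\<mu>. g \<zeta>) = 0"
    have [simp]: "B i \<in> sets borel" for i using B sb by blast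
    have "(LINT \<zeta>:(\<Union>i. B i)|\<mu>. g \<zeta>) = (\<Sum>i. LINT \<zeta>:B i|\<mu>. g \<zeta>)"
      using B(1) by (intro lebesgue_integral_countable_add si) (auto simp: disjoint_family_on_def)
    then show "(LINT \<zeta>:(\<Union>i. B i)|\<mu>. g \<zeta>) = 0" using B by simp
  qed (auto simp: set_lebesgue_integral_def)
qed

corollary fourier_unique:
  assumes "integrable \<mu> g" "integrable \<mu> h"
    and "\<And>n. coef g n = coef h n"
  shows "AE \<zeta> in \<mu>. g \<zeta> = h \<zeta>"
  using fourier_unique_zero[of "\<lambda>\<zeta>. g \<zeta> - h \<zeta>"] assms by (simp add: fourier_diff)

section \<open>Trigonometric polynomials and the Riesz projection\<close>

lemma AE_circle_ex: "(AE \<zeta> in \<mu>. P \<zeta>) \<Longrightarrow> \<exists>\<zeta>. P \<zeta>"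
proof (rule ccontr)
  assume "AE \<zeta> in \<mu>. P \<zeta>" "\<nexists>\<zeta>. P \<zeta>"
  then have "AE \<zeta> in \<mu>. False" by simp
  then have "emeasure \<mu> (space \<mu>) = 0"
    unfolding eventually_False ae_filter_eq_bot_iff .
  then show False by (simp add: emeasure_circle_UNIV)
qed

lemma L2_power: "(\<lambda>\<zeta>::complex. \<zeta> ^ k) \<in> L2_circle"
  using L2_powi[of "int k"] by simp

lemma fourier_power: "coef (\<lambda>\<zeta>. \<zeta> ^ k) n = (if n = int k then 1 else 0)"
  using fourier_powi[of "int k"] by simp

lemma fourier_power_shift:
  "g \<in> borel_measurable borel \<Longrightarrow> coef (\<lambda>\<zeta>. \<zeta> ^ k * g \<zeta>) n = coef g (n - int k)"
  using fourier_powi_shift[of g "int k"] by simp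

text \<open>Only nonnegative frequencies occur, since only analytic trigonometric polynomials are needed.\<close>

definition trig_poly :: "(nat \<Rightarrow> complex) \<Rightarrow> nat set \<Rightarrow> complex \<Rightarrow> complex" where
  "trig_poly a I \<zeta> = (\<Sum>k\<in>I. a k * \<zeta> ^ k)"

lemma L2_trig_poly: "trig_poly a I \<in> L2_circle"
  unfolding trig_poly_def[abs_def] by (intro L2_sum L2_cmult L2_power)

lemma trig_poly_inner:
  assumes g: "g \<in> L2_circle"
  shows "(LINT \<zeta>|\<mu>. g \<zeta> * cnj (trig_poly a I \<zeta>)) = (\<Sum>k\<in>I. cnj (a k) * coef g (int k))"
proof -
  have [measurable]: "g \<in> borel_measurable borel" using g by (rule L2_measurable)
  have [measurable]: "trig_poly a I \<in> borel_measurable borel" using L2_trig_poly by (rule L2_measurable)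
  have "(LINT \<zeta>|\<mu>. g \<zeta> * cnj (trig_poly a I \<zeta>))
      = (LINT \<zeta>|\<mu>. (\<Sum>k\<in>I. cnj (a k) * (g \<zeta> * \<zeta> powi (- int k))))"
  proof (rule integral_cong_AE)
    show "AE \<zeta> in \<mu>. g \<zeta> * cnj (trig_poly a I \<zeta>) = (\<Sum>k\<in>I. cnj (a k) * (g \<zeta> * \<zeta> powi (- int k)))"
      using AE_circle_norm_1
    proof eventually_elim
      case (elim \<zeta>)
      have "inverse \<zeta> = cnj \<zeta>"
        using elim by (rule inverse_eq_cnj)
      then have "cnj (\<zeta> ^ k) = \<zeta> powi (- int k)" for k
        by (simp add: power_int_minus power_inverse[symmetric])
      then show ?case by (simp add: trig_poly_def sum_distrib_left mult_ac)
    qed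
  qed measurable
  also have "\<dots> = (\<Sum>k\<in>I. cnj (a k) * coef g (int k))"
    using L2_integrable[OF g] by (simp add: fourier_coeff_def fourier_integrable)
  finally show ?thesis .
qed

lemma fourier_trig_poly:
  assumes "finite I"
  shows "coef (trig_poly a I) n = (if n \<ge> 0 \<and> nat n \<in> I then a (nat n) else 0)"
proof -
  have "coef (trig_poly a I) n = (\<Sum>k\<in>I. a k * coef (\<lambda>\<zeta>. \<zeta> ^ k) n)"
    unfolding trig_poly_def[abs_def]
    by (subst fourier_sum) (auto simp: fourier_cmult intro!: L2_integrable L2_cmult L2_power)
  also have "\<dots> = (\<Sum>k\<in>I. if k = nat n \<and> n \<ge> 0 then a k else 0)"
    by (rule sum.cong) (auto simp: fourier_power)
  also have "\<dots> = (if n \<ge> 0 \<and> nat n \<in> I then a (nat n) else 0)"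
    using assms by (cases "n \<ge> 0") (auto simp: sum.delta)
  finally show ?thesis .
qed

lemma trig_poly_norm:
  assumes "finite I"
  shows "sq_norm (trig_poly a I) = (\<Sum>k\<in>I. (norm (a k))\<^sup>2)"
proof -
  have "of_real (sq_norm (trig_poly a I))
      = (LINT \<zeta>|\<mu>. trig_poly a I \<zeta> * cnj (trig_poly a I \<zeta>))"
    using L2_trig_poly[of a I]
    by (subst integral_of_real[symmetric]) (auto simp only: complex_norm_square L2_circle_iff)
  also have "\<dots> = (\<Sum>k\<in>I. cnj (a k) * a k)"
    by (subst trig_poly_inner[OF L2_trig_poly]) (auto simp: fourier_trig_poly[OF assms] intro!: sum.cong)
  also have "\<dots> = of_real (\<Sum>k\<in>I. (norm (a k))\<^sup>2)"
    by (simp only: complex_norm_square mult.commute of_real_sum)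
  finally show ?thesis by (simp only: of_real_eq_iff)
qed

lemma Bessel:
  assumes g: "g \<in> L2_circle" and "finite I"
  shows "(\<Sum>k\<in>I. (norm (coef g (int k)))\<^sup>2) \<le> sq_norm g"
proof -
  define c where "c = (\<lambda>k. coef g (int k))"
  let ?s = "\<Sum>k\<in>I. (norm (c k))\<^sup>2"
  have "(LINT \<zeta>|\<mu>. g \<zeta> * cnj (trig_poly c I \<zeta>)) = (\<Sum>k\<in>I. cnj (c k) * c k)"
    by (subst trig_poly_inner[OF g]) (simp add: c_def)
  also have "\<dots> = of_real ?s"
    by (simp only: complex_norm_square mult.commute of_real_sum)
  finally have e: "(LINT \<zeta>|\<mu>. g \<zeta> * cnj (trig_poly c I \<zeta>)) = of_real ?s" .
  have "?s\<^sup>2 = (norm (LINT \<zeta>|\<mu>. g \<zeta> * cnj (trig_poly c I \<zeta>)))\<^sup>2"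
    unfolding e by (simp only: norm_of_real power2_abs)
  also have "\<dots> \<le> sq_norm g * ?s"
    using Cauchy_Schwarz_circle[OF g L2_cnj[OF L2_trig_poly[of c I]]] by (simp add: trig_poly_norm[OF assms(2)])
  finally have "?s * ?s \<le> sq_norm g * ?s" by (simp add: power2_eq_square)
  moreover have "?s \<ge> 0" by (intro sum_nonneg) auto
  moreover have "sq_norm g \<ge> 0" by simp
  ultimately have "?s \<le> sq_norm g"
    by (cases "?s = 0") simp_all
  then show ?thesis by (simp add: c_def)
qed

lemma fourier_sq_summable:
  assumes "g \<in> L2_circle"
  shows "summable (\<lambda>k. (norm (coef g (int k)))\<^sup>2)"
  by (rule bounded_imp_summable[where B="LINT \<zeta>|\<mu>. (norm (g \<zeta>))\<^sup>2"])
     (auto intro: Bessel[OF assms])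

lemma L2_tendsto_integral:
  fixes u :: "nat \<Rightarrow> complex \<Rightarrow> complex"
  assumes u: "\<And>n. u n \<in> L2_circle" and g: "g \<in> L2_circle" and h: "h \<in> L2_circle"
    and lim: "(\<lambda>n. LINT \<zeta>|\<mu>. (norm (u n \<zeta> - g \<zeta>))\<^sup>2) \<longlonglongrightarrow> 0"
  shows "(\<lambda>n. LINT \<zeta>|\<mu>. u n \<zeta> * h \<zeta>) \<longlonglongrightarrow> (LINT \<zeta>|\<mu>. g \<zeta> * h \<zeta>)"
proof -
  let ?d = "\<lambda>n. (LINT \<zeta>|\<mu>. u n \<zeta> * h \<zeta>) - (LINT \<zeta>|\<mu>. g \<zeta> * h \<zeta>)"
  have "(norm (?d n))\<^sup>2 \<le> sq_norm (\<lambda>\<zeta>. u n \<zeta> - g \<zeta>) * sq_norm h" for n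
  proof -
    have "?d n = (LINT \<zeta>|\<mu>. (u n \<zeta> - g \<zeta>) * h \<zeta>)"
      using L2_mult_integrable[OF u h] L2_mult_integrable[OF g h] by (simp add: left_diff_distrib)
    then show ?thesis using Cauchy_Schwarz_circle[OF L2_diff[OF u g] h] by simp
  qed
  then have "(\<lambda>n. (norm (?d n))\<^sup>2) \<longlonglongrightarrow> 0"
    by (intro tendsto_0_le[OF lim, where K="LINT \<zeta>|\<mu>. (norm (h \<zeta>))\<^sup>2"]) auto
  then have "(\<lambda>n. norm (?d n)) \<longlonglongrightarrow> 0"
    using tendsto_real_sqrt[of "\<lambda>n. (norm (?d n))\<^sup>2" 0] by simp
  then show ?thesis by (simp add: LIM_zero_iff tendsto_norm_zero_iff)
qed

lemma L2_tendsto_fourier: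
  assumes "\<And>n. u n \<in> L2_circle" "g \<in> L2_circle"
    and "(\<lambda>n. LINT \<zeta>|\<mu>. (norm (u n \<zeta> - g \<zeta>))\<^sup>2) \<longlonglongrightarrow> 0"
  shows "(\<lambda>n. coef (u n) k) \<longlonglongrightarrow> coef g k"
  unfolding fourier_coeff_def by (rule L2_tendsto_integral[OF assms(1,2) L2_powi assms(3)])

text \<open>The orthogonal projection \<open>P\<^sub>+\<close> of \<open>L\<^sup>2\<close> onto \<open>H\<^sup>2\<close>: by Bessel's inequality the partial sums
  of the nonnegative part of the Fourier series form a Cauchy sequence.\<close>

theorem Riesz_projection_exists:
  assumes g: "g \<in> L2_circle"
  obtains p where "p \<in> L2_circle" "\<And>n. coef p n = (if n \<ge> 0 then coef g n else 0)"
    "(\<lambda>N. LINT \<zeta>|\<mu>. (norm (trig_poly (\<lambda>k. coef g (int k)) {..<N} \<zeta> - p \<zeta>))\<^sup>2) \<longlonglongrightarrow> 0"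
proof -
  define c where "c = (\<lambda>k. coef g (int k))"
  define u where "u = (\<lambda>N. trig_poly c {..<N})"
  have u: "u N \<in> L2_circle" for N unfolding u_def by (rule L2_trig_poly)
  have d: "(sq_norm (\<lambda>\<zeta>. u n \<zeta> - u m \<zeta>)) = (\<Sum>k=m..<n. (norm (c k))\<^sup>2)" if "m \<le> n" for m n
  proof -
    have "u n \<zeta> - u m \<zeta> = trig_poly c {m..<n} \<zeta>" for \<zeta>
      using that by (simp add: u_def trig_poly_def lessThan_atLeast0 sum_diff_nat_ivl)
    then show ?thesis by (simp add: trig_poly_norm)
  qed
  have "\<exists>N. \<forall>m\<ge>N. \<forall>n\<ge>N. (sq_norm (\<lambda>\<zeta>. u m \<zeta> - u n \<zeta>)) < e" if "e > 0" for e
  proof -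
    obtain N where N: "\<And>m n. m \<ge> N \<Longrightarrow> norm (\<Sum>k=m..<n. (norm (c k))\<^sup>2) < e"
      using fourier_sq_summable[OF g] \<open>e > 0\<close> unfolding summable_Cauchy c_def by meson
    have "sq_norm (\<lambda>\<zeta>. u m \<zeta> - u n \<zeta>) < e" if "m \<ge> N" "n \<ge> N" for m n
    proof (cases "n \<le> m")
      case True
      then show ?thesis using N[OF that(2), of m] d by auto
    next
      case False
      then show ?thesis using N[OF that(1), of n] d[of m n] by (auto simp: norm_minus_commute)
    qed
    then show ?thesis by blast
  qed
  from L2_complete[OF u this] obtain p where p: "p \<in> L2_circle"
    "(\<lambda>N. LINT \<zeta>|\<mu>. (norm (u N \<zeta> - p \<zeta>))\<^sup>2) \<longlonglongrightarrow> 0" by blast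
  have "coef p n = (if n \<ge> 0 then coef g n else 0)" for n
  proof (rule LIMSEQ_unique[OF L2_tendsto_fourier[OF u p]])
    have "eventually (\<lambda>N. coef (u N) n = (if n \<ge> 0 then coef g n else 0)) sequentially"
      by (rule eventually_sequentiallyI[of "Suc (nat n)"]) (auto simp: u_def fourier_trig_poly c_def)
    then show "(\<lambda>N. coef (u N) n) \<longlonglongrightarrow> (if n \<ge> 0 then coef g n else 0)"
      by (rule tendsto_eventually)
  qed
  with p show ?thesis using that unfolding u_def c_def by blast
qed

text \<open>If the negative coefficients vanish, then \<open>g\<close> and its Riesz projection have the same Fourier
  coefficients, so the Fourier series converges to \<open>g\<close> itself.\<close>

lemma analytic_L2_approx:
  assumes g: "g \<in> L2_circle" and n: "\<And>n. n < 0 \<Longrightarrow> coef g n = 0"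
  shows "(\<lambda>N. LINT \<zeta>|\<mu>. (norm (trig_poly (\<lambda>k. coef g (int k)) {..<N} \<zeta> - g \<zeta>))\<^sup>2) \<longlonglongrightarrow> 0"
proof -
  from Riesz_projection_exists[OF g] obtain p where p: "p \<in> L2_circle"
    "\<And>n. coef p n = (if n \<ge> 0 then coef g n else 0)"
    "(\<lambda>N. LINT \<zeta>|\<mu>. (norm (trig_poly (\<lambda>k. coef g (int k)) {..<N} \<zeta> - p \<zeta>))\<^sup>2) \<longlonglongrightarrow> 0" by blast
  have ae: "AE \<zeta> in \<mu>. p \<zeta> = g \<zeta>"
    by (rule fourier_unique) (use p(2) n in \<open>auto intro!: L2_integrable p g\<close>)
  have [measurable]: "p \<in> borel_measurable borel" "g \<in> borel_measurable borel"
    "trig_poly a I \<in> borel_measurable borel" for a I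
    using g p L2_trig_poly by (auto intro: L2_measurable)
  have "sq_norm (\<lambda>\<zeta>. trig_poly a I \<zeta> - p \<zeta>) =
        (sq_norm (\<lambda>\<zeta>. trig_poly a I \<zeta> - g \<zeta>))" for a I
    by (rule integral_cong_AE) (use ae in \<open>measurable, eventually_elim, simp\<close>)
  then show ?thesis using p(3) by simp
qed

section \<open>Boundary values of scalar Hardy functions\<close>

lemma boundary_ofD:
  assumes "boundary_of f g"
  shows "g \<in> L2_circle" "\<And>n. n < 0 \<Longrightarrow> coef g n = 0"
    "\<And>z. norm z < 1 \<Longrightarrow> (\<lambda>n. coef g (int n) * z ^ n) sums f z"
    "\<And>z. \<not> norm z < 1 \<Longrightarrow> f z = 0" "g \<in> borel_measurable borel" "integrable \<mu> g"
  using assms by (auto simp: boundary_of_def L2_integrable L2_measurable)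

lemma boundary_ofI:
  assumes "g \<in> L2_circle" "\<And>n. n < 0 \<Longrightarrow> coef g n = 0"
    "\<And>z. norm z < 1 \<Longrightarrow> (\<lambda>n. coef g (int n) * z ^ n) sums f z"
    "\<And>z. \<not> norm z < 1 \<Longrightarrow> f z = 0"
  shows "boundary_of f g"
  using assms by (auto simp: boundary_of_def)

lemma fourier_summable:
  assumes "integrable \<mu> g" "norm z < 1"
  shows "summable (\<lambda>n. norm (coef g (int n) * z ^ n))"
proof (rule summable_comparison_test)
  show "\<exists>N. \<forall>n\<ge>N. norm (norm (coef g (int n) * z ^ n)) \<le> (LINT \<zeta>|\<mu>. norm (g \<zeta>)) * norm z ^ n"
    by (auto simp: norm_mult norm_power intro!: mult_right_mono fourier_norm_le assms(1) exI[of _ 0])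
  show "summable (\<lambda>n. (LINT \<zeta>|\<mu>. norm (g \<zeta>)) * norm z ^ n)"
    using assms(2) by (intro summable_mult summable_geometric) simp
qed

lemma boundary_of_unique:
  assumes f: "boundary_of f g" "boundary_of f h"
  shows "AE \<zeta> in \<mu>. g \<zeta> = h \<zeta>"
proof (rule fourier_unique)
  have r: "fps_conv_radius (Abs_fps (\<lambda>n. coef u (int n))) > 0" if "boundary_of f u" for u
  proof -
    have "conv_radius (\<lambda>n. coef u (int n)) \<ge> norm (1/2 :: complex)"
      by (rule conv_radius_geI) (use boundary_ofD(3)[OF that, of "1/2"] in \<open>auto simp: summable_def\<close>)
    moreover have "(0::ereal) < ereal (norm (1/2 :: complex))" by simp
    ultimately show ?thesis unfolding fps_conv_radius_def fps_nth_Abs_fps by (rule order_less_le_trans[rotated])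
  qed
  have e: "eval_fps (Abs_fps (\<lambda>n. coef u (int n))) z = f z" if "boundary_of f u" "norm z < 1" for u z
    using boundary_ofD(3)[OF that] by (simp add: eval_fps_def sums_iff)
  have "Abs_fps (\<lambda>n. coef g (int n)) = Abs_fps (\<lambda>n. coef h (int n))"
  proof (rule eval_fps_eqD[OF r[OF f(1)] r[OF f(2)]])
    have "eventually (\<lambda>z. norm z < 1) (nhds (0::complex))"
      using eventually_nhds_in_open[of "ball 0 1" "0::complex"] by simp
    then show "\<forall>\<^sub>F z in nhds 0. eval_fps (Abs_fps (\<lambda>n. coef g (int n))) z =
        eval_fps (Abs_fps (\<lambda>n. coef h (int n))) z"
      by eventually_elim (simp add: e f)
  qed
  then have *: "coef g (int n) = coef h (int n)" for n
    by (metis fps_nth_Abs_fps)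
  show "coef g n = coef h n" for n
  proof (cases "n < 0")
    case True
    then show ?thesis using boundary_ofD(2)[OF f(1)] boundary_ofD(2)[OF f(2)] by simp
  next
    case False
    then show ?thesis using *[of "nat n"] by simp
  qed
qed (use boundary_ofD f in auto)

lemma boundary_of_bdry: "f \<in> H2 \<Longrightarrow> boundary_of f (bdry f)"
  unfolding H2_def bdry_def using someI_ex[of "boundary_of f"] by simp

lemma boundary_of_H2: "boundary_of f g \<Longrightarrow> f \<in> H2"
  by (auto simp: H2_def)

lemma boundary_of_cong_AE:
  assumes f: "boundary_of f g" and [measurable]: "h \<in> borel_measurable borel"
    and ae: "AE \<zeta> in \<mu>. g \<zeta> = h \<zeta>"
  shows "boundary_of f h"
proof -
  have "coef h n = coef g n" for n
    using fourier_coeff_cong_AE[OF boundary_ofD(5)[OF f] assms(2) ae, of n] by simp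
  moreover have "h \<in> L2_circle"
    by (rule L2_dominated[OF boundary_ofD(1)[OF f] assms(2), where C=1]) (use ae in \<open>eventually_elim, simp\<close>)
  ultimately show ?thesis using f by (simp add: boundary_of_def)
qed

lemma boundary_of_add:
  assumes f: "boundary_of f g" and h: "boundary_of f' g'"
  shows "boundary_of (\<lambda>z. f z + f' z) (\<lambda>\<zeta>. g \<zeta> + g' \<zeta>)"
proof (rule boundary_ofI)
  fix z :: complex assume "norm z < 1"
  from sums_add[OF boundary_ofD(3)[OF f this] boundary_ofD(3)[OF h this]]
  show "(\<lambda>n. coef (\<lambda>\<zeta>. g \<zeta> + g' \<zeta>) (int n) * z ^ n) sums (f z + f' z)"
    by (simp add: fourier_add boundary_ofD[OF f] boundary_ofD[OF h] distrib_right)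
qed (simp_all add: fourier_add L2_add boundary_ofD[OF f] boundary_ofD[OF h])

lemma boundary_of_cmult:
  assumes f: "boundary_of f g"
  shows "boundary_of (\<lambda>z. c * f z) (\<lambda>\<zeta>. c * g \<zeta>)"
proof (rule boundary_ofI)
  fix z :: complex assume "norm z < 1"
  from sums_mult[OF boundary_ofD(3)[OF f this]]
  show "(\<lambda>n. coef (\<lambda>\<zeta>. c * g \<zeta>) (int n) * z ^ n) sums (c * f z)"
    by (simp add: fourier_cmult mult.assoc)
qed (simp_all add: fourier_cmult L2_cmult boundary_ofD[OF f])

lemma boundary_of_zero: "boundary_of (\<lambda>_. 0) (\<lambda>_. 0)"
  by (rule boundary_ofI) (auto simp: fourier_zero)

lemma boundary_of_const: "boundary_of (\<lambda>z. if norm z < 1 then c else 0) (\<lambda>_. c)"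
proof (rule boundary_ofI)
  have [simp]: "coef (\<lambda>_. c) n = (if n = 0 then c else 0)" for n
    using fourier_cmult[of c "\<lambda>_. 1" n] fourier_powi[of 0 n] by simp
  show "coef (\<lambda>_. c) n = 0" if "n < 0" for n using that by simp
  fix z :: complex assume "norm z < 1"
  then show "(\<lambda>n. coef (\<lambda>_. c) (int n) * z ^ n) sums (if norm z < 1 then c else 0)"
    using powser_sums_zero_iff[of "\<lambda>_. c" c] sums_single[of 0 "\<lambda>n. c * z^n"]
    by (simp add: if_distrib[of "\<lambda>x. x * _"] cong: if_cong)
next
  show "(\<lambda>_. c) \<in> L2_circle" by (rule L2_bounded[where C="norm c"]) auto
qed auto

lemma boundary_of_sum:
  assumes "\<And>i. i \<in> I \<Longrightarrow> boundary_of (f i) (g i)"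
  shows "boundary_of (\<lambda>z. \<Sum>i\<in>I. f i z) (\<lambda>\<zeta>. \<Sum>i\<in>I. g i \<zeta>)"
  using assms by (induction I rule: infinite_finite_induct)
    (auto intro: boundary_of_add boundary_of_zero)

lemma fourier_mult:
  assumes g: "g \<in> L2_circle" and gn: "\<And>n. n < 0 \<Longrightarrow> coef g n = 0"
    and h: "h \<in> L2_circle" and hn: "\<And>n. n < 0 \<Longrightarrow> coef h n = 0"
  shows "coef (\<lambda>\<zeta>. g \<zeta> * h \<zeta>) n =
    (if n < 0 then 0 else \<Sum>k\<le>nat n. coef g (int k) * coef h (int (nat n - k)))"
proof -
  let ?u = "\<lambda>N. trig_poly (\<lambda>k. coef g (int k)) {..<N}"
  let ?r = "if n < 0 then 0 else \<Sum>k\<le>nat n. coef g (int k) * coef h (int (nat n - k))"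
  have [measurable]: "h \<in> borel_measurable borel" using h by (rule L2_measurable)
  have hL: "(\<lambda>\<zeta>. h \<zeta> * \<zeta> powi (-n)) \<in> L2_circle"
  proof (rule L2_dominated[OF h, where C=1])
    show "AE \<zeta> in \<mu>. norm (h \<zeta> * \<zeta> powi - n) \<le> 1 * norm (h \<zeta>)"
      using AE_circle_norm_1 by eventually_elim (simp add: norm_mult norm_power_int)
  qed measurable
  have "(\<lambda>N. LINT \<zeta>|\<mu>. ?u N \<zeta> * (h \<zeta> * \<zeta> powi (-n))) \<longlonglongrightarrow> (LINT \<zeta>|\<mu>. g \<zeta> * (h \<zeta> * \<zeta> powi (-n)))"
    by (rule L2_tendsto_integral[OF L2_trig_poly g hL analytic_L2_approx[OF g gn]])
  moreover have "(LINT \<zeta>|\<mu>. ?u N \<zeta> * (h \<zeta> * \<zeta> powi (-n)))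
      = (\<Sum>k<N. coef g (int k) * coef h (n - int k))" for N
  proof -
    have "(LINT \<zeta>|\<mu>. ?u N \<zeta> * (h \<zeta> * \<zeta> powi (-n)))
        = coef (\<lambda>\<zeta>. \<Sum>k<N. coef g (int k) * (\<zeta> ^ k * h \<zeta>)) n"
      unfolding fourier_coeff_def[of "\<lambda>\<zeta>. \<Sum>k<N. _ k \<zeta>"] trig_poly_def
      by (simp add: sum_distrib_right sum_distrib_left mult.assoc)
    also have "\<dots> = (\<Sum>k<N. coef g (int k) * coef h (n - int k))"
      using fourier_integrable[OF L2_integrable[OF h], of "int _"]
      by (subst fourier_sum) (auto simp: fourier_cmult fourier_power_shift[OF L2_measurable[OF h]] mult.commute[of "h _"])
    finally show ?thesis .
  qed
  moreover have "(\<lambda>N. \<Sum>k<N. coef g (int k) * coef h (n - int k)) \<longlonglongrightarrow> ?r"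
  proof (rule tendsto_eventually, rule eventually_sequentiallyI[of "Suc (nat n)"])
    fix N assume N: "Suc (nat n) \<le> N"
    show "(\<Sum>k<N. coef g (int k) * coef h (n - int k)) = ?r"
    proof (cases "n < 0")
      case True
      then show ?thesis by (auto intro!: sum.neutral simp: hn)
    next
      case False
      have "(\<Sum>k<N. coef g (int k) * coef h (n - int k))
          = (\<Sum>k\<le>nat n. coef g (int k) * coef h (n - int k))"
        using N False by (intro sum.mono_neutral_right) (auto simp: hn)
      also have "\<dots> = ?r" using False by (auto intro!: sum.cong simp: of_nat_diff)
      finally show ?thesis .
    qed
  qed
  ultimately have "(LINT \<zeta>|\<mu>. g \<zeta> * (h \<zeta> * \<zeta> powi (-n))) = ?r"
    using LIMSEQ_unique by auto
  then show ?thesis by (simp add: fourier_coeff_def mult.assoc)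
qed

text \<open>The product of two \<open>H\<^sup>2\<close> functions need not be square integrable on the circle, hence the
  last assumption.\<close>

lemma boundary_of_mult:
  assumes f: "boundary_of f g" and h: "boundary_of f' g'"
    and L: "(\<lambda>\<zeta>. g \<zeta> * g' \<zeta>) \<in> L2_circle"
  shows "boundary_of (\<lambda>z. f z * f' z) (\<lambda>\<zeta>. g \<zeta> * g' \<zeta>)"
proof (rule boundary_ofI)
  note fm = fourier_mult[OF boundary_ofD(1,2)[OF f] boundary_ofD(1,2)[OF h]]
  show "coef (\<lambda>\<zeta>. g \<zeta> * g' \<zeta>) n = 0" if "n < 0" for n using that by (simp add: fm)
  fix z :: complex assume z: "norm z < 1"
  have s: "f z = (\<Sum>n. coef g (int n) * z ^ n)" "f' z = (\<Sum>n. coef g' (int n) * z ^ n)"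
    using boundary_ofD(3)[OF f z] boundary_ofD(3)[OF h z] by (simp_all add: sums_iff)
  have "(\<lambda>n. \<Sum>k\<le>n. (coef g (int k) * z ^ k) * (coef g' (int (n - k)) * z ^ (n - k))) sums (f z * f' z)"
    unfolding s by (intro Cauchy_product_sums fourier_summable boundary_ofD[OF f] boundary_ofD[OF h] z)
  moreover have "(\<Sum>k\<le>n. (coef g (int k) * z ^ k) * (coef g' (int (n - k)) * z ^ (n - k)))
     = coef (\<lambda>\<zeta>. g \<zeta> * g' \<zeta>) (int n) * z ^ n" for n
  proof -
    have "(coef g (int k) * z ^ k) * (coef g' (int (n - k)) * z ^ (n - k))
      = (coef g (int k) * coef g' (int (n - k))) * z ^ n" if "k \<le> n" for k
      using that power_add[of z k "n - k"] by simp
    then have "(\<Sum>k\<le>n. (coef g (int k) * z ^ k) * (coef g' (int (n - k)) * z ^ (n - k)))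
      = (\<Sum>k\<le>n. (coef g (int k) * coef g' (int (n - k))) * z ^ n)"
      by (intro sum.cong) auto
    then show ?thesis by (simp add: fm sum_distrib_right)
  qed
  ultimately show "(\<lambda>n. coef (\<lambda>\<zeta>. g \<zeta> * g' \<zeta>) (int n) * z ^ n) sums (f z * f' z)" by simp
qed (use L boundary_ofD[OF f] in auto)

text \<open>Maximum principle: apply the coefficient estimate to \<open>f ^ n\<close> and take \<open>n\<close>-th roots.\<close>

lemma boundary_bound_imp_bound:
  assumes f: "boundary_of f g" and b: "AE \<zeta> in \<mu>. norm (g \<zeta>) \<le> C"
  shows "norm (f z) \<le> C"
proof (cases "norm z < 1")
  case False
  have "C \<ge> 0" using AE_circle_ex[OF b] norm_ge_zero order_trans by blast
  then show ?thesis using boundary_ofD(4)[OF f False] by simp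
next
  case z: True
  have [measurable]: "g \<in> borel_measurable borel" by (rule boundary_ofD[OF f])
  have C: "C \<ge> 0" using AE_circle_ex[OF b] norm_ge_zero order_trans by blast
  have bn: "AE \<zeta> in \<mu>. norm (g \<zeta> ^ n) \<le> C ^ n" for n
    using b by eventually_elim (simp add: norm_power power_mono)
  have pow: "boundary_of (\<lambda>z. f z ^ Suc n) (\<lambda>\<zeta>. g \<zeta> ^ Suc n)" for n
  proof (induction n)
    case (Suc n)
    have "(\<lambda>\<zeta>. g \<zeta> * g \<zeta> ^ Suc n) \<in> L2_circle"
      using bn[of "Suc (Suc n)"] by (intro L2_bounded[where C="C ^ Suc (Suc n)"]) auto
    from boundary_of_mult[OF f Suc this] show ?case by simp
  qed (use f in simp)
  have est: "norm (f z) ^ Suc n \<le> C ^ Suc n * (1 / (1 - norm z))" for n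
  proof -
    note P = pow[of n]
    have c: "norm (coef (\<lambda>\<zeta>. g \<zeta> ^ Suc n) k) \<le> C ^ Suc n" for k
    proof -
      have "norm (coef (\<lambda>\<zeta>. g \<zeta> ^ Suc n) k) \<le> (LINT \<zeta>|\<mu>. norm (g \<zeta> ^ Suc n))"
        by (rule fourier_norm_le[OF boundary_ofD(6)[OF P]])
      also have "\<dots> \<le> (LINT \<zeta>|\<mu>. C ^ Suc n)"
        by (rule integral_mono_AE) (use bn[of "Suc n"] boundary_ofD(6)[OF P] in auto)
      finally show ?thesis by simp
    qed
    have "norm (f z ^ Suc n) \<le> (\<Sum>k. C ^ Suc n * norm z ^ k)"
    proof -
      have "f z ^ Suc n = (\<Sum>k. coef (\<lambda>\<zeta>. g \<zeta> ^ Suc n) (int k) * z ^ k)"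
        using boundary_ofD(3)[OF P z] by (simp add: sums_iff)
      also have "norm \<dots> \<le> (\<Sum>k. C ^ Suc n * norm z ^ k)"
        by (rule norm_suminf_le) (use z c in \<open>auto simp: norm_mult norm_power intro!: summable_mult summable_geometric mult_right_mono\<close>)
      finally show ?thesis .
    qed
    also have "\<dots> = C ^ Suc n * (1 / (1 - norm z))"
      using z by (subst suminf_mult) (auto simp: suminf_geometric)
    finally show ?thesis by (simp only: norm_power)
  qed
  show ?thesis
  proof (rule ccontr)
    assume "\<not> norm (f z) \<le> C"
    then have gt: "norm (f z) > C" by simp
    show False
    proof (cases "C = 0")
      case True
      then show False using est[of 0] gt by simp
    next
      case False
      then have C0: "C > 0" using C by simp
      then have "norm (f z) / C > 1" using gt by simp
      then obtain n where n: "(norm (f z) / C) ^ n > 1 / (1 - norm z)"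
        using real_arch_pow by blast
      have "(norm (f z) / C) ^ n \<le> (norm (f z) / C) ^ Suc n"
        using \<open>norm (f z) / C > 1\<close> by (intro power_increasing) auto
      also have "\<dots> \<le> 1 / (1 - norm z)"
        using est[of n] C0 by (simp add: power_divide divide_le_eq mult.commute)
      finally show False using n by simp
    qed
  qed
qed

text \<open>Conversely, the averages of the dilates \<open>\<zeta> \<mapsto> f (r \<zeta>)\<close> over a set converge, as \<open>r \<rightarrow> 1\<close>, to
  the average of the boundary function, so all these averages are bounded by \<open>C\<close>.\<close>

lemma bound_imp_boundary_bound:
  assumes f: "boundary_of f g" and b: "\<And>z. norm z < 1 \<Longrightarrow> norm (f z) \<le> C"
  shows "AE \<zeta> in \<mu>. norm (g \<zeta>) \<le> C"
proof -
  note D = boundary_ofD[OF f]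
  define c where "c = (\<lambda>k. coef g (int k))"
  have "AE \<zeta> in \<mu>. g \<zeta> \<in> cball 0 C"
  proof (rule circle.averaging_theorem[OF D(6)])
    fix A assume "A \<in> sets \<mu>" and mA: "measure \<mu> A > 0"
    then have [measurable]: "A \<in> sets borel" by simp
    \<comment> \<open>the average over \<open>A\<close> is a pairing with \<open>h\<close>, hence a series in the coefficients \<open>c\<close> and \<open>e\<close>\<close>
    define h where "h = (\<lambda>\<zeta>. complex_of_real (indicator A \<zeta>))"
    have h: "h \<in> L2_circle" unfolding h_def by (rule L2_bounded[where C=1]) (auto simp: indicator_def)
    have [measurable]: "h \<in> borel_measurable borel" using h by (rule L2_measurable)
    define e where "e = (\<lambda>k. coef h (- int k))"
    have "summable (\<lambda>k. norm (c k * e k))"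
    proof (rule summable_comparison_test)
      have e: "norm (e k) = norm (coef h (int k))" for k
      proof -
        have "e k = cnj (coef h (int k))"
          unfolding e_def fourier_coeff_def Bochner_Integration.integral_cnj[symmetric]
        proof (rule integral_cong_AE)
          show "AE \<zeta> in \<mu>. h \<zeta> * \<zeta> powi - (- int k) = cnj (h \<zeta> * \<zeta> powi - int k)"
            using AE_circle_norm_1
          proof eventually_elim
            case (elim \<zeta>)
            have "inverse \<zeta> = cnj \<zeta>"
              using elim by (rule inverse_eq_cnj)
            then have "cnj (inverse \<zeta> ^ k) = \<zeta> ^ k" by simp
            then show ?case by (simp add: h_def power_int_minus power_inverse[symmetric] indicator_def)
          qed
        qed measurable
        then show ?thesis by simp
      qed
      show "\<exists>N. \<forall>n\<ge>N. norm (norm (c n * e n)) \<le> (norm (c n))\<^sup>2 + (norm (coef h (int n)))\<^sup>2"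
      proof (intro exI[of _ 0] allI impI)
        fix n
        have "2 * norm (c n) * norm (e n) \<le> (norm (c n))\<^sup>2 + (norm (e n))\<^sup>2" by (rule sum_squares_bound)
        moreover have "0 \<le> norm (c n) * norm (e n)" by simp
        ultimately show "norm (norm (c n * e n)) \<le> (norm (c n))\<^sup>2 + (norm (coef h (int n)))\<^sup>2"
          unfolding norm_mult e real_norm_def by linarith
      qed
      show "summable (\<lambda>n. (norm (c n))\<^sup>2 + (norm (coef h (int n)))\<^sup>2)"
        unfolding c_def by (intro summable_add fourier_sq_summable D h)
    qed
    note sm = this
    have "(\<lambda>N. LINT \<zeta>|\<mu>. trig_poly c {..<N} \<zeta> * h \<zeta>) \<longlonglongrightarrow> (LINT \<zeta>|\<mu>. g \<zeta> * h \<zeta>)"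
      unfolding c_def by (rule L2_tendsto_integral[OF L2_trig_poly D(1) h analytic_L2_approx[OF D(1,2)]])
    moreover have trig: "(LINT \<zeta>|\<mu>. trig_poly a {..<N} \<zeta> * h \<zeta>) = (\<Sum>k<N. a k * e k)" for a N
    proof -
      have i: "integrable \<mu> (\<lambda>\<zeta>. h \<zeta> * \<zeta> ^ k)" for k
        using fourier_integrable[OF L2_integrable[OF h], of "int k"] by simp
      have "(LINT \<zeta>|\<mu>. trig_poly a {..<N} \<zeta> * h \<zeta>)
          = (LINT \<zeta>|\<mu>. (\<Sum>k<N. a k * (h \<zeta> * \<zeta> ^ k)))"
        by (simp add: trig_poly_def sum_distrib_right mult.assoc mult.commute[of "h _"])
      also have "\<dots> = (\<Sum>k<N. a k * e k)"
        by (subst Bochner_Integration.integral_sum) (auto simp: i e_def fourier_coeff_def)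
      finally show ?thesis .
    qed
    ultimately have sums: "(\<lambda>k. c k * e k) sums (LINT \<zeta>|\<mu>. g \<zeta> * h \<zeta>)"
      by (simp add: sums_def)
    define r where "r = (\<lambda>n. 1 - 1 / real (Suc n))"
    have r01: "0 \<le> r n" "r n < 1" for n by (auto simp: r_def field_simps)
    have r1: "r \<longlonglongrightarrow> 1"
      using tendsto_diff[OF tendsto_const[of 1] LIMSEQ_inverse_real_of_nat] by (simp add: r_def[abs_def] inverse_eq_divide)
    have dil: "norm (\<Sum>k. c k * e k * of_real (r n) ^ k) \<le> C * measure \<mu> A" for n
    proof -
      have rn: "norm (of_real (r n) :: complex) < 1" using r01[of n] by simp
      define B where "B = (\<Sum>k. norm (c k * of_real (r n) ^ k))"
      have Bs: "summable (\<lambda>k. norm (c k * of_real (r n) ^ k))"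
        unfolding c_def by (rule fourier_summable[OF D(6) rn])
      \<comment> \<open>the dilate \<open>f (r n * \<zeta>)\<close>, written as a limit to have a Borel function on the whole plane\<close>
      define F where "F = (\<lambda>\<zeta>. lim (\<lambda>N. trig_poly (\<lambda>k. c k * of_real (r n) ^ k) {..<N} \<zeta>))"
      have Feq: "(\<lambda>N. trig_poly (\<lambda>k. c k * of_real (r n) ^ k) {..<N} \<zeta>) \<longlonglongrightarrow> f (of_real (r n) * \<zeta>)"
        if "norm \<zeta> = 1" for \<zeta>
        using D(3)[of "of_real (r n) * \<zeta>"] that rn
        by (simp add: norm_mult sums_def trig_poly_def c_def power_mult_distrib mult.assoc)
      have Fv: "F \<zeta> = f (of_real (r n) * \<zeta>)" if "norm \<zeta> = 1" for \<zeta>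
        unfolding F_def by (rule limI[OF Feq[OF that]])
      have F: "(\<lambda>N. trig_poly (\<lambda>k. c k * of_real (r n) ^ k) {..<N} \<zeta>) \<longlonglongrightarrow> F \<zeta>"
        if "norm \<zeta> = 1" for \<zeta> using Feq[OF that] Fv[OF that] by simp
      have [measurable]: "trig_poly a I \<in> borel_measurable borel" for a I
        by (rule L2_measurable[OF L2_trig_poly])
      have [measurable]: "F \<in> borel_measurable borel" unfolding F_def by measurable
      have Fb: "norm (F \<zeta>) \<le> C" if "norm \<zeta> = 1" for \<zeta>
        unfolding Fv[OF that] by (rule b) (use that rn in \<open>simp add: norm_mult\<close>)
      have FL: "F \<in> L2_circle"
        by (rule L2_bounded[where C=C]) (use AE_circle_norm_1 Fb in \<open>auto elim: eventually_mono\<close>)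
      have "(\<lambda>N. LINT \<zeta>|\<mu>. trig_poly (\<lambda>k. c k * of_real (r n) ^ k) {..<N} \<zeta> * h \<zeta>)
         \<longlonglongrightarrow> (LINT \<zeta>|\<mu>. F \<zeta> * h \<zeta>)"
      proof (rule integral_dominated_convergence[where w="\<lambda>_. B"])
        show "AE \<zeta> in \<mu>. (\<lambda>N. trig_poly (\<lambda>k. c k * of_real (r n) ^ k) {..<N} \<zeta> * h \<zeta>) \<longlonglongrightarrow> F \<zeta> * h \<zeta>"
          using AE_circle_norm_1 by eventually_elim (intro tendsto_intros F)
        show "AE \<zeta> in \<mu>. norm (trig_poly (\<lambda>k. c k * of_real (r n) ^ k) {..<N} \<zeta> * h \<zeta>) \<le> B" for N
          using AE_circle_norm_1
        proof eventually_elim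
          case (elim \<zeta>)
          have "norm (trig_poly (\<lambda>k. c k * of_real (r n) ^ k) {..<N} \<zeta> * h \<zeta>) \<le> norm (trig_poly (\<lambda>k. c k * of_real (r n) ^ k) {..<N} \<zeta>)"
            by (simp add: h_def indicator_def)
          also have "\<dots> \<le> (\<Sum>k<N. norm (c k * of_real (r n) ^ k * \<zeta> ^ k))"
            unfolding trig_poly_def by (rule norm_sum)
          also have "\<dots> = (\<Sum>k<N. norm (c k * of_real (r n) ^ k))"
            using elim by (simp add: norm_mult norm_power)
          also have "\<dots> \<le> B" unfolding B_def by (rule sum_le_suminf[OF Bs]) auto
          finally show ?case .
        qed
      qed (simp_all add: F_def)
      then have "(\<lambda>k. c k * of_real (r n) ^ k * e k) sums (LINT \<zeta>|\<mu>. F \<zeta> * h \<zeta>)"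
        by (simp add: trig sums_def)
      then have "(\<Sum>k. c k * e k * of_real (r n) ^ k) = (LINT \<zeta>|\<mu>. F \<zeta> * h \<zeta>)"
        by (simp add: sums_iff mult_ac)
      also have "norm \<dots> \<le> (LINT \<zeta>|\<mu>. C * indicator A \<zeta>)"
      proof (rule order_trans[OF integral_norm_bound], rule integral_mono_AE)
        show "integrable \<mu> (\<lambda>\<zeta>. norm (F \<zeta> * h \<zeta>))"
          using L2_mult_integrable[OF FL h] by (rule integrable_norm)
        show "integrable \<mu> (\<lambda>\<zeta>. C * indicator A \<zeta>)"
          by (intro integrable_mult_right integrable_real_indicator) (auto simp: circle.emeasure_eq_measure)
        show "AE \<zeta> in \<mu>. norm (F \<zeta> * h \<zeta>) \<le> C * indicator A \<zeta>"
          using AE_circle_norm_1 by eventually_elim (use Fb in \<open>auto simp: h_def indicator_def\<close>)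
      qed
      also have "\<dots> = C * measure \<mu> A" by simp
      finally show ?thesis .
    qed
    have "(\<lambda>n. \<Sum>k. c k * e k * of_real (r n) ^ k) \<longlonglongrightarrow> (\<Sum>k. c k * e k)"
    proof -
      have "(\<lambda>n. c k * e k * of_real (r n) ^ k) \<longlonglongrightarrow> c k * e k * of_real 1 ^ k" for k
        by (intro tendsto_intros r1)
      then have "(\<lambda>n. c k * e k * of_real (r n) ^ k) \<longlonglongrightarrow> c k * e k" for k by simp
      moreover have "\<forall>\<^sub>F (k, n) in at_top \<times>\<^sub>F sequentially. norm (c k * e k * of_real (r n) ^ k) \<le> norm (c k * e k)"
        using r01 by (intro always_eventually)
          (auto simp: norm_mult norm_power power_le_one less_imp_le intro!: mult_left_le)
      ultimately show ?thesis
        using tannerys_theorem[OF _ _ sm, where F=sequentially and a="\<lambda>k n. c k * e k * of_real (r n) ^ k"] by simp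
    qed
    from LIMSEQ_le_const2[OF tendsto_norm[OF this]] dil
    have "norm (\<Sum>k. c k * e k) \<le> C * measure \<mu> A" by blast
    moreover have "(\<Sum>k. c k * e k) = (LINT \<zeta>:A|\<mu>. g \<zeta>)"
      using sums by (simp add: sums_iff set_lebesgue_integral_def h_def scaleR_conv_of_real mult.commute)
    ultimately show "(1 / measure \<mu> A) *\<^sub>R (LINT \<zeta>:A|\<mu>. g \<zeta>) \<in> cball 0 C"
      using mA by (simp add: divide_le_eq)
  qed auto
  then show ?thesis by simp
qed

section \<open>Matrices as operators\<close>

lemma hinner_add_left: "hinner (u + v) w = hinner u w + hinner v w"
  by (simp add: hinner_def distrib_right sum.distrib)

lemma hinner_diff_left: "hinner (u - v) w = hinner u w - hinner v w"
  by (simp add: hinner_def left_diff_distrib sum_subtractf)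

lemma hinner_diff_right: "hinner u (v - w) = hinner u v - hinner u w"
  by (simp add: hinner_def right_diff_distrib sum_subtractf)

lemma hinner_scale_left: "hinner (c *s u) v = c * hinner u v"
  by (simp add: hinner_def sum_distrib_left mult.assoc)

lemma hinner_cnj: "cnj (hinner u v) = hinner v u"
  by (simp add: hinner_def mult.commute)

lemma hinner_self: "hinner v v = of_real ((norm v)\<^sup>2)"
proof -
  have "hinner v v = (\<Sum>i\<in>UNIV. of_real ((norm (v $ i))\<^sup>2))"
    unfolding hinner_def complex_norm_square ..
  also have "\<dots> = of_real (\<Sum>i\<in>UNIV. (norm (v $ i))\<^sup>2)" by simp
  also have "(\<Sum>i\<in>UNIV. (norm (v $ i))\<^sup>2) = (norm v)\<^sup>2"
    by (simp add: norm_vec_def L2_set_def sum_nonneg)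
  finally show ?thesis .
qed

lemma hinner_Cauchy_Schwarz: "norm (hinner u v) \<le> norm u * norm v"
proof -
  have "norm (hinner u v) \<le> (\<Sum>i\<in>UNIV. \<bar>norm (u $ i)\<bar> * \<bar>norm (v $ i)\<bar>)"
    unfolding hinner_def by (rule sum_norm_le) (simp add: norm_mult)
  also have "\<dots> \<le> norm u * norm v"
    unfolding norm_vec_def by (rule L2_set_mult_ineq)
  finally show ?thesis .
qed

lemma hinner_adj: "hinner (A *v u) v = hinner u (adj A *v v)"
proof -
  have "hinner (A *v u) v = (\<Sum>i\<in>UNIV. \<Sum>j\<in>UNIV. A $ i $ j * u $ j * cnj (v $ i))"
    by (simp add: hinner_def matrix_vector_mult_def sum_distrib_right)
  also have "\<dots> = (\<Sum>j\<in>UNIV. \<Sum>i\<in>UNIV. A $ i $ j * u $ j * cnj (v $ i))"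
    by (rule sum.swap)
  also have "\<dots> = hinner u (adj A *v v)"
    by (simp add: hinner_def matrix_vector_mult_def adj_def sum_distrib_left mult_ac)
  finally show ?thesis .
qed

lemma adj_adj [simp]: "adj (adj A) = A"
  by (simp add: adj_def vec_eq_iff)

lemma adj_mult: "adj (A ** B) = adj B ** adj A"
  by (simp add: adj_def vec_eq_iff matrix_matrix_mult_def mult.commute)

lemma adj_diff: "adj (A - B) = adj A - adj B"
  by (simp add: adj_def vec_eq_iff)

lemma adj_mat_1 [simp]: "adj (mat 1) = mat 1"
  by (auto simp: adj_def vec_eq_iff mat_def)

lemma matrix_axis_nth: "(A *v axis j (1::complex)) $ i = A $ i $ j"
  by (simp add: matrix_vector_mult_def axis_def if_distrib cong: if_cong)

lemma opnorm_bound: "norm (A *v v) \<le> opnorm A * norm v"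
  unfolding opnorm_def by (rule onorm) simp

lemma opnorm_nonneg: "0 \<le> opnorm A"
  unfolding opnorm_def by (rule onorm_pos_le) simp

lemma adj_bound:
  assumes "\<And>v. norm (A *v v) \<le> q * norm v"
  shows "norm (adj A *v v) \<le> q * norm v"
proof (cases "adj A *v v = 0")
  case True
  have "0 \<le> q * norm v" using assms[of v] norm_ge_zero order_trans by blast
  then show ?thesis using True by simp
next
  case False
  let ?w = "adj A *v v"
  have "(norm ?w)\<^sup>2 = norm (hinner ?w ?w)" by (simp add: hinner_self norm_power)
  also have "hinner ?w ?w = hinner (A *v ?w) v" using hinner_adj[of A ?w v] by simp
  also have "norm \<dots> \<le> norm (A *v ?w) * norm v" by (rule hinner_Cauchy_Schwarz)
  also have "\<dots> \<le> (q * norm ?w) * norm v" by (intro mult_right_mono assms) simp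
  finally have "norm ?w * norm ?w \<le> (q * norm v) * norm ?w" by (simp add: power2_eq_square mult_ac)
  then show ?thesis using False by simp
qed

lemma unitary_norm: "unitary U \<Longrightarrow> norm (U *v v) = norm v"
proof -
  assume "unitary U"
  then have "hinner (U *v v) (U *v v) = hinner v v"
    by (simp add: hinner_adj unitary_def matrix_vector_mul_assoc)
  then have "(norm (U *v v))\<^sup>2 = (norm v)\<^sup>2" by (simp add: hinner_self del: of_real_power)
  then show ?thesis by simp
qed

lemma matrix_inv_unique:
  fixes A B :: "'a::field^'n^'n"
  assumes "B ** A = mat 1"
  shows "matrix_inv A = B"
proof -
  have "A ** B = mat 1" using assms matrix_left_right_inverse by blast
  then have "A ** matrix_inv A = mat 1 \<and> matrix_inv A ** A = mat 1"
    unfolding matrix_inv_def using assms by (intro someI[of "\<lambda>A'. A ** A' = mat 1 \<and> A' ** A = mat 1"]) auto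
  then show ?thesis by (metis assms matrix_mul_assoc matrix_mul_lid matrix_mul_rid)
qed

lemma resolvent:
  fixes X :: "complex^'d^'d"
  assumes q: "q < 1" and X: "\<And>v. norm (X *v v) \<le> q * norm v"
  shows "matrix_inv (mat 1 - X) ** (mat 1 - X) = mat 1"
    and "(mat 1 - X) ** matrix_inv (mat 1 - X) = mat 1"
    and "norm (matrix_inv (mat 1 - X) *v v) \<le> norm v / (1 - q)"
proof -
  have low: "(1 - q) * norm v \<le> norm ((mat 1 - X) *v v)" for v
  proof -
    have "norm v \<le> norm (v - X *v v) + norm (X *v v)" by (metis diff_add_cancel norm_triangle_ineq)
    then show ?thesis using X[of v] by (simp add: matrix_vector_mult_diff_rdistrib algebra_simps)
  qed
  have "v = 0" if "(mat 1 - X) *v v = 0" for v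
    using low[of v] that q by (simp add: mult_le_0_iff)
  then obtain B where B: "B ** (mat 1 - X) = mat 1" using matrix_left_invertible_ker by blast
  have [simp]: "matrix_inv (mat 1 - X) = B" by (rule matrix_inv_unique[OF B])
  show "matrix_inv (mat 1 - X) ** (mat 1 - X) = mat 1" using B by simp
  show 2: "(mat 1 - X) ** matrix_inv (mat 1 - X) = mat 1" using B matrix_left_right_inverse by simp blast
  have "(1 - q) * norm (matrix_inv (mat 1 - X) *v v) \<le> norm ((mat 1 - X) *v (matrix_inv (mat 1 - X) *v v))"
    by (rule low)
  also have "\<dots> = norm v" unfolding matrix_vector_mul_assoc 2 by simp
  finally show "norm (matrix_inv (mat 1 - X) *v v) \<le> norm v / (1 - q)"
    using q by (simp add: le_divide_eq mult.commute)
qed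

section \<open>Positive square roots\<close>

text \<open>The trace form of the Hilbert--Schmidt inner product of \<open>M\<close> and \<open>N\<close>.\<close>

lemma sum_hinner_axis: "(\<Sum>i\<in>UNIV. hinner (M *v axis i 1) (N *v axis i 1)) = trace (adj N ** M)"
proof -
  show ?thesis
    by (simp add: trace_def matrix_matrix_mult_def hinner_def matrix_axis_nth adj_def mult.commute)
qed

lemma matrix_eq_0_axis: "(\<And>i. M *v axis i 1 = (0::complex^'d)) \<Longrightarrow> M = (0::complex^'d^'d)"
proof -
  assume a: "\<And>i. M *v axis i 1 = (0::complex^'d)"
  show ?thesis using a by (simp add: vec_eq_iff matrix_axis_nth)
qed

text \<open>The Sylvester equation with positive coefficients has only the trivial solution; it yields
  both uniqueness of positive square roots and the intertwining relation of the defect operators.\<close>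

lemma Sylvester_zero:
  fixes A B Z :: "complex^'d^'d"
  assumes \<delta>: "\<delta> > 0" and A: "\<And>v. \<delta> * (norm v)\<^sup>2 \<le> Re (hinner (A *v v) v)"
    and B: "\<And>v. 0 \<le> Re (hinner (B *v v) v)" and eq: "A ** Z + Z ** B = 0"
  shows "Z = 0"
proof -
  have "(\<Sum>i\<in>UNIV. hinner ((A ** Z) *v axis i 1) (Z *v axis i 1))
      + (\<Sum>i\<in>UNIV. hinner ((Z ** B) *v axis i 1) (Z *v axis i 1))
     = (\<Sum>i\<in>UNIV. hinner ((A ** Z + Z ** B) *v axis i 1) (Z *v axis i 1))"
    by (simp add: matrix_vector_mult_add_rdistrib hinner_add_left sum.distrib)
  also have "\<dots> = 0" unfolding eq by (simp add: hinner_def)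
  finally have e: "(\<Sum>i\<in>UNIV. hinner ((A ** Z) *v axis i 1) (Z *v axis i 1))
      + (\<Sum>i\<in>UNIV. hinner ((Z ** B) *v axis i 1) (Z *v axis i 1)) = 0" .
  have "(\<Sum>i\<in>UNIV. hinner ((Z ** B) *v axis i 1) (Z *v axis i 1)) = trace (adj Z ** (Z ** B))"
    by (rule sum_hinner_axis)
  also have "\<dots> = trace ((Z ** B) ** adj Z)" by (rule trace_mul_sym)
  also have "\<dots> = trace (adj (adj Z) ** (B ** adj Z))" by (simp add: matrix_mul_assoc)
  also have "\<dots> = (\<Sum>i\<in>UNIV. hinner ((B ** adj Z) *v axis i 1) (adj Z *v axis i 1))"
    by (rule sum_hinner_axis[symmetric])
  also have "Re \<dots> \<ge> 0"
    unfolding Re_sum matrix_vector_mul_assoc[symmetric] by (intro sum_nonneg B)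
  finally have b: "Re (\<Sum>i\<in>UNIV. hinner ((Z ** B) *v axis i 1) (Z *v axis i 1)) \<ge> 0" .
  have a: "Re (\<Sum>i\<in>UNIV. hinner ((A ** Z) *v axis i 1) (Z *v axis i 1)) \<ge> (\<Sum>i\<in>UNIV. \<delta> * (norm (Z *v axis i 1))\<^sup>2)"
    unfolding Re_sum matrix_vector_mul_assoc[symmetric] by (intro sum_mono A)
  have "(\<Sum>i\<in>UNIV. \<delta> * (norm (Z *v axis i 1))\<^sup>2) \<le> 0"
    using a b arg_cong[OF e, of Re] by simp
  moreover have "(\<Sum>i\<in>UNIV. \<delta> * (norm (Z *v axis i 1))\<^sup>2) \<ge> 0" using \<delta> by (intro sum_nonneg) simp
  ultimately have "(\<Sum>i\<in>UNIV. \<delta> * (norm (Z *v axis i 1))\<^sup>2) = 0" by linarith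
  then have "\<forall>i\<in>UNIV. \<delta> * (norm (Z *v axis i 1))\<^sup>2 = 0"
    using \<delta> by (subst (asm) sum_nonneg_eq_0_iff) auto
  then show ?thesis using \<delta> by (intro matrix_eq_0_axis) simp
qed

text \<open>The square root of \<open>I - X\<close> is \<open>I - Y\<close>, where \<open>Y\<close> is the limit of the iteration
  \<open>Y \<mapsto> (X + Y\<^sup>2) / 2\<close>, which stays in the ball of radius \<open>r = 1 - sqrt (1 - q)\<close> and is
  contracting there.\<close>

primrec sqrt_iter :: "complex^'d^'d \<Rightarrow> nat \<Rightarrow> complex^'d^'d" where
  "sqrt_iter X 0 = 0"
| "sqrt_iter X (Suc n) = (1/2) *\<^sub>R (X + sqrt_iter X n ** sqrt_iter X n)"

lemma scaleR_mv: "(c *\<^sub>R A) *v v = c *\<^sub>R (A *v (v::complex^'d))"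
  by (simp add: vec_eq_iff matrix_vector_mult_def scaleR_sum_right)

lemma positive_sqrt_exists:
  fixes X :: "complex^'d^'d"
  assumes sa: "adj X = X" and q: "0 \<le> q" "q < 1" and X: "\<And>v. norm (X *v v) \<le> q * norm v"
  obtains S \<delta> where "adj S = S" "S ** S = mat 1 - X" "\<delta> > 0"
    "\<And>v. \<delta> * (norm v)\<^sup>2 \<le> Re (hinner (S *v v) v)"
proof -
  define r where "r = 1 - sqrt (1 - q)"
  have r: "0 \<le> r" "r < 1" and rq: "q + r * r = 2 * r"
  proof -
    show "0 \<le> r" "r < 1" using q by (auto simp: r_def)
    have "sqrt (1 - q) * sqrt (1 - q) = 1 - q" using q by simp
    then show "q + r * r = 2 * r" by (simp add: r_def algebra_simps)
  qed
  define Y where "Y = sqrt_iter X"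
  have Y0: "Y 0 = 0" and YS: "Y (Suc n) = (1/2) *\<^sub>R (X + Y n ** Y n)" for n by (simp_all add: Y_def)
  have Yb: "norm (Y n *v v) \<le> r * norm v" for n v
  proof (induction n arbitrary: v)
    case 0
    then show ?case using r by (simp add: Y0)
  next
    case (Suc n)
    have "norm (Y n *v (Y n *v v)) \<le> r * (r * norm v)"
      using Suc[of "Y n *v v"] mult_left_mono[OF Suc[of v] r(1)] by linarith
    moreover have "norm (X *v v + Y n *v (Y n *v v)) \<le> norm (X *v v) + norm (Y n *v (Y n *v v))"
      by (rule norm_triangle_ineq)
    ultimately have "norm (X *v v + Y n *v (Y n *v v)) \<le> q * norm v + r * (r * norm v)"
      using X[of v] by linarith
    also have "\<dots> = (q + r * r) * norm v" by (simp add: algebra_simps)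
    finally show ?case
      by (simp add: YS scaleR_mv matrix_vector_mult_add_rdistrib matrix_vector_mul_assoc[symmetric] rq)
  qed
  have Yd: "norm ((Y (Suc n) - Y n) *v v) \<le> r ^ n * (q * norm v)" for n v
  proof (induction n arbitrary: v)
    case 0
    have "norm (X *v v) / 2 \<le> q * norm v"
      using X[of v] mult_nonneg_nonneg[OF q(1) norm_ge_zero[of v]] by linarith
    then show ?case by (simp add: Y0 YS scaleR_mv)
  next
    case (Suc n)
    let ?D = "Y (Suc n) - Y n"
    have "Y (Suc (Suc n)) - Y (Suc n) = (1/2) *\<^sub>R (Y (Suc n) ** Y (Suc n) - Y n ** Y n)"
      unfolding YS[of "Suc n"] using YS[of n] by (simp add: scaleR_diff_right scaleR_add_right)
    then have eq: "(Y (Suc (Suc n)) - Y (Suc n)) *v v = (1/2) *\<^sub>R (Y (Suc n) *v (?D *v v) + ?D *v (Y n *v v))"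
      by (simp add: scaleR_mv matrix_vector_mult_diff_rdistrib matrix_vector_mul_assoc[symmetric]
           matrix_vector_mult_diff_distrib)
    have 1: "norm (Y (Suc n) *v (?D *v v)) \<le> r * (r ^ n * (q * norm v))"
      using Yb[of "Suc n" "?D *v v"] mult_left_mono[OF Suc[of v] r(1)] by linarith
    have "r ^ n * (q * norm (Y n *v v)) \<le> r ^ n * (q * (r * norm v))"
      using r q by (intro mult_left_mono Yb) auto
    then have 2: "norm (?D *v (Y n *v v)) \<le> r * (r ^ n * (q * norm v))"
      using Suc[of "Y n *v v"] by (simp add: mult_ac)
    have "norm (Y (Suc n) *v (?D *v v) + ?D *v (Y n *v v)) \<le> 2 * (r * (r ^ n * (q * norm v)))"
      using 1 2 norm_triangle_ineq[of "Y (Suc n) *v (?D *v v)" "?D *v (Y n *v v)"] by linarith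
    then show ?case unfolding eq by simp
  qed
  define L where "L = (\<chi> i j. lim (\<lambda>n. Y n $ i $ j))"
  have ent: "(\<lambda>n. Y n $ i $ j) \<longlonglongrightarrow> L $ i $ j" for i j
  proof -
    have "norm (Y (Suc n) $ i $ j - Y n $ i $ j) \<le> r ^ n * q" for n
    proof -
      have "Y (Suc n) $ i $ j - Y n $ i $ j = ((Y (Suc n) - Y n) *v axis j 1) $ i"
        by (simp add: matrix_axis_nth)
      also have "norm \<dots> \<le> norm ((Y (Suc n) - Y n) *v axis j 1)" by (rule Finite_Cartesian_Product.norm_nth_le)
      also have "\<dots> \<le> r ^ n * (q * norm (axis j 1 :: complex^'d))" by (rule Yd)
      finally show ?thesis by simp
    qed
    then have "summable (\<lambda>n. Y (Suc n) $ i $ j - Y n $ i $ j)"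
      using r by (intro summable_comparison_test[OF _ summable_mult2[OF summable_geometric[of r], of q]]) auto
    then have "convergent (\<lambda>n. Y n $ i $ j)"
      using sum_lessThan_telescope[of "\<lambda>n. Y n $ i $ j"] by (simp add: summable_iff_convergent Y0)
    then show ?thesis by (simp add: L_def convergent_LIMSEQ_iff)
  qed
  have lim: "Y \<longlonglongrightarrow> L" by (intro vec_tendstoI ent)
  have mv: "(\<lambda>n. Y n *v v) \<longlonglongrightarrow> L *v v" for v
    unfolding matrix_vector_mult_def by (intro tendsto_intros ent)
  have "(\<lambda>n. Y n ** Y n) \<longlonglongrightarrow> L ** L"
    unfolding matrix_matrix_mult_def by (intro tendsto_intros ent)
  then have "(\<lambda>n. Y (Suc n)) \<longlonglongrightarrow> (1/2) *\<^sub>R (X + L ** L)"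
    unfolding YS by (intro tendsto_intros)
  from LIMSEQ_unique[OF LIMSEQ_Suc[OF lim] this] have L: "L = (1/2) *\<^sub>R (X + L ** L)" .
  from arg_cong[OF L, of "\<lambda>A. 2 *\<^sub>R A"] have "L + L = X + L ** L" by (simp add: scaleR_2)
  then have L2: "L ** L = L + L - X" by simp
  have Lb: "norm (L *v v) \<le> r * norm v" for v
    using LIMSEQ_le_const2[OF tendsto_norm[OF mv]] Yb by blast
  have Ya: "adj (Y n) = Y n" for n
  proof (induction n)
    case (Suc n)
    have "adj (c *\<^sub>R (A + B)) = c *\<^sub>R (adj A + adj B)" for c and A B :: "complex^'d^'d"
      by (simp add: adj_def vec_eq_iff)
    then show ?case by (simp add: YS adj_mult Suc sa)
  qed (simp add: Y0 adj_def vec_eq_iff)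
  have "(\<lambda>n. adj (Y n)) \<longlonglongrightarrow> adj L"
    unfolding adj_def by (intro tendsto_intros ent)
  then have La: "adj L = L" unfolding Ya by (rule LIMSEQ_unique[OF _ lim])
  show ?thesis
  proof (rule that[of "mat 1 - L" "1 - r"])
    show "adj (mat 1 - L) = mat 1 - L" by (simp add: adj_diff La)
    show "(mat 1 - L) ** (mat 1 - L) = mat 1 - X"
    proof -
      have "((mat 1 - L) ** (mat 1 - L)) *v v = v - L *v v - L *v v + (L ** L) *v v" for v
        by (simp add: matrix_vector_mul_assoc[symmetric] matrix_vector_mult_diff_rdistrib matrix_vector_mult_diff_distrib)
      moreover have "(L ** L) *v v = L *v v + L *v v - X *v v" for v
        by (simp only: L2 matrix_vector_mult_diff_rdistrib matrix_vector_mult_add_rdistrib)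
      ultimately have "((mat 1 - L) ** (mat 1 - L)) *v v = (mat 1 - X) *v v" for v
        by (simp only: matrix_vector_mult_diff_rdistrib matrix_vector_mul_lid) simp
      then show ?thesis by (simp only: matrix_eq) blast
    qed
    show "1 - r > 0" using r by simp
    show "(1 - r) * (norm v)\<^sup>2 \<le> Re (hinner ((mat 1 - L) *v v) v)" for v
    proof -
      have "Re (hinner (L *v v) v) \<le> norm (L *v v) * norm v"
        using hinner_Cauchy_Schwarz complex_Re_le_cmod order_trans by blast
      also have "\<dots> \<le> (r * norm v) * norm v" by (intro mult_right_mono Lb) simp
      finally show ?thesis
        by (simp add: matrix_vector_mult_diff_rdistrib hinner_diff_left hinner_self power2_eq_square algebra_simps)
    qed
  qed
qed

lemma defect_op:
  fixes W :: "complex^'d^'d"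
  assumes "strict_contraction W"
  shows "adj (defect_op W) = defect_op W"
    and "defect_op W ** defect_op W = mat 1 - adj W ** W"
    and "\<exists>\<delta>>0. \<forall>v. \<delta> * (norm v)\<^sup>2 \<le> Re (hinner (defect_op W *v v) v)"
proof -
  define q where "q = opnorm W"
  have q: "0 \<le> q" "q < 1" using assms by (simp_all add: q_def opnorm_nonneg strict_contraction_def)
  have Wb: "norm (W *v v) \<le> q * norm v" for v unfolding q_def by (rule opnorm_bound)
  have Xb: "norm ((adj W ** W) *v v) \<le> q * norm v" for v
  proof -
    have "norm (adj W *v (W *v v)) \<le> q * norm (W *v v)" by (rule adj_bound[OF Wb])
    also have "\<dots> \<le> 1 * norm (W *v v)" using q by (intro mult_right_mono) auto
    finally show ?thesis using Wb[of v] by (simp add: matrix_vector_mul_assoc)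
  qed
  have "adj (adj W ** W) = adj W ** W" by (simp add: adj_mult)
  from positive_sqrt_exists[OF this q Xb] obtain S \<delta> where S: "adj S = S" "S ** S = mat 1 - adj W ** W"
    and \<delta>: "\<delta> > 0" "\<And>v. \<delta> * (norm v)\<^sup>2 \<le> Re (hinner (S *v v) v)" by blast
  have pos: "positive_op S" unfolding positive_op_def
  proof (intro conjI allI S)
    show "0 \<le> Re (hinner (S *v v) v)" for v
      using \<delta>(2)[of v] \<delta>(1) by (meson mult_nonneg_nonneg less_imp_le order_trans zero_le_power2)
  qed
  have uniq: "T = S" if T: "positive_op T" "T ** T = mat 1 - adj W ** W" for T
  proof -
    have "S ** (S - T) + (S - T) ** T = S ** S - T ** T"
      by (simp add: matrix_eq matrix_vector_mult_add_rdistrib matrix_vector_mult_diff_rdistrib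
          matrix_vector_mul_assoc[symmetric] matrix_vector_mult_diff_distrib)
    also have "\<dots> = 0" unfolding S(2) T(2) by simp
    finally have *: "S ** (S - T) + (S - T) ** T = 0" .
    have "0 \<le> Re (hinner (T *v v) v)" for v using T(1) by (simp add: positive_op_def)
    from Sylvester_zero[OF \<delta> this *] have "S - T = 0" .
    then show "T = S" by simp
  qed
  have D: "defect_op W = S"
    unfolding defect_op_def sqrt_op_def using pos S(2) uniq by (intro the_equality) blast+
  show "adj (defect_op W) = defect_op W" unfolding D by (rule S(1))
  show "defect_op W ** defect_op W = mat 1 - adj W ** W" unfolding D by (rule S(2))
  show "\<exists>\<delta>>0. \<forall>v. \<delta> * (norm v)\<^sup>2 \<le> Re (hinner (defect_op W *v v) v)"
    unfolding D using \<delta> by blast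
qed

lemma strict_contraction_adj:
  assumes "strict_contraction W" shows "strict_contraction (adj W)"
proof -
  have "opnorm (adj W) \<le> opnorm W"
    unfolding opnorm_def[of "adj W"] by (rule onorm_le) (rule adj_bound[OF opnorm_bound])
  then show ?thesis using assms by (simp add: strict_contraction_def)
qed

lemma defect_op_inverse:
  assumes "strict_contraction W"
  obtains E where "E ** defect_op W = mat 1" "defect_op W ** E = mat 1"
proof -
  obtain \<delta> where \<delta>: "\<delta> > 0" "\<And>v. \<delta> * (norm v)\<^sup>2 \<le> Re (hinner (defect_op W *v v) v)"
    using defect_op(3)[OF assms] by blast
  have "v = 0" if "defect_op W *v v = 0" for v
    using \<delta>(2)[of v] \<delta>(1) that by (simp add: hinner_def mult_le_0_iff)
  then obtain E where "E ** defect_op W = mat 1" using matrix_left_invertible_ker by blast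
  then show ?thesis using that matrix_left_right_inverse by blast
qed

lemma defect_op_intertwine:
  assumes W: "strict_contraction W"
  shows "defect_op (adj W) ** W = W ** defect_op W"
proof -
  let ?A = "defect_op (adj W)" and ?B = "defect_op W"
  note A = defect_op[OF strict_contraction_adj[OF W]] and B = defect_op[OF W]
  obtain \<delta> where \<delta>: "\<delta> > 0" "\<And>v. \<delta> * (norm v)\<^sup>2 \<le> Re (hinner (?A *v v) v)" using A(3) by blast
  obtain \<epsilon> where \<epsilon>: "\<epsilon> > 0" "\<And>v. \<epsilon> * (norm v)\<^sup>2 \<le> Re (hinner (?B *v v) v)" using B(3) by blast
  have B0: "0 \<le> Re (hinner (?B *v v) v)" for v
    using \<epsilon>(2)[of v] \<epsilon>(1) by (meson mult_nonneg_nonneg less_imp_le order_trans zero_le_power2)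
  have "?A ** (?A ** W - W ** ?B) + (?A ** W - W ** ?B) ** ?B = (?A ** ?A) ** W - W ** (?B ** ?B)"
    by (simp add: matrix_eq matrix_vector_mult_add_rdistrib matrix_vector_mult_diff_rdistrib
          matrix_vector_mul_assoc[symmetric] matrix_vector_mult_diff_distrib)
  also have "\<dots> = 0"
    unfolding A B
    by (simp add: matrix_eq matrix_vector_mult_diff_rdistrib
          matrix_vector_mul_assoc[symmetric] matrix_vector_mult_diff_distrib)
  finally have "?A ** W - W ** ?B = 0" by (rule Sylvester_zero[OF \<delta> B0])
  then show ?thesis by simp
qed

section \<open>Vector- and matrix-valued Hardy functions\<close>

text \<open>As for scalar functions, \<open>vec_boundary f g\<close> says that \<open>g\<close> is a boundary function of
  \<open>f \<in> H\<^sup>2\<close>; working with an arbitrary \<open>g\<close> instead of the chosen one avoids almost everywhere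
  corrections.\<close>

definition vec_boundary :: "(complex \<Rightarrow> complex^'d) \<Rightarrow> (complex \<Rightarrow> complex^'d) \<Rightarrow> bool" where
  "vec_boundary f g \<longleftrightarrow> (\<forall>i. boundary_of (\<lambda>z. f z $ i) (\<lambda>\<zeta>. g \<zeta> $ i))"

text \<open>The same for matrix-valued functions, entrywise.\<close>

definition mat_boundary :: "(complex \<Rightarrow> complex^'d^'d) \<Rightarrow> (complex \<Rightarrow> complex^'d^'d) \<Rightarrow> bool" where
  "mat_boundary F G \<longleftrightarrow> (\<forall>i j. boundary_of (\<lambda>z. F z $ i $ j) (\<lambda>\<zeta>. G \<zeta> $ i $ j))"

lemma vec_nth_measurable [measurable]: "(\<lambda>v::'a::euclidean_space^'n. v $ i) \<in> borel_measurable borel"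
  by (intro borel_measurable_continuous_onI continuous_intros)

lemma borel_measurable_vec_iff:
  fixes f :: "'b \<Rightarrow> 'a::euclidean_space^'n"
  shows "f \<in> borel_measurable M \<longleftrightarrow> (\<forall>i. (\<lambda>x. f x $ i) \<in> borel_measurable M)"
proof
  assume "f \<in> borel_measurable M"
  then show "\<forall>i. (\<lambda>x. f x $ i) \<in> borel_measurable M"
    using measurable_compose[OF _ vec_nth_measurable] by blast
next
  assume [rule_format, measurable]: "\<forall>i. (\<lambda>x. f x $ i) \<in> borel_measurable M"
  show "f \<in> borel_measurable M"
  proof (rule borel_measurable_euclidean_space[THEN iffD2], rule)
    fix b :: "'a^'n" assume "b \<in> Basis"
    have "(\<lambda>x. f x \<bullet> b) = (\<lambda>x. \<Sum>i\<in>UNIV. (f x $ i) \<bullet> (b $ i))" by (simp add: inner_vec_def)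
    moreover have "(\<lambda>x. f x $ i) \<in> borel_measurable M" for i by measurable
    ultimately show "(\<lambda>x. f x \<bullet> b) \<in> borel_measurable M" by simp
  qed
qed

lemma borel_measurable_mat_iff:
  fixes f :: "'b \<Rightarrow> complex^'n^'m"
  shows "f \<in> borel_measurable M \<longleftrightarrow> (\<forall>i j. (\<lambda>x. f x $ i $ j) \<in> borel_measurable M)"
proof -
  have "(\<lambda>x. f x $ i) \<in> borel_measurable M \<longleftrightarrow> (\<forall>j. (\<lambda>x. f x $ i $ j) \<in> borel_measurable M)" for i
    by (rule borel_measurable_vec_iff)
  then show ?thesis using borel_measurable_vec_iff[of f M] by blast
qed

lemma matrix_vector_measurable [measurable (raw)]:
  fixes A :: "'b \<Rightarrow> complex^'n^'m" and f :: "'b \<Rightarrow> complex^'n"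
  assumes "A \<in> borel_measurable M" "f \<in> borel_measurable M"
  shows "(\<lambda>x. A x *v f x) \<in> borel_measurable M"
proof -
  have "(\<lambda>x. A x $ i $ j) \<in> borel_measurable M" "(\<lambda>x. f x $ j) \<in> borel_measurable M" for i j
    using assms by (simp_all add: borel_measurable_mat_iff borel_measurable_vec_iff)
  then have "(\<lambda>x. (A x *v f x) $ i) \<in> borel_measurable M" for i
    unfolding matrix_vector_mult_def by simp
  then show ?thesis using borel_measurable_vec_iff by blast
qed

lemma matrix_matrix_measurable [measurable (raw)]:
  fixes A :: "'b \<Rightarrow> complex^'n^'m" and B :: "'b \<Rightarrow> complex^'p^'n"
  assumes "A \<in> borel_measurable M" "B \<in> borel_measurable M"
  shows "(\<lambda>x. A x ** B x) \<in> borel_measurable M"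
proof -
  have "(\<lambda>x. A x $ i $ j) \<in> borel_measurable M" "(\<lambda>x. B x $ j $ k) \<in> borel_measurable M" for i j k
    using assms by (simp_all add: borel_measurable_mat_iff)
  then have "(\<lambda>x. (A x ** B x) $ i $ j) \<in> borel_measurable M" for i j
    unfolding matrix_matrix_mult_def by simp
  then show ?thesis using borel_measurable_mat_iff by blast
qed

lemma adj_measurable [measurable (raw)]:
  fixes A :: "'b \<Rightarrow> complex^'n^'n"
  assumes "A \<in> borel_measurable M"
  shows "(\<lambda>x. adj (A x)) \<in> borel_measurable M"
proof -
  have "(\<lambda>x. A x $ i $ j) \<in> borel_measurable M" for i j
    using assms by (simp_all add: borel_measurable_mat_iff)
  then have "(\<lambda>x. cnj (A x $ i $ j)) \<in> borel_measurable M" for i j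
    using measurable_compose[OF _ cnj_measurable] by blast
  then have "(\<lambda>x. adj (A x) $ i $ j) \<in> borel_measurable M" for i j
    unfolding adj_def by simp
  then show ?thesis using borel_measurable_mat_iff by blast
qed

lemma L2_vec_iff:
  fixes g :: "complex \<Rightarrow> 'a::euclidean_space^'n"
  shows "g \<in> L2_circle \<longleftrightarrow> (\<forall>i. (\<lambda>\<zeta>. g \<zeta> $ i) \<in> L2_circle)"
proof
  assume g: "g \<in> L2_circle"
  then have "g \<in> borel_measurable borel" by (rule L2_measurable)
  then have "(\<lambda>\<zeta>. g \<zeta> $ i) \<in> borel_measurable borel" for i by (simp add: borel_measurable_vec_iff)
  then show "\<forall>i. (\<lambda>\<zeta>. g \<zeta> $ i) \<in> L2_circle"
    by (auto intro!: L2_dominated[OF g, where C=1] AE_I2 Finite_Cartesian_Product.norm_nth_le)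
next
  assume g: "\<forall>i. (\<lambda>\<zeta>. g \<zeta> $ i) \<in> L2_circle"
  have e: "(norm (g \<zeta>))\<^sup>2 = (\<Sum>i\<in>UNIV. (norm (g \<zeta> $ i))\<^sup>2)" for \<zeta>
    by (simp add: norm_vec_def L2_set_def sum_nonneg)
  show "g \<in> L2_circle"
    using g by (simp add: L2_circle_iff borel_measurable_vec_iff[of g] e)
qed

lemma vec_boundaryD:
  assumes "vec_boundary f g"
  shows "g \<in> L2_circle" "g \<in> borel_measurable borel" "\<And>z. \<not> norm z < 1 \<Longrightarrow> f z = 0" "f \<in> H2_vec"
proof -
  have b: "boundary_of (\<lambda>z. f z $ i) (\<lambda>\<zeta>. g \<zeta> $ i)" for i using assms by (simp add: vec_boundary_def)
  show "g \<in> L2_circle" using boundary_ofD(1)[OF b] by (simp add: L2_vec_iff)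
  then show "g \<in> borel_measurable borel" by (rule L2_measurable)
  show "f \<in> H2_vec" using boundary_of_H2[OF b] by (simp add: H2_vec_def)
  show "f z = 0" if "\<not> norm z < 1" for z using boundary_ofD(4)[OF b that] by (simp add: vec_eq_iff)
qed

lemma vec_boundary_bdry: "f \<in> H2_vec \<Longrightarrow> vec_boundary f (bdry_vec f)"
  by (simp add: vec_boundary_def H2_vec_def bdry_vec_def boundary_of_bdry)

lemma mat_boundary_bdry: "F \<in> H2_mat \<Longrightarrow> mat_boundary F (bdry_mat F)"
  by (simp add: mat_boundary_def H2_mat_def bdry_mat_def boundary_of_bdry)

lemma vec_boundary_unique:
  assumes "vec_boundary f g" "vec_boundary f h"
  shows "AE \<zeta> in \<mu>. g \<zeta> = h \<zeta>"
proof -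
  have "AE \<zeta> in \<mu>. g \<zeta> $ i = h \<zeta> $ i" for i
    by (rule boundary_of_unique[of "\<lambda>z. f z $ i"]) (use assms in \<open>auto simp: vec_boundary_def\<close>)
  then have "AE \<zeta> in \<mu>. \<forall>i\<in>UNIV. g \<zeta> $ i = h \<zeta> $ i"
    by (intro AE_finite_allI) auto
  then show ?thesis by eventually_elim (simp add: vec_eq_iff)
qed

lemma vec_boundary_add:
  "vec_boundary f g \<Longrightarrow> vec_boundary f' g' \<Longrightarrow> vec_boundary (\<lambda>z. f z + f' z) (\<lambda>\<zeta>. g \<zeta> + g' \<zeta>)"
  by (simp add: vec_boundary_def boundary_of_add)

lemma vec_boundary_scale:
  "vec_boundary f g \<Longrightarrow> vec_boundary (\<lambda>z. c *s f z) (\<lambda>\<zeta>. c *s g \<zeta>)"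
  by (simp add: vec_boundary_def boundary_of_cmult)

lemma vec_boundary_diff:
  assumes "vec_boundary f g" "vec_boundary f' g'"
  shows "vec_boundary (\<lambda>z. f z - f' z) (\<lambda>\<zeta>. g \<zeta> - g' \<zeta>)"
  using vec_boundary_add[OF assms(1) vec_boundary_scale[OF assms(2), of "-1"]] by simp

lemma vec_boundary_const_mult:
  assumes "vec_boundary f g"
  shows "vec_boundary (\<lambda>z. A *v f z) (\<lambda>\<zeta>. A *v g \<zeta>)"
  using assms unfolding vec_boundary_def matrix_vector_mult_def
  by (auto intro!: boundary_of_sum boundary_of_cmult)

lemma vec_boundary_zero_imp_zero:
  assumes f: "vec_boundary f g" and ae: "AE \<zeta> in \<mu>. g \<zeta> = 0"
  shows "f z = 0"
proof (cases "norm z < 1")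
  case True
  have "f z $ i = 0" for i
  proof -
    have "boundary_of (\<lambda>z. f z $ i) (\<lambda>\<zeta>. g \<zeta> $ i)" using f by (simp add: vec_boundary_def)
    then have "boundary_of (\<lambda>z. f z $ i) (\<lambda>\<zeta>. 0)"
      by (rule boundary_of_cong_AE) (use ae in \<open>auto elim: eventually_mono\<close>)
    from boundary_bound_imp_bound[OF this, of 0] show ?thesis by simp
  qed
  then show ?thesis by (simp add: vec_eq_iff)
qed (use vec_boundaryD(3)[OF f] in simp)

lemma mat_boundary_measurable:
  assumes "mat_boundary F G" shows "G \<in> borel_measurable borel"
  using assms boundary_ofD(5) by (fastforce simp: mat_boundary_def borel_measurable_mat_iff)

lemma matrix_entry_le: "norm (A $ i $ j) \<le> norm (A *v axis j (1::complex))"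
proof -
  have "A $ i $ j = (A *v axis j 1) $ i"
    by (simp add: matrix_axis_nth)
  then show ?thesis using Finite_Cartesian_Product.norm_nth_le by metis
qed

lemma vec_boundary_mult:
  assumes F: "mat_boundary F G" and f: "vec_boundary f g"
    and b: "AE \<zeta> in \<mu>. \<forall>v. norm (G \<zeta> *v v) \<le> C * norm v"
  shows "vec_boundary (\<lambda>z. F z *v f z) (\<lambda>\<zeta>. G \<zeta> *v g \<zeta>)"
proof -
  have "boundary_of (\<lambda>z. F z $ i $ j * f z $ j) (\<lambda>\<zeta>. G \<zeta> $ i $ j * g \<zeta> $ j)" for i j
  proof (rule boundary_of_mult)
    show 1: "boundary_of (\<lambda>z. F z $ i $ j) (\<lambda>\<zeta>. G \<zeta> $ i $ j)" using F by (simp add: mat_boundary_def)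
    show 2: "boundary_of (\<lambda>z. f z $ j) (\<lambda>\<zeta>. g \<zeta> $ j)" using f by (simp add: vec_boundary_def)
    have [measurable]: "(\<lambda>\<zeta>. G \<zeta> $ i $ j) \<in> borel_measurable borel" "(\<lambda>\<zeta>. g \<zeta> $ j) \<in> borel_measurable borel"
      using boundary_ofD(5)[OF 1] boundary_ofD(5)[OF 2] by auto
    show "(\<lambda>\<zeta>. G \<zeta> $ i $ j * g \<zeta> $ j) \<in> L2_circle"
    proof (rule L2_dominated[OF boundary_ofD(1)[OF 2], where C=C])
      show "AE \<zeta> in \<mu>. norm (G \<zeta> $ i $ j * g \<zeta> $ j) \<le> C * norm (g \<zeta> $ j)"
        using b
      proof eventually_elim
        case (elim \<zeta>)
        have "norm (G \<zeta> $ i $ j) \<le> C"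
          using matrix_entry_le[of "G \<zeta>" i j] elim[rule_format, of "axis j 1"] by simp
        then show ?case by (simp add: norm_mult mult_right_mono)
      qed
    qed measurable
  qed
  then show ?thesis unfolding vec_boundary_def matrix_vector_mult_def
    by (auto intro!: boundary_of_sum)
qed

lemma vec_boundary_const: "vec_boundary (\<lambda>z. if norm z < 1 then c else 0) (\<lambda>_. c)"
  unfolding vec_boundary_def
proof
  fix i
  have "(\<lambda>z. (if norm z < 1 then c else 0) $ i) = (\<lambda>z::complex. if norm z < 1 then c $ i else 0)" by auto
  then show "boundary_of (\<lambda>z. (if norm z < 1 then c else 0) $ i) (\<lambda>\<zeta>. c $ i)"
    using boundary_of_const by simp
qed

text \<open>A bound for the operator norm on the circle holds in the disc: apply the maximum principle to
  the scalar functions \<open>\<langle>F u, v\<rangle>\<close> with \<open>v\<close> the value of \<open>F u\<close> at the given point.\<close>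

lemma mat_boundary_bound:
  assumes F: "mat_boundary F G" and b: "AE \<zeta> in \<mu>. \<forall>v. norm (G \<zeta> *v v) \<le> C * norm v"
  shows "norm (F z *v u) \<le> C * norm u"
proof (cases "norm z < 1")
  case False
  have "F z = 0" using F False by (auto simp: mat_boundary_def vec_eq_iff dest!: boundary_ofD(4))
  moreover have "0 \<le> C * norm u"
    using AE_circle_ex[OF b] norm_ge_zero order_trans by blast
  ultimately show ?thesis by simp
next
  case z: True
  define v where "v = F z *v u"
  have "vec_boundary (\<lambda>z. F z *v (if norm z < 1 then u else 0)) (\<lambda>\<zeta>. G \<zeta> *v u)"
    by (rule vec_boundary_mult[OF F vec_boundary_const b])
  then have "boundary_of (\<lambda>w. hinner (F w *v (if norm w < 1 then u else 0)) v) (\<lambda>\<zeta>. hinner (G \<zeta> *v u) v)"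
    unfolding hinner_def by (subst (1 2) mult.commute) (auto simp: vec_boundary_def intro!: boundary_of_sum boundary_of_cmult)
  from boundary_bound_imp_bound[OF this, of "C * norm u * norm v" z]
  have "norm (hinner (F z *v u) v) \<le> C * norm u * norm v"
  proof (simp add: z, elim meta_mp)
    show "AE \<zeta> in \<mu>. norm (hinner (G \<zeta> *v u) v) \<le> C * norm u * norm v"
      using b
    proof eventually_elim
      case (elim \<zeta>)
      have "norm (hinner (G \<zeta> *v u) v) \<le> norm (G \<zeta> *v u) * norm v" by (rule hinner_Cauchy_Schwarz)
      also have "\<dots> \<le> (C * norm u) * norm v" using elim by (intro mult_right_mono) auto
      finally show ?case .
    qed
  qed
  then have "norm v * norm v \<le> C * norm u * norm v"
    by (simp add: v_def[symmetric] hinner_self norm_power power2_eq_square norm_mult)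
  moreover have "0 \<le> C * norm u"
    using AE_circle_ex[OF b] norm_ge_zero order_trans by blast
  ultimately show ?thesis unfolding v_def[symmetric] by (cases "v = 0") auto
qed

lemma vec_bound_imp_boundary_bound:
  assumes f: "vec_boundary f g" and b: "\<And>z. norm z < 1 \<Longrightarrow> norm (f z) \<le> C"
  obtains B where "AE \<zeta> in \<mu>. norm (g \<zeta>) \<le> B"
proof -
  have "AE \<zeta> in \<mu>. norm (g \<zeta> $ i) \<le> C" for i
  proof (rule bound_imp_boundary_bound)
    show "boundary_of (\<lambda>z. f z $ i) (\<lambda>\<zeta>. g \<zeta> $ i)" using f by (simp add: vec_boundary_def)
    show "norm (f z $ i) \<le> C" if "norm z < 1" for z
      using b[OF that] Finite_Cartesian_Product.norm_nth_le order_trans by blast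
  qed
  then have "AE \<zeta> in \<mu>. \<forall>i\<in>UNIV. norm (g \<zeta> $ i) \<le> C"
    by (intro AE_finite_allI) auto
  then have "AE \<zeta> in \<mu>. norm (g \<zeta>) \<le> (\<Sum>i\<in>(UNIV::'a set). C)"
    by eventually_elim (auto simp: norm_vec_def intro!: order_trans[OF L2_set_le_sum] sum_mono simp del: sum_constant)
  then show ?thesis using that by blast
qed

section \<open>Resolvents of contractive Hardy functions\<close>

text \<open>Bounded almost everywhere limits of boundary functions: the Fourier coefficients converge by
  dominated convergence, and the power series converge termwise.\<close>

lemma boundary_of_limit:
  assumes f: "\<And>n. boundary_of (f n) (g n)"
    and bd: "\<And>n. AE \<zeta> in \<mu>. norm (g n \<zeta>) \<le> C"
    and lim: "AE \<zeta> in \<mu>. (\<lambda>n. g n \<zeta>) \<longlonglongrightarrow> h \<zeta>" and h [measurable]: "h \<in> borel_measurable borel"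
    and flim: "\<And>z. (\<lambda>n. f n z) \<longlonglongrightarrow> F z"
  shows "boundary_of F h"
proof -
  note D = boundary_ofD[OF f]
  have [measurable]: "g n \<in> borel_measurable borel" for n by (rule D)
  have "AE \<zeta> in \<mu>. \<forall>n. norm (g n \<zeta>) \<le> C" using bd by (simp add: AE_all_countable)
  with lim have hb: "AE \<zeta> in \<mu>. norm (h \<zeta>) \<le> C"
  proof eventually_elim
    case (elim \<zeta>)
    show ?case using LIMSEQ_le_const2[OF tendsto_norm[OF elim(1)]] elim(2) by blast
  qed
  have hL: "h \<in> L2_circle" by (rule L2_bounded[OF h hb])
  have c: "(\<lambda>n. coef (g n) k) \<longlonglongrightarrow> coef h k" for k
    unfolding fourier_coeff_def
  proof (rule integral_dominated_convergence[where w="\<lambda>_. C"])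
    show "AE \<zeta> in \<mu>. (\<lambda>n. g n \<zeta> * \<zeta> powi - k) \<longlonglongrightarrow> h \<zeta> * \<zeta> powi - k"
      using lim by eventually_elim (intro tendsto_intros)
    show "AE \<zeta> in \<mu>. norm (g n \<zeta> * \<zeta> powi - k) \<le> C" for n
      using bd[of n] AE_circle_norm_1 by eventually_elim (simp add: norm_mult norm_power_int)
  qed simp_all
  have cb: "norm (coef (g n) k) \<le> C" for n k
  proof -
    have "norm (coef (g n) k) \<le> (LINT \<zeta>|\<mu>. norm (g n \<zeta>))"
      by (rule fourier_norm_le[OF D(6)])
    also have "\<dots> \<le> (LINT \<zeta>|\<mu>. C)"
      by (rule integral_mono_AE) (use bd D(6) in auto)
    finally show ?thesis by simp
  qed
  show ?thesis
  proof (rule boundary_ofI[OF hL])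
    show "coef h n = 0" if "n < 0" for n
      using c[of n] D(2)[OF that] by (simp add: LIMSEQ_const_iff)
    show "F z = 0" if "\<not> norm z < 1" for z
      using flim[of z] D(4)[OF that] by (simp add: LIMSEQ_const_iff)
    fix z :: complex assume z: "norm z < 1"
    have "(\<lambda>n. \<Sum>k. coef (g n) (int k) * z ^ k) \<longlonglongrightarrow> (\<Sum>k. coef h (int k) * z ^ k)"
    proof (rule tannerys_theorem[THEN conjunct2, THEN conjunct2])
      show "(\<lambda>n. coef (g n) (int k) * z ^ k) \<longlonglongrightarrow> coef h (int k) * z ^ k" for k
        by (intro tendsto_intros c)
      show "\<forall>\<^sub>F (k, n) in at_top \<times>\<^sub>F sequentially. norm (coef (g n) (int k) * z ^ k) \<le> C * norm z ^ k"
        by (intro always_eventually) (auto simp: norm_mult norm_power intro!: mult_right_mono cb)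
      show "summable (\<lambda>k. C * norm z ^ k)" using z by (intro summable_mult summable_geometric) simp
    qed simp
    moreover have "(\<Sum>k. coef (g n) (int k) * z ^ k) = f n z" for n
      using D(3)[OF z] by (simp add: sums_iff)
    ultimately have "F z = (\<Sum>k. coef h (int k) * z ^ k)"
      using LIMSEQ_unique[OF flim] by simp
    then show "(\<lambda>k. coef h (int k) * z ^ k) sums F z"
      using summable_norm_cancel[OF fourier_summable[OF L2_integrable[OF hL] z]] by (simp add: summable_sums)
  qed
qed

text \<open>Partial sums of the Neumann series of \<open>(I - X)\<^sup>-\<^sup>1\<close>.\<close>

primrec neumann :: "complex^'d^'d \<Rightarrow> nat \<Rightarrow> complex^'d \<Rightarrow> complex^'d" where
  "neumann X 0 u = 0"
| "neumann X (Suc n) u = u + X *v neumann X n u"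

lemma neumann_converges:
  assumes q: "0 \<le> q" "q < 1" and X: "\<And>v. norm (X *v v) \<le> q * norm v"
  shows "(\<lambda>n. neumann X n u) \<longlonglongrightarrow> matrix_inv (mat 1 - X) *v u"
    and "norm (neumann X n u) \<le> norm u / (1 - q)"
proof -
  define y where "y = matrix_inv (mat 1 - X) *v u"
  have "(mat 1 - X) *v y = u" unfolding y_def matrix_vector_mul_assoc resolvent(2)[OF q(2) X] by simp
  then have y: "y = u + X *v y" by (simp add: matrix_vector_mult_diff_rdistrib algebra_simps)
  have b: "norm (y - neumann X n u) \<le> q ^ n * norm y" for n
  proof (induction n)
    case (Suc n)
    have "y - neumann X (Suc n) u = X *v (y - neumann X n u)"
      by (subst y) (simp add: matrix_vector_mult_diff_distrib)
    also have "norm \<dots> \<le> q * norm (y - neumann X n u)" by (rule X)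
    also have "\<dots> \<le> q * (q ^ n * norm y)" using q Suc by (intro mult_left_mono)
    finally show ?case by simp
  qed simp
  have "(\<lambda>n. q ^ n * norm y) \<longlonglongrightarrow> 0"
    using q by (intro tendsto_mult_left_zero LIMSEQ_power_zero) simp
  then have "(\<lambda>n. y - neumann X n u) \<longlonglongrightarrow> 0"
    using Lim_null_comparison[of "\<lambda>n. y - neumann X n u" "\<lambda>n. q ^ n * norm y" sequentially] b by simp
  from tendsto_diff[OF tendsto_const[of y] this]
  show "(\<lambda>n. neumann X n u) \<longlonglongrightarrow> matrix_inv (mat 1 - X) *v u" by (simp add: y_def)
  show "norm (neumann X n u) \<le> norm u / (1 - q)"
  proof (induction n)
    case (Suc n)
    have "norm (neumann X (Suc n) u) \<le> norm u + q * norm (neumann X n u)"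
      using X[of "neumann X n u"] norm_triangle_ineq[of u "X *v neumann X n u"] by simp
    also have "\<dots> \<le> norm u + q * (norm u / (1 - q))" using q Suc by (intro add_left_mono mult_left_mono)
    also have "\<dots> = norm u / (1 - q)" using q by (simp add: field_simps)
    finally show ?case .
  qed (use q in simp)
qed

text \<open>The resolvent of a strictly contractive \<open>X\<close> is again a Hardy function, as the limit of the
  Neumann series applied to the unit vectors. On the circle it is only identified almost everywhere,
  which leaves room for a measurable choice \<open>Gb\<close>.\<close>

lemma resolvent_boundary:
  fixes X Xb :: "complex \<Rightarrow> complex^'d^'d"
  assumes q: "0 \<le> q" "q < 1" and X: "mat_boundary X Xb"
    and b: "AE \<zeta> in \<mu>. \<forall>v. norm (Xb \<zeta> *v v) \<le> q * norm v"
  obtains Gb where "mat_boundary (\<lambda>z. if norm z < 1 then matrix_inv (mat 1 - X z) else 0) Gb"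
    "AE \<zeta> in \<mu>. Gb \<zeta> = matrix_inv (mat 1 - Xb \<zeta>)"
proof -
  have Xi: "norm (X z *v v) \<le> q * norm v" for z v by (rule mat_boundary_bound[OF X b])
  define s where "s = (\<lambda>n j z. neumann (X z) n (if norm z < 1 then axis j 1 else 0))"
  define t where "t = (\<lambda>n j \<zeta>. neumann (Xb \<zeta>) n (axis j 1))"
  have st: "vec_boundary (s n j) (t n j)" for n j
  proof (induction n)
    case 0
    show ?case by (simp add: s_def t_def vec_boundary_def boundary_of_zero)
  next
    case (Suc n)
    show ?case
      using vec_boundary_add[OF vec_boundary_const[of "axis j 1"] vec_boundary_mult[OF X Suc b]]
      by (simp add: s_def t_def)
  qed
  define Gb where "Gb = (\<lambda>\<zeta>. \<chi> i j. lim (\<lambda>n. t n j \<zeta> $ i))"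
  have tm: "(\<lambda>\<zeta>. t n j \<zeta> $ i) \<in> borel_measurable borel" for n i j
    using vec_boundaryD(2)[OF st] by (simp add: borel_measurable_vec_iff)
  have lim: "AE \<zeta> in \<mu>. \<forall>j. (\<lambda>n. t n j \<zeta>) \<longlonglongrightarrow> matrix_inv (mat 1 - Xb \<zeta>) *v axis j 1"
    using b
  proof eventually_elim
    case (elim \<zeta>)
    then have "norm (Xb \<zeta> *v v) \<le> q * norm v" for v by blast
    from neumann_converges(1)[OF q this] show ?case by (simp add: t_def)
  qed
  have lim': "AE \<zeta> in \<mu>. \<forall>i j. (\<lambda>n. t n j \<zeta> $ i) \<longlonglongrightarrow> matrix_inv (mat 1 - Xb \<zeta>) $ i $ j"
    using lim
  proof eventually_elim
    case (elim \<zeta>)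
    show ?case using tendsto_vec_nth[OF elim[rule_format]] by (simp add: matrix_axis_nth)
  qed
  then have eq: "AE \<zeta> in \<mu>. Gb \<zeta> = matrix_inv (mat 1 - Xb \<zeta>)"
    by eventually_elim (simp add: Gb_def vec_eq_iff limI)
  have "mat_boundary (\<lambda>z. if norm z < 1 then matrix_inv (mat 1 - X z) else 0) Gb"
    unfolding mat_boundary_def
  proof (intro allI)
    fix i j
    show "boundary_of (\<lambda>z. (if norm z < 1 then matrix_inv (mat 1 - X z) else 0) $ i $ j) (\<lambda>\<zeta>. Gb \<zeta> $ i $ j)"
    proof (rule boundary_of_limit)
      show "boundary_of (\<lambda>z. s n j z $ i) (\<lambda>\<zeta>. t n j \<zeta> $ i)" for n
        using st[of n j] by (simp add: vec_boundary_def)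
      show "AE \<zeta> in \<mu>. norm (t n j \<zeta> $ i) \<le> 1 / (1 - q)" for n
        using b
      proof eventually_elim
        case (elim \<zeta>)
        have "norm (t n j \<zeta> $ i) \<le> norm (t n j \<zeta>)" by (rule Finite_Cartesian_Product.norm_nth_le)
        also have "\<dots> \<le> norm (axis j 1 :: complex^'d) / (1 - q)"
          unfolding t_def by (rule neumann_converges(2)[OF q]) (use elim in blast)
        finally show ?case by simp
      qed
      show "AE \<zeta> in \<mu>. (\<lambda>n. t n j \<zeta> $ i) \<longlonglongrightarrow> Gb \<zeta> $ i $ j"
        using lim' eq by eventually_elim simp
      show "(\<lambda>\<zeta>. Gb \<zeta> $ i $ j) \<in> borel_measurable borel"
        using tm by (simp add: Gb_def)
      fix z
      show "(\<lambda>n. s n j z $ i) \<longlonglongrightarrow> (if norm z < 1 then matrix_inv (mat 1 - X z) else 0) $ i $ j"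
      proof (cases "norm z < 1")
        case True
        have "(\<lambda>n. s n j z) \<longlonglongrightarrow> matrix_inv (mat 1 - X z) *v axis j 1"
          using neumann_converges(1)[OF q Xi] True by (simp add: s_def)
        from tendsto_vec_nth[OF this, of i] show ?thesis using True by (simp add: matrix_axis_nth)
      next
        case False
        then have "s n j z = 0" for n using vec_boundaryD(3)[OF st] by blast
        then show ?thesis using False by simp
      qed
    qed
  qed
  with eq show ?thesis using that by blast
qed

section \<open>The inner product and the Riesz projection for vector functions\<close>

lemma hinner_integrable:
  assumes "g \<in> L2_circle" "h \<in> L2_circle"
  shows "integrable \<mu> (\<lambda>\<zeta>. hinner (g \<zeta>) (h \<zeta>))"
  unfolding hinner_def using assms
  by (auto simp: L2_vec_iff intro!: Bochner_Integration.integrable_sum L2_mult_integrable L2_cnj)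

lemma L2_inner_diff_left:
  assumes "g \<in> L2_circle" "g' \<in> L2_circle" "h \<in> L2_circle"
  shows "L2_inner (\<lambda>\<zeta>. g \<zeta> - g' \<zeta>) h = L2_inner g h - L2_inner g' h"
  using assms by (simp add: L2_inner_def hinner_diff_left hinner_integrable)

lemma L2_inner_diff_right:
  assumes "g \<in> L2_circle" "h \<in> L2_circle" "h' \<in> L2_circle"
  shows "L2_inner g (\<lambda>\<zeta>. h \<zeta> - h' \<zeta>) = L2_inner g h - L2_inner g h'"
  using assms by (simp add: L2_inner_def hinner_diff_right hinner_integrable)

lemma L2_inner_add_left:
  assumes "g \<in> L2_circle" "g' \<in> L2_circle" "h \<in> L2_circle"
  shows "L2_inner (\<lambda>\<zeta>. g \<zeta> + g' \<zeta>) h = L2_inner g h + L2_inner g' h"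
  using assms by (simp add: L2_inner_def hinner_add_left hinner_integrable)

lemma L2_inner_scale_left: "L2_inner (\<lambda>\<zeta>. c *s g \<zeta>) h = c * L2_inner g h"
  by (simp add: L2_inner_def hinner_scale_left)

lemma L2_inner_cnj: "cnj (L2_inner g h) = L2_inner h g"
  unfolding L2_inner_def Bochner_Integration.integral_cnj[symmetric] hinner_cnj ..

lemma L2_inner_cong:
  assumes "g \<in> L2_circle" "h \<in> L2_circle" "g' \<in> L2_circle" "h' \<in> L2_circle"
    and "AE \<zeta> in \<mu>. hinner (g \<zeta>) (h \<zeta>) = hinner (g' \<zeta>) (h' \<zeta>)"
  shows "L2_inner g h = L2_inner g' h'"
  unfolding L2_inner_def
  by (rule integral_cong_AE) (use assms hinner_integrable borel_measurable_integrable in blast)+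

lemma L2_inner_self: "L2_inner g g = of_real (sq_norm g)"
  by (simp add: L2_inner_def hinner_self del: of_real_power)

lemma L2_inner_self_zero:
  assumes "g \<in> L2_circle" "L2_inner g g = 0"
  shows "AE \<zeta> in \<mu>. g \<zeta> = 0"
proof -
  have "sq_norm g = 0" using assms(2) by (simp add: L2_inner_self)
  then have "AE \<zeta> in \<mu>. (norm (g \<zeta>))\<^sup>2 = 0"
    using assms(1) by (subst (asm) integral_nonneg_eq_0_iff_AE) (auto simp: L2_circle_iff)
  then show ?thesis by simp
qed

lemma H2_inner_eq:
  assumes f: "vec_boundary f g" and h: "vec_boundary h k"
  shows "H2_inner f h = L2_inner g k"
proof -
  note f' = vec_boundary_bdry[OF vec_boundaryD(4)[OF f]] and h' = vec_boundary_bdry[OF vec_boundaryD(4)[OF h]]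
  show ?thesis unfolding H2_inner_def
  proof (rule L2_inner_cong)
    show "AE \<zeta> in \<mu>. hinner (bdry_vec f \<zeta>) (bdry_vec h \<zeta>) = hinner (g \<zeta>) (k \<zeta>)"
      using vec_boundary_unique[OF f' f] vec_boundary_unique[OF h' h] by eventually_elim simp
  qed (use f h f' h' vec_boundaryD(1) in blast)+
qed

lemma H2_norm_eq: "H2_norm f = sqrt (Re (H2_inner f f))"
  by (simp add: H2_norm_def H2_inner_def L2_inner_self)

lemma Riesz_projection_orthogonal:
  assumes g: "g \<in> L2_circle" and p: "p \<in> L2_circle"
    and pc: "\<And>n. coef p n = (if n \<ge> 0 then coef g n else 0)"
    and k: "k \<in> L2_circle" "\<And>n. n < 0 \<Longrightarrow> coef k n = 0"
  shows "(LINT \<zeta>|\<mu>. (g \<zeta> - p \<zeta>) * cnj (k \<zeta>)) = 0"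
proof -
  let ?S = "\<lambda>N. trig_poly (\<lambda>j. coef k (int j)) {..<N}"
  have gp: "(\<lambda>\<zeta>. g \<zeta> - p \<zeta>) \<in> L2_circle" by (rule L2_diff[OF g p])
  have "(\<lambda>N. LINT \<zeta>|\<mu>. (norm (cnj (?S N \<zeta>) - cnj (k \<zeta>)))\<^sup>2) \<longlonglongrightarrow> 0"
    using analytic_L2_approx[OF k] by (simp flip: complex_cnj_diff)
  then have "(\<lambda>N. LINT \<zeta>|\<mu>. cnj (?S N \<zeta>) * (g \<zeta> - p \<zeta>)) \<longlonglongrightarrow> (LINT \<zeta>|\<mu>. cnj (k \<zeta>) * (g \<zeta> - p \<zeta>))"
    by (rule L2_tendsto_integral[OF L2_cnj[OF L2_trig_poly] L2_cnj[OF k(1)] gp])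
  moreover have "(LINT \<zeta>|\<mu>. cnj (?S N \<zeta>) * (g \<zeta> - p \<zeta>)) = 0" for N
    using trig_poly_inner[OF gp, of "\<lambda>j. coef k (int j)" "{..<N}"]
    by (simp add: mult.commute fourier_diff L2_integrable g p pc)
  ultimately show ?thesis by (simp add: LIMSEQ_const_iff mult.commute)
qed

lemma vec_Riesz_projection:
  fixes g :: "complex \<Rightarrow> complex^'d"
  assumes g: "g \<in> L2_circle"
  obtains f p :: "complex \<Rightarrow> complex^'d"
  where "vec_boundary f p" "\<And>h k. vec_boundary h k \<Longrightarrow> L2_inner g k = L2_inner p k"
proof -
  have gi: "(\<lambda>\<zeta>. g \<zeta> $ i) \<in> L2_circle" for i using g by (simp add: L2_vec_iff)
  have "\<exists>p. p \<in> L2_circle \<and> (\<forall>n. coef p n = (if n \<ge> 0 then coef (\<lambda>\<zeta>. g \<zeta> $ i) n else 0))" for i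
    using Riesz_projection_exists[OF gi[of i]] by metis
  then obtain P where P: "\<And>i. P i \<in> L2_circle"
    "\<And>i n. coef (P i) n = (if n \<ge> 0 then coef (\<lambda>\<zeta>. g \<zeta> $ i) n else 0)" by metis
  define p where "p = (\<lambda>\<zeta>. \<chi> i. P i \<zeta>)"
  define f where "f = (\<lambda>z. \<chi> i. if norm z < 1 then \<Sum>n. coef (P i) (int n) * z ^ n else 0)"
  have fp: "vec_boundary f p"
    unfolding vec_boundary_def
  proof
    fix i
    show "boundary_of (\<lambda>z. f z $ i) (\<lambda>\<zeta>. p \<zeta> $ i)"
    proof (rule boundary_ofI)
      fix z :: complex assume z: "norm z < 1"
      show "(\<lambda>n. coef (\<lambda>\<zeta>. p \<zeta> $ i) (int n) * z ^ n) sums f z $ i"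
        using summable_sums[OF summable_norm_cancel[OF fourier_summable[OF L2_integrable[OF P(1)] z]]] z
        by (simp add: p_def f_def)
    qed (auto simp: p_def f_def P)
  qed
  show ?thesis
  proof (rule that[OF fp])
    fix h k :: "complex \<Rightarrow> complex^'d" assume hk: "vec_boundary h k"
    have pL: "p \<in> L2_circle" and kL: "k \<in> L2_circle" using fp hk vec_boundaryD(1) by auto
    have b: "boundary_of (\<lambda>z. h z $ i) (\<lambda>\<zeta>. k \<zeta> $ i)" for i using hk by (simp add: vec_boundary_def)
    have kl: "(\<lambda>\<zeta>. k \<zeta> $ i) \<in> L2_circle" for i using kL by (simp add: L2_vec_iff)
    have "L2_inner g k - L2_inner p k = L2_inner (\<lambda>\<zeta>. g \<zeta> - p \<zeta>) k"
      by (rule L2_inner_diff_left[OF g pL kL, symmetric])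
    also have "\<dots> = (\<Sum>i\<in>UNIV. LINT \<zeta>|\<mu>. (g \<zeta> $ i - P i \<zeta>) * cnj (k \<zeta> $ i))"
      unfolding L2_inner_def hinner_def
      by (subst Bochner_Integration.integral_sum)
        (auto simp: p_def intro!: L2_mult_integrable L2_diff gi P L2_cnj kl)
    also have "\<dots> = 0"
      by (intro sum.neutral ballI Riesz_projection_orthogonal[OF gi P(1) P(2) boundary_ofD(1,2)[OF b]])
    finally show "L2_inner g k = L2_inner p k" by simp
  qed
qed

section \<open>Model spaces\<close>

text \<open>\<open>multiplier F G\<close>: multiplication by \<open>F\<close> preserves \<open>H\<^sup>2\<close>, and on the circle it is
  multiplication by \<open>G\<close>.\<close>

definition multiplier :: "(complex \<Rightarrow> complex^'d^'d) \<Rightarrow> (complex \<Rightarrow> complex^'d^'d) \<Rightarrow> bool" where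
  "multiplier F G \<longleftrightarrow>
     (\<forall>h k. vec_boundary h k \<longrightarrow> vec_boundary (\<lambda>z. F z *v h z) (\<lambda>\<zeta>. G \<zeta> *v k \<zeta>))"

lemma multiplierD:
  "multiplier F G \<Longrightarrow> vec_boundary h k \<Longrightarrow> vec_boundary (\<lambda>z. F z *v h z) (\<lambda>\<zeta>. G \<zeta> *v k \<zeta>)"
  by (simp add: multiplier_def)

text \<open>If \<open>\<Theta>\<close> multiplies \<open>H\<^sup>2\<close> into itself, then membership in the model space can be tested on
  arbitrary boundary functions.\<close>

lemma model_space_iff:
  assumes m: "multiplier \<Theta> T" and f: "vec_boundary f g"
  shows "f \<in> model_space \<Theta> \<longleftrightarrow> (\<forall>h k. vec_boundary h k \<longrightarrow> L2_inner g (\<lambda>\<zeta>. T \<zeta> *v k \<zeta>) = 0)"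
proof -
  have "H2_inner f (\<lambda>z. \<Theta> z *v h z) = L2_inner g (\<lambda>\<zeta>. T \<zeta> *v k \<zeta>)" if "vec_boundary h k" for h k
    by (rule H2_inner_eq[OF f multiplierD[OF m that]])
  then have "(\<forall>h\<in>H2_vec. H2_inner f (\<lambda>z. \<Theta> z *v h z) = 0)
      \<longleftrightarrow> (\<forall>h k. vec_boundary h k \<longrightarrow> L2_inner g (\<lambda>\<zeta>. T \<zeta> *v k \<zeta>) = 0)"
    using vec_boundary_bdry vec_boundaryD(4) by metis
  then show ?thesis using vec_boundaryD(4)[OF f] by (simp add: model_space_def)
qed

lemma model_space_boundary: "f \<in> model_space \<Theta> \<Longrightarrow> vec_boundary f (bdry_vec f)"
  by (simp add: model_space_def vec_boundary_bdry)

lemma model_space_add: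
  assumes m: "multiplier \<Theta> T" and f: "f \<in> model_space \<Theta>" and h: "h \<in> model_space \<Theta>"
  shows "(\<lambda>z. f z + h z) \<in> model_space \<Theta>"
proof -
  note bf = model_space_boundary[OF f] and bh = model_space_boundary[OF h]
  show ?thesis
    unfolding model_space_iff[OF m vec_boundary_add[OF bf bh]]
    using f h model_space_iff[OF m bf] model_space_iff[OF m bh]
    by (auto simp: L2_inner_add_left vec_boundaryD(1)[OF bf] vec_boundaryD(1)[OF bh]
        vec_boundaryD(1)[OF multiplierD[OF m]])
qed

lemma model_space_scale:
  assumes m: "multiplier \<Theta> T" and f: "f \<in> model_space \<Theta>"
  shows "(\<lambda>z. c *s f z) \<in> model_space \<Theta>"
proof -
  note bf = model_space_boundary[OF f]
  show ?thesis
    unfolding model_space_iff[OF m vec_boundary_scale[OF bf]]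
    using f model_space_iff[OF m bf] by (simp add: L2_inner_scale_left)
qed

lemma model_space_diff:
  assumes m: "multiplier \<Theta> T" and f: "f \<in> model_space \<Theta>" and h: "h \<in> model_space \<Theta>"
  shows "(\<lambda>z. f z - h z) \<in> model_space \<Theta>"
  using model_space_add[OF m f model_space_scale[OF m h, of "-1"]] by simp

lemma model_space_eqI:
  assumes m: "multiplier \<Theta> T" and f: "f \<in> model_space \<Theta>" and h: "h \<in> model_space \<Theta>"
    and eq: "\<And>k. k \<in> model_space \<Theta> \<Longrightarrow> L2_inner (bdry_vec f) (bdry_vec k) = L2_inner (bdry_vec h) (bdry_vec k)"
  shows "f = h"
proof -
  note bf = model_space_boundary[OF f] and bh = model_space_boundary[OF h]
  let ?d = "\<lambda>z. f z - h z"
  have d: "?d \<in> model_space \<Theta>" by (rule model_space_diff[OF m f h])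
  note bd = model_space_boundary[OF d] and bd' = vec_boundary_diff[OF bf bh]
  have "L2_inner (bdry_vec ?d) (bdry_vec ?d) = H2_inner ?d ?d" by (simp add: H2_inner_def)
  also have "\<dots> = L2_inner (\<lambda>\<zeta>. bdry_vec f \<zeta> - bdry_vec h \<zeta>) (bdry_vec ?d)" by (rule H2_inner_eq[OF bd' bd])
  also have "\<dots> = 0"
    by (simp add: L2_inner_diff_left vec_boundaryD(1)[OF bf] vec_boundaryD(1)[OF bh] vec_boundaryD(1)[OF bd] eq[OF d])
  finally have "AE \<zeta> in \<mu>. bdry_vec ?d \<zeta> = 0"
    by (rule L2_inner_self_zero[OF vec_boundaryD(1)[OF bd]])
  from vec_boundary_zero_imp_zero[OF bd this] show ?thesis by auto
qed

text \<open>The defining property determines the projection as soon as some element satisfies it.\<close>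

lemma model_proj_eqI:
  assumes m: "multiplier \<Theta> T" and g: "g \<in> L2_circle" and h: "h \<in> model_space \<Theta>"
    and orth: "\<And>k. k \<in> model_space \<Theta> \<Longrightarrow> L2_inner g (bdry_vec k) = L2_inner (bdry_vec h) (bdry_vec k)"
  shows "model_proj \<Theta> g = h"
proof -
  have eq: "(L2_inner (\<lambda>\<zeta>. g \<zeta> - bdry_vec h' \<zeta>) (bdry_vec k) = 0) \<longleftrightarrow>
      L2_inner g (bdry_vec k) = L2_inner (bdry_vec h') (bdry_vec k)"
    if "h' \<in> model_space \<Theta>" "k \<in> model_space \<Theta>" for h' k
    using that[THEN model_space_boundary, THEN vec_boundaryD(1)] by (simp add: L2_inner_diff_left g)
  show ?thesis unfolding model_proj_def
  proof (rule the_equality)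
    show "h \<in> model_space \<Theta> \<and> (\<forall>k\<in>model_space \<Theta>. L2_inner (\<lambda>\<zeta>. g \<zeta> - bdry_vec h \<zeta>) (bdry_vec k) = 0)"
      using h eq[OF h] orth by blast
    fix h' assume h': "h' \<in> model_space \<Theta> \<and> (\<forall>k\<in>model_space \<Theta>. L2_inner (\<lambda>\<zeta>. g \<zeta> - bdry_vec h' \<zeta>) (bdry_vec k) = 0)"
    show "h' = h"
    proof (rule model_space_eqI[OF m _ h])
      show "h' \<in> model_space \<Theta>" using h' by blast
      show "L2_inner (bdry_vec h') (bdry_vec k) = L2_inner (bdry_vec h) (bdry_vec k)" if k: "k \<in> model_space \<Theta>" for k
        using h' eq[of h' k] orth[OF k] k by auto
    qed
  qed
qed

text \<open>On \<open>L\<^sup>2\<close> the projection is \<open>P\<^sub>+ - \<Theta> P\<^sub>+ \<Theta>\<^sup>*\<close>, where \<open>P\<^sub>+\<close> is the Riesz projection.\<close>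

lemma model_proj_inner:
  fixes \<Theta> :: "complex \<Rightarrow> complex^'d^'d"
  assumes m: "multiplier \<Theta> T" and T [measurable]: "T \<in> borel_measurable borel"
    and U: "AE \<zeta> in \<mu>. unitary (T \<zeta>)" and g: "g \<in> L2_circle"
  shows "model_proj \<Theta> g \<in> model_space \<Theta>"
    and "\<And>k. k \<in> model_space \<Theta> \<Longrightarrow> L2_inner g (bdry_vec k) = L2_inner (bdry_vec (model_proj \<Theta> g)) (bdry_vec k)"
proof -
  have [measurable]: "g \<in> borel_measurable borel" by (rule L2_measurable[OF g])
  have tg: "(\<lambda>\<zeta>. adj (T \<zeta>) *v g \<zeta>) \<in> L2_circle"
  proof (rule L2_dominated[OF g, where C=1])
    show "AE \<zeta> in \<mu>. norm (adj (T \<zeta>) *v g \<zeta>) \<le> 1 * norm (g \<zeta>)"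
      using U by eventually_elim (rule adj_bound, simp add: unitary_norm)
  qed measurable
  obtain f p where fp: "vec_boundary f p" and p: "\<And>h k. vec_boundary h k \<Longrightarrow> L2_inner g k = L2_inner p k"
    using vec_Riesz_projection[OF g] by blast
  obtain f' q where fq: "vec_boundary f' q"
    and q: "\<And>h k. vec_boundary h k \<Longrightarrow> L2_inner (\<lambda>\<zeta>. adj (T \<zeta>) *v g \<zeta>) k = L2_inner q k"
    using vec_Riesz_projection[OF tg] by blast
  note Tq = multiplierD[OF m fq]
  let ?h = "\<lambda>z. f z - \<Theta> z *v f' z"
  note bh = vec_boundary_diff[OF fp Tq]
  have hK: "?h \<in> model_space \<Theta>"
    unfolding model_space_iff[OF m bh]
  proof (intro allI impI)
    fix h k :: "complex \<Rightarrow> complex^'d" assume hk: "vec_boundary h k"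
    note Tk = multiplierD[OF m hk]
    have "L2_inner (\<lambda>\<zeta>. p \<zeta> - T \<zeta> *v q \<zeta>) (\<lambda>\<zeta>. T \<zeta> *v k \<zeta>)
      = L2_inner p (\<lambda>\<zeta>. T \<zeta> *v k \<zeta>) - L2_inner (\<lambda>\<zeta>. T \<zeta> *v q \<zeta>) (\<lambda>\<zeta>. T \<zeta> *v k \<zeta>)"
      by (rule L2_inner_diff_left) (use fp Tq Tk vec_boundaryD(1) in blast)+
    also have "L2_inner p (\<lambda>\<zeta>. T \<zeta> *v k \<zeta>) = L2_inner g (\<lambda>\<zeta>. T \<zeta> *v k \<zeta>)" using p[OF Tk] by simp
    also have "\<dots> = L2_inner (\<lambda>\<zeta>. adj (T \<zeta>) *v g \<zeta>) k"
      by (rule L2_inner_cong)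
        (use g tg vec_boundaryD(1)[OF Tk] vec_boundaryD(1)[OF hk] in \<open>auto simp: hinner_adj\<close>)
    also have "\<dots> = L2_inner q k" by (rule q[OF hk])
    also have "L2_inner (\<lambda>\<zeta>. T \<zeta> *v q \<zeta>) (\<lambda>\<zeta>. T \<zeta> *v k \<zeta>) = L2_inner q k"
    proof (rule L2_inner_cong)
      show "AE \<zeta> in \<mu>. hinner (T \<zeta> *v q \<zeta>) (T \<zeta> *v k \<zeta>) = hinner (q \<zeta>) (k \<zeta>)"
        using U by eventually_elim (simp add: hinner_adj matrix_vector_mul_assoc unitary_def)
    qed (use Tq Tk fq hk vec_boundaryD(1) in blast)+
    finally show "L2_inner (\<lambda>\<zeta>. p \<zeta> - T \<zeta> *v q \<zeta>) (\<lambda>\<zeta>. T \<zeta> *v k \<zeta>) = 0" by simp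
  qed
  have orth: "L2_inner g (bdry_vec k) = L2_inner (bdry_vec ?h) (bdry_vec k)" if k: "k \<in> model_space \<Theta>" for k
  proof -
    note bk = model_space_boundary[OF k]
    have "L2_inner (bdry_vec ?h) (bdry_vec k) = H2_inner ?h k" by (simp add: H2_inner_def)
    also have "\<dots> = L2_inner (\<lambda>\<zeta>. p \<zeta> - T \<zeta> *v q \<zeta>) (bdry_vec k)" by (rule H2_inner_eq[OF bh bk])
    also have "\<dots> = L2_inner p (bdry_vec k) - L2_inner (\<lambda>\<zeta>. T \<zeta> *v q \<zeta>) (bdry_vec k)"
      by (rule L2_inner_diff_left) (use fp Tq bk vec_boundaryD(1) in blast)+
    also have "L2_inner (\<lambda>\<zeta>. T \<zeta> *v q \<zeta>) (bdry_vec k) = cnj (L2_inner (bdry_vec k) (\<lambda>\<zeta>. T \<zeta> *v q \<zeta>))"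
      by (simp add: L2_inner_cnj)
    also have "L2_inner (bdry_vec k) (\<lambda>\<zeta>. T \<zeta> *v q \<zeta>) = 0"
      using k fq unfolding model_space_iff[OF m bk] by blast
    finally show ?thesis using p[OF bk] by simp
  qed
  have "model_proj \<Theta> g = ?h" by (rule model_proj_eqI[OF m g hK orth])
  then show "model_proj \<Theta> g \<in> model_space \<Theta>"
    "\<And>k. k \<in> model_space \<Theta> \<Longrightarrow> L2_inner g (bdry_vec k) = L2_inner (bdry_vec (model_proj \<Theta> g)) (bdry_vec k)"
    using hK orth by simp_all
qed

section \<open>The Crofoot transform\<close>

lemma mat_boundary_const_mult:
  assumes "mat_boundary F G"
  shows "mat_boundary (\<lambda>z. F z ** A) (\<lambda>\<zeta>. G \<zeta> ** A)"
  unfolding mat_boundary_def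
proof (intro allI)
  fix i j
  have "boundary_of (\<lambda>z. \<Sum>k\<in>UNIV. A $ k $ j * F z $ i $ k) (\<lambda>\<zeta>. \<Sum>k\<in>UNIV. A $ k $ j * G \<zeta> $ i $ k)"
    using assms by (intro boundary_of_sum boundary_of_cmult) (simp add: mat_boundary_def)
  then show "boundary_of (\<lambda>z. (F z ** A) $ i $ j) (\<lambda>\<zeta>. (G \<zeta> ** A) $ i $ j)"
    by (simp add: matrix_matrix_mult_def mult.commute)
qed

lemma norm_matrix_vector_le:
  fixes A :: "complex^'d^'d"
  shows "norm (A *v v) \<le> (real CARD('d) * real CARD('d)) * norm A * norm v"
proof -
  have "norm (A *v v) \<le> (\<Sum>i\<in>UNIV. norm ((A *v v) $ i))"
    unfolding norm_vec_def[of "A *v v"] by (rule L2_set_le_sum) simp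
  also have "\<dots> \<le> (\<Sum>i\<in>(UNIV::'d set). \<Sum>j\<in>(UNIV::'d set). norm A * norm v)"
  proof (intro sum_mono)
    fix i
    have "norm ((A *v v) $ i) \<le> (\<Sum>j\<in>UNIV. norm (A $ i $ j * v $ j))"
      unfolding matrix_vector_mult_def by (simp add: norm_sum)
    also have "\<dots> \<le> (\<Sum>j\<in>(UNIV::'d set). norm A * norm v)"
    proof (intro sum_mono)
      fix j
      have "norm (A $ i $ j) \<le> norm A"
        using Finite_Cartesian_Product.norm_nth_le[of "A $ i" j] Finite_Cartesian_Product.norm_nth_le[of A i] by linarith
      then show "norm (A $ i $ j * v $ j) \<le> norm A * norm v"
        unfolding norm_mult by (intro mult_mono Finite_Cartesian_Product.norm_nth_le) auto
    qed
    finally show "norm ((A *v v) $ i) \<le> (\<Sum>j\<in>(UNIV::'d set). norm A * norm v)" .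
  qed
  finally show ?thesis by (simp add: mult.assoc)
qed

lemma norm_matrix_le:
  fixes A :: "complex^'d^'d"
  assumes "\<And>v. norm (A *v v) \<le> B * norm v"
  shows "norm A \<le> (real CARD('d) * real CARD('d)) * B"
proof -
  have "norm A \<le> (\<Sum>i\<in>UNIV. norm (A $ i))"
    unfolding norm_vec_def[of A] by (rule L2_set_le_sum) simp
  also have "\<dots> \<le> (\<Sum>i\<in>(UNIV::'d set). \<Sum>j\<in>(UNIV::'d set). B)"
  proof (intro sum_mono)
    fix i
    have "norm (A $ i) \<le> (\<Sum>j\<in>UNIV. norm (A $ i $ j))"
      unfolding norm_vec_def[of "A $ i"] by (rule L2_set_le_sum) simp
    also have "\<dots> \<le> (\<Sum>j\<in>(UNIV::'d set). B)"
    proof (rule sum_mono)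
      fix j
      show "norm (A $ i $ j) \<le> B"
        using matrix_entry_le[of A i j] assms[of "axis j 1"] by simp
    qed
    finally show "norm (A $ i) \<le> (\<Sum>j\<in>(UNIV::'d set). B)" .
  qed
  finally show ?thesis by (simp add: mult.assoc)
qed

lemma L2_sandwich:
  fixes P Q \<Phi> :: "complex \<Rightarrow> complex^'d^'d"
  assumes \<Phi>: "\<Phi> \<in> L2_circle" and [measurable]: "P \<in> borel_measurable borel" "Q \<in> borel_measurable borel"
    and P: "AE \<zeta> in \<mu>. \<forall>v. norm (P \<zeta> *v v) \<le> p * norm v"
    and Q: "AE \<zeta> in \<mu>. \<forall>v. norm (Q \<zeta> *v v) \<le> q * norm v"
    and p: "0 \<le> p"
  shows "(\<lambda>\<zeta>. P \<zeta> ** \<Phi> \<zeta> ** Q \<zeta>) \<in> L2_circle"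
proof -
  define n where "n = real CARD('d) * real CARD('d)"
  have n: "0 \<le> n" by (simp add: n_def)
  have [measurable]: "\<Phi> \<in> borel_measurable borel" by (rule L2_measurable[OF \<Phi>])
  show ?thesis
  proof (rule L2_dominated[OF \<Phi>, where C="n * (p * n * q)"])
    show "AE \<zeta> in \<mu>. norm (P \<zeta> ** \<Phi> \<zeta> ** Q \<zeta>) \<le> n * (p * n * q) * norm (\<Phi> \<zeta>)"
      using P Q
    proof eventually_elim
      case (elim \<zeta>)
      have "norm ((P \<zeta> ** \<Phi> \<zeta> ** Q \<zeta>) *v v) \<le> (p * n * q * norm (\<Phi> \<zeta>)) * norm v" for v
      proof -
        have "norm ((P \<zeta> ** \<Phi> \<zeta> ** Q \<zeta>) *v v) \<le> p * norm (\<Phi> \<zeta> *v (Q \<zeta> *v v))"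
          using elim(1) by (simp add: matrix_vector_mul_assoc matrix_mul_assoc flip: matrix_vector_mul_assoc)
        also have "\<dots> \<le> p * (n * norm (\<Phi> \<zeta>) * norm (Q \<zeta> *v v))"
          using p unfolding n_def by (intro mult_left_mono norm_matrix_vector_le)
        also have "\<dots> \<le> p * (n * norm (\<Phi> \<zeta>) * (q * norm v))"
          using p n elim(2) by (intro mult_left_mono) auto
        finally show ?thesis by (simp add: mult_ac)
      qed
      from norm_matrix_le[OF this] show ?case by (simp add: n_def mult_ac)
    qed
  qed measurable
qed

lemma L2_mult_bounded:
  fixes \<Phi> :: "complex \<Rightarrow> complex^'d^'d" and f :: "complex \<Rightarrow> complex^'d"
  assumes \<Phi>: "\<Phi> \<in> L2_circle" and [measurable]: "f \<in> borel_measurable borel"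
    and b: "AE \<zeta> in \<mu>. norm (f \<zeta>) \<le> B"
  shows "(\<lambda>\<zeta>. \<Phi> \<zeta> *v f \<zeta>) \<in> L2_circle"
proof -
  define n where "n = real CARD('d) * real CARD('d)"
  have [measurable]: "\<Phi> \<in> borel_measurable borel" by (rule L2_measurable[OF \<Phi>])
  show ?thesis
  proof (rule L2_dominated[OF \<Phi>, where C="n * B"])
    show "AE \<zeta> in \<mu>. norm (\<Phi> \<zeta> *v f \<zeta>) \<le> n * B * norm (\<Phi> \<zeta>)"
      using b
    proof eventually_elim
      case (elim \<zeta>)
      have "norm (\<Phi> \<zeta> *v f \<zeta>) \<le> n * norm (\<Phi> \<zeta>) * norm (f \<zeta>)"
        unfolding n_def by (rule norm_matrix_vector_le)
      also have "\<dots> \<le> n * norm (\<Phi> \<zeta>) * B" using elim by (intro mult_left_mono) (auto simp: n_def)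
      finally show ?case by (simp add: mult_ac)
    qed
  qed measurable
qed

lemma L2_matrix_mult:
  fixes G :: "complex \<Rightarrow> complex^'d^'d" and f :: "complex \<Rightarrow> complex^'d"
  assumes f: "f \<in> L2_circle" and [measurable]: "G \<in> borel_measurable borel"
    and b: "AE \<zeta> in \<mu>. \<forall>v. norm (G \<zeta> *v v) \<le> C * norm v"
  shows "(\<lambda>\<zeta>. G \<zeta> *v f \<zeta>) \<in> L2_circle"
proof (rule L2_dominated[OF f, where C=C])
  have [measurable]: "f \<in> borel_measurable borel" by (rule L2_measurable[OF f])
  show "(\<lambda>\<zeta>. G \<zeta> *v f \<zeta>) \<in> borel_measurable borel" by measurable
qed (use b in \<open>eventually_elim, blast\<close>)

text \<open>The data of the Crofoot transform. In the locale below, \<open>D\<close> and \<open>D'\<close> are the defect operators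
  of \<open>W\<close> and \<open>W\<^sup>*\<close>, \<open>K\<close> and \<open>K'\<close> are the model spaces of \<open>\<Theta>\<close> and of its transform \<open>\<Theta>'\<close>, and \<open>T\<close> is
  the boundary function of \<open>\<Theta>\<close>.\<close>

locale crofoot_data =
  fixes W :: "complex^'d^'d" and \<Theta> :: "complex \<Rightarrow> complex^'d^'d"
  assumes W: "strict_contraction W" and inner: "inner_function \<Theta>"
begin

abbreviation "D \<equiv> defect_op W"
abbreviation "D' \<equiv> defect_op (adj W)"
abbreviation "\<Theta>' \<equiv> crofoot_inner W \<Theta>"
abbreviation "K \<equiv> model_space \<Theta>"
abbreviation "K' \<equiv> model_space \<Theta>'"
abbreviation "J \<equiv> crofoot W \<Theta>"
abbreviation "T \<equiv> bdry_mat \<Theta>"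

text \<open>The resolvent \<open>(I - \<Theta> W\<^sup>*)\<^sup>-\<^sup>1\<close> in the disc and a boundary function of it, so that \<open>J\<close> is
  multiplication by \<open>D' G\<close>.\<close>

definition G where "G z = (if norm z < 1 then matrix_inv (mat 1 - \<Theta> z ** adj W) else 0)"

definition Gb where
  "Gb = (SOME Gb. mat_boundary G Gb \<and> (AE \<zeta> in \<mu>. Gb \<zeta> = matrix_inv (mat 1 - T \<zeta> ** adj W)))"

lemma D'_sq: "D' *v (D' *v v) = v - W *v (adj W *v v)"
  using defect_op(2)[OF strict_contraction_adj[OF W]] by (simp add: matrix_vector_mul_assoc matrix_vector_mult_diff_rdistrib)

lemma D'_W: "D' *v (W *v v) = W *v (D *v v)"
  using defect_op_intertwine[OF W] by (simp add: matrix_vector_mul_assoc)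

lemma hinner_D': "hinner (D' *v u) v = hinner u (D' *v v)"
  by (simp add: hinner_adj defect_op(1)[OF strict_contraction_adj[OF W]])

lemma T_boundary: "mat_boundary \<Theta> T"
  using inner mat_boundary_bdry[of \<Theta>] by (simp add: inner_function_def)

lemma T_measurable [measurable]: "T \<in> borel_measurable borel"
  by (rule mat_boundary_measurable[OF T_boundary])

lemma T_unitary: "AE \<zeta> in \<mu>. unitary (T \<zeta>)"
  using inner by (simp add: inner_function_def)

lemma T_bound: "AE \<zeta> in \<mu>. \<forall>v. norm (T \<zeta> *v v) \<le> 1 * norm v"
  using T_unitary by eventually_elim (simp add: unitary_norm)

lemma Theta_bound: "norm (\<Theta> z *v v) \<le> norm v"
  using mat_boundary_bound[OF T_boundary T_bound] by simp

lemma Theta_multiplier: "multiplier \<Theta> T"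
  unfolding multiplier_def using vec_boundary_mult[OF T_boundary _ T_bound] by blast

abbreviation "q \<equiv> opnorm W"

lemma q: "0 \<le> q" "q < 1"
  using W by (simp_all add: opnorm_nonneg strict_contraction_def)

lemma W_adj_bound: "norm (adj W *v v) \<le> q * norm v"
  by (rule adj_bound[OF opnorm_bound])

lemma X_bound: "norm ((\<Theta> z ** adj W) *v v) \<le> q * norm v"
  using Theta_bound[of z "adj W *v v"] W_adj_bound[of v] by (simp add: matrix_vector_mul_assoc)

lemma Xb_bound: "AE \<zeta> in \<mu>. \<forall>v. norm ((T \<zeta> ** adj W) *v v) \<le> q * norm v"
  using T_bound
proof eventually_elim
  case (elim \<zeta>)
  show ?case
    using elim W_adj_bound by (auto simp: matrix_vector_mul_assoc[symmetric] intro: order_trans)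
qed

lemma G_boundary: "mat_boundary G Gb"
  and Gb_eq: "AE \<zeta> in \<mu>. Gb \<zeta> = matrix_inv (mat 1 - T \<zeta> ** adj W)"
proof -
  obtain H where "mat_boundary G H" "AE \<zeta> in \<mu>. H \<zeta> = matrix_inv (mat 1 - T \<zeta> ** adj W)"
    using resolvent_boundary[OF q mat_boundary_const_mult[OF T_boundary] Xb_bound]
    unfolding G_def[abs_def] by blast
  then have "mat_boundary G Gb \<and> (AE \<zeta> in \<mu>. Gb \<zeta> = matrix_inv (mat 1 - T \<zeta> ** adj W))"
    unfolding Gb_def by (intro someI[where x=H and P="\<lambda>Gb. mat_boundary G Gb \<and> (AE \<zeta> in \<mu>. Gb \<zeta> = matrix_inv (mat 1 - T \<zeta> ** adj W))"]) blast
  then show "mat_boundary G Gb" "AE \<zeta> in \<mu>. Gb \<zeta> = matrix_inv (mat 1 - T \<zeta> ** adj W)" by auto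
qed

lemma Gb_measurable [measurable]: "Gb \<in> borel_measurable borel"
  by (rule mat_boundary_measurable[OF G_boundary])

lemma resolvent_mv:
  assumes X: "\<And>v. norm ((S ** adj W) *v v) \<le> q * norm v" and R: "R = matrix_inv (mat 1 - S ** adj W)"
  shows "R *v (v - S *v (adj W *v v)) = v" "R *v v - S *v (adj W *v (R *v v)) = v"
    "norm (R *v v) \<le> 1 / (1 - q) * norm v"
proof -
  note r = resolvent[OF q(2) X, folded R]
  have e: "u - S *v (adj W *v u) = (mat 1 - S ** adj W) *v u" for u
    by (simp add: matrix_vector_mult_diff_rdistrib matrix_vector_mul_assoc)
  show "R *v (v - S *v (adj W *v v)) = v" "R *v v - S *v (adj W *v (R *v v)) = v"
    unfolding e by (simp_all only: matrix_vector_mul_assoc r matrix_vector_mul_lid)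
  show "norm (R *v v) \<le> 1 / (1 - q) * norm v" using r(3)[of v] by simp
qed

lemma G_mv:
  assumes "norm z < 1"
  shows "G z *v (v - \<Theta> z *v (adj W *v v)) = v" "G z *v v - \<Theta> z *v (adj W *v (G z *v v)) = v"
    "norm (G z *v v) \<le> 1 / (1 - q) * norm v"
  using resolvent_mv[OF X_bound, of "G z" z v] assms by (auto simp: G_def)

lemma Gb_mv:
  "AE \<zeta> in \<mu>. (\<forall>v. Gb \<zeta> *v (v - T \<zeta> *v (adj W *v v)) = v)
     \<and> (\<forall>v. Gb \<zeta> *v v - T \<zeta> *v (adj W *v (Gb \<zeta> *v v)) = v)
     \<and> (\<forall>v. norm (Gb \<zeta> *v v) \<le> 1 / (1 - q) * norm v)"
  using Gb_eq Xb_bound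
proof eventually_elim
  case (elim \<zeta>)
  have "norm ((T \<zeta> ** adj W) *v v) \<le> q * norm v" for v using elim(2) by blast
  from resolvent_mv[OF this elim(1)] show ?case by blast
qed

lemma Gb_bound: "AE \<zeta> in \<mu>. \<forall>v. norm (Gb \<zeta> *v v) \<le> 1 / (1 - q) * norm v"
  using Gb_mv by eventually_elim blast

lemma G_multiplier: "multiplier G Gb"
  unfolding multiplier_def using vec_boundary_mult[OF G_boundary _ Gb_bound] by blast

lemma crofoot_inner_mv:
  assumes "norm z < 1"
  shows "\<Theta>' z *v v = D' *v (G z *v (\<Theta> z *v (D *v v))) - W *v v"
proof -
  have "(- W + A) *v v = A *v v - W *v v" for A :: "complex^'d^'d"
    by (metis add.commute diff_conv_add_uminus matrix_vector_mult_diff_rdistrib)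
  then show ?thesis
    using assms by (simp add: crofoot_inner_def G_def matrix_vector_mul_assoc matrix_mul_assoc)
qed

text \<open>The boundary function of \<open>\<Theta>'\<close>.\<close>

definition T' where "T' \<zeta> = D' ** Gb \<zeta> ** T \<zeta> ** D - W"

lemma T'_mv: "T' \<zeta> *v v = D' *v (Gb \<zeta> *v (T \<zeta> *v (D *v v))) - W *v v"
  by (simp add: T'_def matrix_vector_mult_diff_rdistrib matrix_vector_mul_assoc matrix_mul_assoc)

lemma Theta'_multiplier: "multiplier \<Theta>' T'"
  unfolding multiplier_def
proof (intro allI impI)
  fix h k :: "complex \<Rightarrow> complex^'d" assume hk: "vec_boundary h k"
  have "vec_boundary (\<lambda>z. D' *v (G z *v (\<Theta> z *v (D *v h z))) - W *v h z) (\<lambda>\<zeta>. T' \<zeta> *v k \<zeta>)"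
    unfolding T'_mv
    by (intro vec_boundary_diff vec_boundary_const_mult hk multiplierD[OF G_multiplier]
        multiplierD[OF Theta_multiplier])
  moreover have "(\<lambda>z. D' *v (G z *v (\<Theta> z *v (D *v h z))) - W *v h z) = (\<lambda>z. \<Theta>' z *v h z)"
  proof
    fix z
    show "D' *v (G z *v (\<Theta> z *v (D *v h z))) - W *v h z = \<Theta>' z *v h z"
      using crofoot_inner_mv[of z "h z"] vec_boundaryD(3)[OF hk, of z] by (cases "norm z < 1") simp_all
  qed
  ultimately show "vec_boundary (\<lambda>z. \<Theta>' z *v h z) (\<lambda>\<zeta>. T' \<zeta> *v k \<zeta>)" by simp
qed

lemma J_eq:
  assumes "f \<in> K" shows "J f = (\<lambda>z. D' *v (G z *v f z))"
  using assms by (auto simp: crofoot_def G_def matrix_vector_mul_assoc)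

lemma J_boundary:
  assumes "f \<in> K" "vec_boundary f g"
  shows "vec_boundary (J f) (\<lambda>\<zeta>. D' *v (Gb \<zeta> *v g \<zeta>))"
  unfolding J_eq[OF assms(1)]
  by (intro vec_boundary_const_mult multiplierD[OF G_multiplier] assms)

text \<open>The computation behind \<open>J K = K'\<close>: pointwise on the circle, \<open>M\<^sup>* \<Theta>' h = G \<Theta> D h\<close>, where
  \<open>M = D' G\<close> is the multiplier defining \<open>J\<close>. The functions \<open>G \<Theta> D h\<close> with \<open>h \<in> H\<^sup>2\<close> fill exactly
  \<open>\<Theta> H\<^sup>2\<close>, which is seen from the choices of \<open>N\<close> and \<open>m\<close> in the proofs that \<open>J\<close> and its inverse map
  the model spaces to each other.\<close>

lemma J_adjoint_identity:
  "AE \<zeta> in \<mu>. \<forall>u v. hinner (D' *v (Gb \<zeta> *v u)) (T' \<zeta> *v v)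
     = hinner u (Gb \<zeta> *v (T \<zeta> *v (D *v v)))"
  using Gb_mv T_unitary
proof eventually_elim
  case (elim \<zeta>)
  note g1 = conjunct1[OF elim(1), rule_format] and g2 = conjunct1[OF conjunct2[OF elim(1)], rule_format]
  let ?t = "T \<zeta>" and ?g = "Gb \<zeta>"
  have tt: "adj ?t *v (?t *v v) = v" for v using elim(2) by (simp add: unitary_def matrix_vector_mul_assoc)
  show ?case
  proof (intro allI)
    fix u v
    \<comment> \<open>\<open>z\<close> solves \<open>z - T W\<^sup>* z = T D v\<close>, and applying \<open>T\<^sup>*\<close> gives \<open>T\<^sup>* z - W\<^sup>* z = D v\<close>\<close>
    define z where "z = ?g *v (?t *v (D *v v))"
    have "z - ?t *v (adj W *v z) = ?t *v (D *v v)" unfolding z_def by (rule g2)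
    then have "adj ?t *v z - adj W *v z = D *v v"
      by (metis matrix_vector_mult_diff_distrib tt)
    then have Wz: "W *v (D *v v) = W *v (adj ?t *v z) - W *v (adj W *v z)"
      by (simp flip: matrix_vector_mult_diff_distrib)
    have "D' *v (T' \<zeta> *v v) = z - W *v (adj W *v z) - W *v (D *v v)"
      by (simp add: T'_mv z_def[symmetric] matrix_vector_mult_diff_distrib D'_sq D'_W)
    then have e: "D' *v (T' \<zeta> *v v) = z - W *v (adj ?t *v z)" using Wz by simp
    have "hinner (D' *v (?g *v u)) (T' \<zeta> *v v) = hinner (?g *v u) (z - W *v (adj ?t *v z))"
      by (simp add: hinner_D' e)
    also have "\<dots> = hinner (?g *v u - ?t *v (adj W *v (?g *v u))) z"
      by (simp add: hinner_diff_left hinner_diff_right hinner_adj)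
    also have "\<dots> = hinner u z" by (simp add: g2)
    finally show "hinner (D' *v (?g *v u)) (T' \<zeta> *v v) = hinner u (?g *v (?t *v (D *v v)))"
      by (simp add: z_def)
  qed
qed

lemma J_adjoint_integral:
  assumes bg: "vec_boundary f g" and hk: "vec_boundary h k"
  shows "L2_inner (\<lambda>\<zeta>. D' *v (Gb \<zeta> *v g \<zeta>)) (\<lambda>\<zeta>. T' \<zeta> *v k \<zeta>)
       = L2_inner g (\<lambda>\<zeta>. Gb \<zeta> *v (T \<zeta> *v (D *v k \<zeta>)))"
proof (rule L2_inner_cong)
  show "AE \<zeta> in \<mu>. hinner (D' *v (Gb \<zeta> *v g \<zeta>)) (T' \<zeta> *v k \<zeta>)
     = hinner (g \<zeta>) (Gb \<zeta> *v (T \<zeta> *v (D *v k \<zeta>)))"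
    using J_adjoint_identity by eventually_elim blast
  show "(\<lambda>\<zeta>. D' *v (Gb \<zeta> *v g \<zeta>)) \<in> L2_circle"
    by (rule vec_boundaryD(1), rule vec_boundary_const_mult[OF multiplierD[OF G_multiplier bg]])
  show "(\<lambda>\<zeta>. T' \<zeta> *v k \<zeta>) \<in> L2_circle"
    by (rule vec_boundaryD(1), rule multiplierD[OF Theta'_multiplier hk])
  show "g \<in> L2_circle" by (rule vec_boundaryD(1)[OF bg])
  show "(\<lambda>\<zeta>. Gb \<zeta> *v (T \<zeta> *v (D *v k \<zeta>))) \<in> L2_circle"
    by (rule vec_boundaryD(1), rule multiplierD[OF G_multiplier multiplierD[OF Theta_multiplier vec_boundary_const_mult[OF hk]]])
qed

lemma J_in_K':
  assumes f: "f \<in> K" shows "J f \<in> K'"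
proof -
  note bf = model_space_boundary[OF f]
  note bJ = J_boundary[OF f bf]
  show ?thesis
    unfolding model_space_iff[OF Theta'_multiplier bJ]
  proof (intro allI impI)
    fix h k :: "complex \<Rightarrow> complex^'d" assume hk: "vec_boundary h k"
    \<comment> \<open>the function in \<open>H\<^sup>2\<close> with \<open>\<Theta> N = G \<Theta> D h\<close>\<close>
    define N where "N = (\<lambda>\<zeta>. D *v k \<zeta> + adj W *v (Gb \<zeta> *v (T \<zeta> *v (D *v k \<zeta>))))"
    have bN: "vec_boundary (\<lambda>z. D *v h z + adj W *v (G z *v (\<Theta> z *v (D *v h z)))) N"
      unfolding N_def
      by (intro vec_boundary_add vec_boundary_const_mult hk multiplierD[OF G_multiplier]
        multiplierD[OF Theta_multiplier])
    have e: "AE \<zeta> in \<mu>. Gb \<zeta> *v (T \<zeta> *v (D *v k \<zeta>)) = T \<zeta> *v N \<zeta>"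
      using Gb_mv
    proof eventually_elim
      case (elim \<zeta>)
      let ?z = "Gb \<zeta> *v (T \<zeta> *v (D *v k \<zeta>))"
      have "?z - T \<zeta> *v (adj W *v ?z) = T \<zeta> *v (D *v k \<zeta>)" using elim by blast
      then show ?case unfolding N_def matrix_vector_right_distrib by (simp add: algebra_simps)
    qed
    have "L2_inner (\<lambda>\<zeta>. D' *v (Gb \<zeta> *v bdry_vec f \<zeta>)) (\<lambda>\<zeta>. T' \<zeta> *v k \<zeta>)
        = L2_inner (bdry_vec f) (\<lambda>\<zeta>. Gb \<zeta> *v (T \<zeta> *v (D *v k \<zeta>)))"
      by (rule J_adjoint_integral[OF bf hk])
    also have "\<dots> = L2_inner (bdry_vec f) (\<lambda>\<zeta>. T \<zeta> *v N \<zeta>)"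
    proof (rule L2_inner_cong)
      show "AE \<zeta> in \<mu>. hinner (bdry_vec f \<zeta>) (Gb \<zeta> *v (T \<zeta> *v (D *v k \<zeta>))) = hinner (bdry_vec f \<zeta>) (T \<zeta> *v N \<zeta>)"
        using e by eventually_elim simp
      show "(\<lambda>\<zeta>. Gb \<zeta> *v (T \<zeta> *v (D *v k \<zeta>))) \<in> L2_circle"
        by (rule vec_boundaryD(1), rule multiplierD[OF G_multiplier multiplierD[OF Theta_multiplier vec_boundary_const_mult[OF hk]]])
      show "(\<lambda>\<zeta>. T \<zeta> *v N \<zeta>) \<in> L2_circle"
        using bN multiplierD[OF Theta_multiplier] vec_boundaryD(1) by blast
    qed (use vec_boundaryD(1)[OF bf] in auto)
    also have "\<dots> = 0"
      using f bN unfolding model_space_iff[OF Theta_multiplier bf] by blast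
    finally show "L2_inner (\<lambda>\<zeta>. D' *v (Gb \<zeta> *v bdry_vec f \<zeta>)) (\<lambda>\<zeta>. T' \<zeta> *v k \<zeta>) = 0" .
  qed
qed

text \<open>Multiplication by \<open>D' G\<close> is in general not isometric on \<open>H\<^sup>2\<close>, but it is on \<open>K\<close>: writing \<open>a = G f\<close>, \<open>b = G h\<close>,
  both sides equal \<open>\<langle>a, b\<rangle> - \<langle>W\<^sup>* a, W\<^sup>* b\<rangle>\<close>, the left one by \<open>D' D' = I - W W\<^sup>*\<close> and the right one because
  \<open>f = a - \<Theta> W\<^sup>* a\<close> and \<open>h = b - \<Theta> W\<^sup>* b\<close> are orthogonal to \<open>\<Theta> H\<^sup>2\<close>.\<close>

lemma J_isometric:
  assumes f: "f \<in> K" and h: "h \<in> K"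
  shows "H2_inner (J f) (J h) = H2_inner f h"
proof -
  define g k where "g = bdry_vec f" and "k = bdry_vec h"
  have bg: "vec_boundary f g" and bk: "vec_boundary h k"
    using model_space_boundary f h by (auto simp: g_def k_def)
  define a b where "a = (\<lambda>\<zeta>. Gb \<zeta> *v g \<zeta>)" and "b = (\<lambda>\<zeta>. Gb \<zeta> *v k \<zeta>)"
  define c d where "c = (\<lambda>\<zeta>. adj W *v a \<zeta>)" and "d = (\<lambda>\<zeta>. adj W *v b \<zeta>)"
  have ba: "vec_boundary (\<lambda>z. G z *v f z) a" and bb: "vec_boundary (\<lambda>z. G z *v h z) b"
    unfolding a_def b_def by (intro multiplierD[OF G_multiplier] bg bk)+
  have bc: "vec_boundary (\<lambda>z. adj W *v (G z *v f z)) c" and bd: "vec_boundary (\<lambda>z. adj W *v (G z *v h z)) d"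
    unfolding c_def d_def by (intro vec_boundary_const_mult ba bb)+
  note bTc = multiplierD[OF Theta_multiplier bc] and bTd = multiplierD[OF Theta_multiplier bd]
  note L = vec_boundaryD(1)[OF bg] vec_boundaryD(1)[OF bk] vec_boundaryD(1)[OF ba] vec_boundaryD(1)[OF bb]
    vec_boundaryD(1)[OF bc] vec_boundaryD(1)[OF bd] vec_boundaryD(1)[OF bTc] vec_boundaryD(1)[OF bTd]
  have ge: "AE \<zeta> in \<mu>. g \<zeta> = a \<zeta> - T \<zeta> *v c \<zeta>"
    and ke: "AE \<zeta> in \<mu>. k \<zeta> = b \<zeta> - T \<zeta> *v d \<zeta>"
    using Gb_mv by (eventually_elim, simp add: a_def b_def c_def d_def)+
  have "H2_inner (J f) (J h) = L2_inner (\<lambda>\<zeta>. D' *v a \<zeta>) (\<lambda>\<zeta>. D' *v b \<zeta>)"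
    unfolding a_def b_def by (rule H2_inner_eq[OF J_boundary[OF f bg] J_boundary[OF h bk]])
  also have "\<dots> = L2_inner a b - L2_inner c d"
  proof -
    have "hinner (D' *v a \<zeta>) (D' *v b \<zeta>) = hinner (a \<zeta>) (b \<zeta>) - hinner (c \<zeta>) (d \<zeta>)" for \<zeta>
      unfolding hinner_D' D'_sq c_def d_def by (simp add: hinner_adj hinner_diff_right)
    then show ?thesis unfolding L2_inner_def by (simp add: hinner_integrable L)
  qed
  finally have 1: "H2_inner (J f) (J h) = L2_inner a b - L2_inner c d" .
  have f0: "L2_inner g (\<lambda>\<zeta>. T \<zeta> *v d \<zeta>) = 0"
    using f bd unfolding model_space_iff[OF Theta_multiplier bg] by blast
  have "L2_inner k (\<lambda>\<zeta>. T \<zeta> *v c \<zeta>) = 0"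
    using h bc unfolding model_space_iff[OF Theta_multiplier bk] by blast
  then have h0: "L2_inner (\<lambda>\<zeta>. T \<zeta> *v c \<zeta>) k = 0" using L2_inner_cnj[of k "\<lambda>\<zeta>. T \<zeta> *v c \<zeta>"] by simp
  have "H2_inner f h = L2_inner g k" by (rule H2_inner_eq[OF bg bk])
  also have "\<dots> = L2_inner g (\<lambda>\<zeta>. b \<zeta> - T \<zeta> *v d \<zeta>)"
    by (rule L2_inner_cong) (use ke in \<open>auto intro!: L L2_diff elim: eventually_mono\<close>)
  also have "\<dots> = L2_inner g b" by (simp add: L2_inner_diff_right L f0)
  also have "\<dots> = L2_inner (\<lambda>\<zeta>. a \<zeta> - T \<zeta> *v c \<zeta>) b"
    by (rule L2_inner_cong) (use ge in \<open>auto intro!: L L2_diff elim: eventually_mono\<close>)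
  also have "\<dots> = L2_inner a b - L2_inner (\<lambda>\<zeta>. T \<zeta> *v c \<zeta>) b" by (simp add: L2_inner_diff_left L)
  finally have 2: "H2_inner f h = L2_inner a b - L2_inner (\<lambda>\<zeta>. T \<zeta> *v c \<zeta>) b" .
  have "0 = L2_inner (\<lambda>\<zeta>. T \<zeta> *v c \<zeta>) (\<lambda>\<zeta>. b \<zeta> - T \<zeta> *v d \<zeta>)"
    unfolding h0[symmetric]
    by (rule L2_inner_cong) (use ke in \<open>auto intro!: L L2_diff elim: eventually_mono\<close>)
  also have "\<dots> = L2_inner (\<lambda>\<zeta>. T \<zeta> *v c \<zeta>) b - L2_inner (\<lambda>\<zeta>. T \<zeta> *v c \<zeta>) (\<lambda>\<zeta>. T \<zeta> *v d \<zeta>)"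
    by (simp add: L2_inner_diff_right L)
  also have "L2_inner (\<lambda>\<zeta>. T \<zeta> *v c \<zeta>) (\<lambda>\<zeta>. T \<zeta> *v d \<zeta>) = L2_inner c d"
  proof (rule L2_inner_cong)
    show "AE \<zeta> in \<mu>. hinner (T \<zeta> *v c \<zeta>) (T \<zeta> *v d \<zeta>) = hinner (c \<zeta>) (d \<zeta>)"
      using T_unitary by eventually_elim (simp add: hinner_adj matrix_vector_mul_assoc unitary_def)
  qed (rule L)+
  finally show ?thesis unfolding 1 2 by simp
qed

text \<open>The inverse of \<open>D'\<close>.\<close>

definition E where "E = (SOME E. E ** D' = mat 1 \<and> D' ** E = mat 1)"

lemma E: "E *v (D' *v v) = v" "D' *v (E *v v) = v"
proof -
  obtain E' where "E' ** D' = mat 1" "D' ** E' = mat 1"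
    using defect_op_inverse[OF strict_contraction_adj[OF W]] by blast
  then have "E ** D' = mat 1 \<and> D' ** E = mat 1"
    unfolding E_def by (intro someI[where P="\<lambda>E. E ** D' = mat 1 \<and> D' ** E = mat 1"]) blast
  then show "E *v (D' *v v) = v" "D' *v (E *v v) = v" by (simp_all add: matrix_vector_mul_assoc)
qed

text \<open>The inverse of \<open>J\<close> is multiplication by \<open>(I - \<Theta> W\<^sup>*) E\<close>.\<close>

definition J_inv where "J_inv f' z = E *v f' z - \<Theta> z *v (adj W *v (E *v f' z))"

lemma J_inv_boundary:
  assumes "vec_boundary f' g"
  shows "vec_boundary (J_inv f') (\<lambda>\<zeta>. E *v g \<zeta> - T \<zeta> *v (adj W *v (E *v g \<zeta>)))"
  unfolding J_inv_def
  by (intro vec_boundary_diff multiplierD[OF Theta_multiplier] vec_boundary_const_mult assms)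

lemma J_inv_in_K:
  assumes f: "f' \<in> K'" shows "J_inv f' \<in> K"
proof -
  obtain Di where Di: "Di ** D = mat 1" "D ** Di = mat 1" using defect_op_inverse[OF W] by blast
  note bf = model_space_boundary[OF f]
  note bJ = J_inv_boundary[OF bf]
  define g where "g = (\<lambda>\<zeta>. E *v bdry_vec f' \<zeta> - T \<zeta> *v (adj W *v (E *v bdry_vec f' \<zeta>)))"
  have bg: "vec_boundary (J_inv f') g" using bJ by (simp add: g_def)
  show ?thesis
    unfolding model_space_iff[OF Theta_multiplier bg]
  proof (intro allI impI)
    fix h k :: "complex \<Rightarrow> complex^'d" assume hk: "vec_boundary h k"
    note Tk = multiplierD[OF Theta_multiplier hk]
    \<comment> \<open>the function in \<open>H\<^sup>2\<close> with \<open>G \<Theta> D m = \<Theta> h\<close>\<close>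
    define m where "m = (\<lambda>\<zeta>. Di *v (k \<zeta> - adj W *v (T \<zeta> *v k \<zeta>)))"
    have bm: "vec_boundary (\<lambda>z. Di *v (h z - adj W *v (\<Theta> z *v h z))) m"
      unfolding m_def by (intro vec_boundary_const_mult vec_boundary_diff hk Tk)
    have Dm: "D *v m \<zeta> = k \<zeta> - adj W *v (T \<zeta> *v k \<zeta>)" for \<zeta>
      using Di(2) by (simp add: m_def matrix_vector_mul_assoc del: matrix_vector_mult_diff_distrib)
    have "AE \<zeta> in \<mu>. T \<zeta> *v k \<zeta> = Gb \<zeta> *v (T \<zeta> *v (D *v m \<zeta>))"
      using Gb_mv by eventually_elim (simp add: Dm matrix_vector_mult_diff_distrib[of "T _"])
    then have "L2_inner g (\<lambda>\<zeta>. T \<zeta> *v k \<zeta>) = L2_inner g (\<lambda>\<zeta>. Gb \<zeta> *v (T \<zeta> *v (D *v m \<zeta>)))"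
      using vec_boundaryD(1)[OF bg] vec_boundaryD(1)[OF Tk]
        vec_boundaryD(1)[OF multiplierD[OF G_multiplier multiplierD[OF Theta_multiplier vec_boundary_const_mult[OF bm]]]]
      by (intro L2_inner_cong) (auto elim: eventually_mono)
    also have "\<dots> = L2_inner (\<lambda>\<zeta>. D' *v (Gb \<zeta> *v g \<zeta>)) (\<lambda>\<zeta>. T' \<zeta> *v m \<zeta>)"
      by (rule J_adjoint_integral[OF bg bm, symmetric])
    also have "\<dots> = L2_inner (bdry_vec f') (\<lambda>\<zeta>. T' \<zeta> *v m \<zeta>)"
    proof (rule L2_inner_cong)
      show "AE \<zeta> in \<mu>. hinner (D' *v (Gb \<zeta> *v g \<zeta>)) (T' \<zeta> *v m \<zeta>) = hinner (bdry_vec f' \<zeta>) (T' \<zeta> *v m \<zeta>)"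
        using Gb_mv by eventually_elim (simp add: g_def E)
      show "(\<lambda>\<zeta>. D' *v (Gb \<zeta> *v g \<zeta>)) \<in> L2_circle"
        by (rule vec_boundaryD(1), rule vec_boundary_const_mult[OF multiplierD[OF G_multiplier bg]])
      show "(\<lambda>\<zeta>. T' \<zeta> *v m \<zeta>) \<in> L2_circle"
        by (rule vec_boundaryD(1), rule multiplierD[OF Theta'_multiplier bm])
      then show "(\<lambda>\<zeta>. T' \<zeta> *v m \<zeta>) \<in> L2_circle" .
      show "bdry_vec f' \<in> L2_circle" by (rule vec_boundaryD(1)[OF bf])
    qed
    also have "\<dots> = 0"
      using f bm unfolding model_space_iff[OF Theta'_multiplier bf] by blast
    finally show "L2_inner g (\<lambda>\<zeta>. T \<zeta> *v k \<zeta>) = 0" .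
  qed
qed

lemma J_J_inv:
  assumes f: "f' \<in> K'" shows "J (J_inv f') = f'"
proof
  fix z
  show "J (J_inv f') z = f' z"
  proof (cases "norm z < 1")
    case True
    then show ?thesis unfolding J_eq[OF J_inv_in_K[OF f]] J_inv_def by (simp add: G_mv E)
  next
    case False
    then have "f' z = 0" using vec_boundaryD(3)[OF model_space_boundary[OF f]] by blast
    then show ?thesis using False by (simp add: J_eq[OF J_inv_in_K[OF f]] G_def)
  qed
qed

lemma J_inv_J:
  assumes f: "f \<in> K" shows "J_inv (J f) = f"
proof
  fix z
  show "J_inv (J f) z = f z"
  proof (cases "norm z < 1")
    case True
    then show ?thesis unfolding J_eq[OF f] J_inv_def by (simp add: G_mv E)
  next
    case False
    then have "f z = 0" using vec_boundaryD(3)[OF model_space_boundary[OF f]] by blast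
    then show ?thesis by (simp add: J_eq[OF f] J_inv_def)
  qed
qed

end

section \<open>Conjugation of truncated Toeplitz operators\<close>

lemma bounded_ball_bound:
  assumes "bounded (f ` ball (0::'a::real_normed_vector) 1)"
  obtains B where "\<And>z. norm z < 1 \<Longrightarrow> norm (f z) \<le> B"
proof -
  obtain B where "\<forall>y\<in>f ` ball 0 1. norm y \<le> B" using assms unfolding bounded_iff by blast
  then show ?thesis using that[of B] by simp
qed

context crofoot_data
begin

lemma J_add:
  assumes "f \<in> K" "h \<in> K"
  shows "J (\<lambda>z. f z + h z) = (\<lambda>z. J f z + J h z)"
  using assms model_space_add[OF Theta_multiplier assms]
  by (simp add: J_eq matrix_vector_right_distrib)

lemma J_scale:
  assumes "f \<in> K"
  shows "J (\<lambda>z. c *s f z) = (\<lambda>z. c *s J f z)"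
  using assms model_space_scale[OF Theta_multiplier assms]
  by (simp add: J_eq vector_scalar_commute)

lemma J_inv_add: "J_inv (\<lambda>z. f z + h z) = (\<lambda>z. J_inv f z + J_inv h z)"
  by (simp add: J_inv_def[abs_def] matrix_vector_right_distrib algebra_simps)

lemma J_inv_scale: "J_inv (\<lambda>z. c *s f z) = (\<lambda>z. c *s J_inv f z)"
  by (simp add: J_inv_def[abs_def] vector_scalar_commute vector_ssub_ldistrib)

lemma H2_norm_J: "f \<in> K \<Longrightarrow> H2_norm (J f) = H2_norm f"
  by (simp add: H2_norm_eq J_isometric)

lemma H2_norm_J_inv: "f \<in> K' \<Longrightarrow> H2_norm (J_inv f) = H2_norm f"
  using H2_norm_J[OF J_inv_in_K] J_J_inv by metis

lemma adjoint_J: "g \<in> K' \<Longrightarrow> adjoint_op K K' J g = J_inv g"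
proof -
  assume g: "g \<in> K'"
  have ip: "H2_inner (J f) g = H2_inner f (J_inv g)" if "f \<in> K" for f
    using J_isometric[OF that J_inv_in_K[OF g]] J_J_inv[OF g] by simp
  have "(THE h. h \<in> K \<and> (\<forall>f\<in>K. H2_inner (J f) g = H2_inner f h)) = J_inv g"
  proof (rule the_equality)
    show "J_inv g \<in> K \<and> (\<forall>f\<in>K. H2_inner (J f) g = H2_inner f (J_inv g))"
      using J_inv_in_K[OF g] ip by blast
    fix h assume h: "h \<in> K \<and> (\<forall>f\<in>K. H2_inner (J f) g = H2_inner f h)"
    show "h = J_inv g"
    proof (rule model_space_eqI[OF Theta_multiplier])
      fix k assume k: "k \<in> K"
      then have "H2_inner k h = H2_inner k (J_inv g)" using h ip by metis
      then have "cnj (H2_inner k h) = cnj (H2_inner k (J_inv g))" by simp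
      then show "L2_inner (bdry_vec h) (bdry_vec k) = L2_inner (bdry_vec (J_inv g)) (bdry_vec k)"
        by (simp add: H2_inner_def L2_inner_cnj)
    qed (use h J_inv_in_K[OF g] in auto)
  qed
  then show ?thesis using g by (simp add: adjoint_op_def)
qed

lemma bounded_J:
  assumes f: "f \<in> K" and b: "bounded (f ` ball 0 1)"
  shows "bounded (J f ` ball 0 1)"
proof -
  obtain B where B: "\<And>z. norm z < 1 \<Longrightarrow> norm (f z) \<le> B" using bounded_ball_bound[OF b] by blast
  show ?thesis
    unfolding bounded_iff
  proof (intro exI ballI)
    fix y assume "y \<in> J f ` ball 0 1"
    then obtain z where z: "norm z < 1" "y = J f z" by auto
    have "norm (D' *v (G z *v f z)) \<le> opnorm D' * norm (G z *v f z)" by (rule opnorm_bound)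
    also have "\<dots> \<le> opnorm D' * (1 / (1 - q) * norm (f z))"
      by (intro mult_left_mono G_mv(3) z opnorm_nonneg)
    also have "\<dots> \<le> opnorm D' * (1 / (1 - q) * B)"
      using q by (intro mult_left_mono B z opnorm_nonneg) simp
    finally show "norm y \<le> opnorm D' * (1 / (1 - q) * B)" by (simp add: z J_eq[OF f])
  qed
qed

text \<open>\<open>R\<close> is the boundary function of the multiplier defining the inverse of \<open>J\<close>.\<close>

definition R where "R \<zeta> = E - T \<zeta> ** adj W ** E"

lemma R_mv: "R \<zeta> *v v = E *v v - T \<zeta> *v (adj W *v (E *v v))"
  by (simp add: R_def matrix_vector_mult_diff_rdistrib matrix_vector_mul_assoc matrix_mul_assoc)

lemma J_inv_bound:
  assumes "\<And>v. norm (S *v v) \<le> norm v"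
  shows "norm (E *v v - S *v (adj W *v (E *v v))) \<le> 2 * opnorm E * norm v"
proof -
  have "norm (S *v (adj W *v (E *v v))) \<le> q * norm (E *v v)"
    using assms[of "adj W *v (E *v v)"] W_adj_bound[of "E *v v"] by linarith
  also have "\<dots> \<le> 1 * norm (E *v v)" using q by (intro mult_right_mono) auto
  finally show ?thesis
    using norm_triangle_ineq4[of "E *v v" "S *v (adj W *v (E *v v))"] opnorm_bound[of E v] by linarith
qed

lemma bounded_J_inv:
  assumes f: "f \<in> K'" and b: "bounded (f ` ball 0 1)"
  shows "bounded (J_inv f ` ball 0 1)"
proof -
  obtain B where B: "\<And>z. norm z < 1 \<Longrightarrow> norm (f z) \<le> B" using bounded_ball_bound[OF b] by blast
  show ?thesis
    unfolding bounded_iff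
  proof (intro exI ballI)
    fix y assume "y \<in> J_inv f ` ball 0 1"
    then obtain z where z: "norm z < 1" "y = J_inv f z" by auto
    have "norm (J_inv f z) \<le> 2 * opnorm E * norm (f z)"
      unfolding J_inv_def by (rule J_inv_bound[OF Theta_bound])
    also have "\<dots> \<le> 2 * opnorm E * B"
      using B[OF z(1)] by (intro mult_left_mono) (auto simp: opnorm_nonneg)
    finally show "norm y \<le> 2 * opnorm E * B" by (simp add: z)
  qed
qed

text \<open>\<open>N\<close> is the boundary function of the multiplier defining \<open>J\<close>.\<close>

definition N where "N \<zeta> = D' ** Gb \<zeta>"

lemma N_mv: "N \<zeta> *v v = D' *v (Gb \<zeta> *v v)"
  by (simp add: N_def matrix_vector_mul_assoc)

lemma N_measurable [measurable]: "N \<in> borel_measurable borel"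
  unfolding N_def[abs_def] by measurable

lemma R_measurable [measurable]: "R \<in> borel_measurable borel"
proof -
  have "(\<lambda>\<zeta>. T \<zeta> ** adj W ** E) \<in> borel_measurable borel" by measurable
  then show ?thesis unfolding R_def[abs_def] by measurable
qed

lemma N_bound: "AE \<zeta> in \<mu>. \<forall>v. norm (N \<zeta> *v v) \<le> opnorm D' * (1 / (1 - q)) * norm v"
  using Gb_bound
proof eventually_elim
  case (elim \<zeta>)
  show ?case
  proof
    fix v
    have "norm (N \<zeta> *v v) \<le> opnorm D' * norm (Gb \<zeta> *v v)" unfolding N_mv by (rule opnorm_bound)
    also have "\<dots> \<le> opnorm D' * (1 / (1 - q) * norm v)"
      using elim by (intro mult_left_mono opnorm_nonneg) blast
    finally show "norm (N \<zeta> *v v) \<le> opnorm D' * (1 / (1 - q)) * norm v" by (simp only: mult.assoc)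
  qed
qed

lemma R_bound: "AE \<zeta> in \<mu>. \<forall>v. norm (R \<zeta> *v v) \<le> 2 * opnorm E * norm v"
  using T_bound
proof eventually_elim
  case (elim \<zeta>)
  then have "norm (T \<zeta> *v v) \<le> norm v" for v by simp
  from J_inv_bound[OF this] show ?case unfolding R_mv by blast
qed

lemma adj_bound_AE:
  assumes "AE \<zeta> in \<mu>. \<forall>v. norm (A \<zeta> *v v) \<le> C * norm v"
  shows "AE \<zeta> in \<mu>. \<forall>v. norm (adj (A \<zeta>) *v v) \<le> C * norm v"
  using assms by eventually_elim (blast intro: adj_bound)

lemma R_N: "AE \<zeta> in \<mu>. \<forall>v. R \<zeta> *v (N \<zeta> *v v) = v"
  using Gb_mv by eventually_elim (simp add: R_mv N_mv E)

lemma bdry_J: "f \<in> K \<Longrightarrow> AE \<zeta> in \<mu>. bdry_vec (J f) \<zeta> = N \<zeta> *v bdry_vec f \<zeta>"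
  unfolding N_mv
  by (rule vec_boundary_unique[OF model_space_boundary[OF J_in_K'] J_boundary[OF _ model_space_boundary]])

lemmas proj_K = model_proj_inner[OF Theta_multiplier T_measurable T_unitary]

lemma model_proj_cong:
  assumes g: "g \<in> L2_circle" and h: "h \<in> L2_circle" and ae: "AE \<zeta> in \<mu>. g \<zeta> = h \<zeta>"
  shows "model_proj \<Theta> g = model_proj \<Theta> h"
proof (rule model_proj_eqI[OF Theta_multiplier g proj_K(1)[OF h]])
  fix k assume k: "k \<in> K"
  have "L2_inner g (bdry_vec k) = L2_inner h (bdry_vec k)"
    using g h vec_boundaryD(1)[OF model_space_boundary[OF k]] ae
    by (intro L2_inner_cong) (auto elim: eventually_mono)
  also have "\<dots> = L2_inner (bdry_vec (model_proj \<Theta> h)) (bdry_vec k)" by (rule proj_K(2)[OF h k])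
  finally show "L2_inner g (bdry_vec k) = L2_inner (bdry_vec (model_proj \<Theta> h)) (bdry_vec k)" .
qed

text \<open>Since \<open>J\<close> is unitary and acts on the circle as multiplication by \<open>N\<close>, the projections onto
  the two model spaces are related by \<open>P' = J P N\<^sup>*\<close>.\<close>

lemma model_proj_crofoot:
  assumes g: "g \<in> L2_circle"
  shows "(\<lambda>\<zeta>. adj (N \<zeta>) *v g \<zeta>) \<in> L2_circle"
    and "model_proj \<Theta>' g = J (model_proj \<Theta> (\<lambda>\<zeta>. adj (N \<zeta>) *v g \<zeta>))"
proof -
  let ?g = "\<lambda>\<zeta>. adj (N \<zeta>) *v g \<zeta>"
  show gL: "?g \<in> L2_circle"
    by (rule L2_matrix_mult[OF g _ adj_bound_AE[OF N_bound]]) measurable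
  let ?h = "model_proj \<Theta> ?g"
  note hK = proj_K(1)[OF gL]
  show "model_proj \<Theta>' g = J ?h"
  proof (rule model_proj_eqI[OF Theta'_multiplier g J_in_K'[OF hK]])
    fix k' assume k': "k' \<in> K'"
    define k where "k = J_inv k'"
    have k: "k \<in> K" "J k = k'" using J_inv_in_K J_J_inv k' by (auto simp: k_def)
    note kL = vec_boundaryD(1)[OF model_space_boundary[OF k(1)]]
    have "L2_inner g (bdry_vec k') = L2_inner ?g (bdry_vec k)"
    proof (rule L2_inner_cong)
      show "AE \<zeta> in \<mu>. hinner (g \<zeta>) (bdry_vec k' \<zeta>) = hinner (?g \<zeta>) (bdry_vec k \<zeta>)"
        using bdry_J[OF k(1)] by eventually_elim (simp add: k hinner_adj)
    qed (use g gL kL vec_boundaryD(1)[OF model_space_boundary[OF k']] in auto)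
    also have "\<dots> = L2_inner (bdry_vec ?h) (bdry_vec k)" by (rule proj_K(2)[OF gL k(1)])
    also have "\<dots> = H2_inner (J ?h) (J k)" by (simp add: J_isometric[OF hK k(1)]) (simp add: H2_inner_def)
    finally show "L2_inner g (bdry_vec k') = L2_inner (bdry_vec (J ?h)) (bdry_vec k')"
      by (simp add: k H2_inner_def)
  qed
qed

lemma bdry_bounded:
  assumes "f \<in> model_space \<Psi>" "bounded (f ` ball 0 1)"
  obtains B where "AE \<zeta> in \<mu>. norm (bdry_vec f \<zeta>) \<le> B"
proof -
  obtain C where "\<And>z. norm z < 1 \<Longrightarrow> norm (f z) \<le> C" using bounded_ball_bound[OF assms(2)] by blast
  from vec_bound_imp_boundary_bound[OF model_space_boundary[OF assms(1)] this] that show ?thesis by blast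
qed

text \<open>For bounded \<open>f\<close> the function \<open>\<Phi> f\<close> is square integrable on the circle, so its projection is
  defined.\<close>

lemma symbol_L2:
  fixes \<Phi> \<Psi> :: "complex \<Rightarrow> complex^'n^'n"
  assumes "\<Phi> \<in> L2_circle" "f \<in> model_space \<Psi>" "bounded (f ` ball 0 1)"
  shows "(\<lambda>\<zeta>. \<Phi> \<zeta> *v bdry_vec f \<zeta>) \<in> L2_circle"
proof -
  obtain B where "AE \<zeta> in \<mu>. norm (bdry_vec f \<zeta>) \<le> B"
    using bdry_bounded[OF assms(2,3)] by blast
  then show ?thesis
    by (rule L2_mult_bounded[OF assms(1) vec_boundaryD(2)[OF model_space_boundary[OF assms(2)]]])
qed

lemma N_symbol_L2:
  assumes \<Phi>: "\<Phi> \<in> L2_circle"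
  shows "(\<lambda>\<zeta>. adj (N \<zeta>) ** \<Phi> \<zeta> ** N \<zeta>) \<in> L2_circle"
proof (rule L2_sandwich[OF \<Phi> _ _ adj_bound_AE[OF N_bound] N_bound])
  show "0 \<le> opnorm D' * (1 / (1 - q))" using q by (intro mult_nonneg_nonneg opnorm_nonneg) simp
qed measurable

lemma R_symbol_L2:
  assumes \<Phi>: "\<Phi> \<in> L2_circle"
  shows "(\<lambda>\<zeta>. adj (R \<zeta>) ** \<Phi> \<zeta> ** R \<zeta>) \<in> L2_circle"
proof (rule L2_sandwich[OF \<Phi> _ _ adj_bound_AE[OF R_bound] R_bound])
  show "0 \<le> 2 * opnorm E" by (simp add: opnorm_nonneg)
qed measurable

text \<open>The truncated Toeplitz operator on \<open>K'\<close> with symbol \<open>\<Phi>\<close> corresponds to the one on \<open>K\<close>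
  with symbol \<open>N\<^sup>* \<Phi> N\<close>.\<close>

lemma model_proj_symbol:
  assumes \<Phi>: "\<Phi> \<in> L2_circle" and f: "f \<in> K" and b: "bounded (f ` ball 0 1)"
  shows "(\<lambda>\<zeta>. adj (N \<zeta>) ** \<Phi> \<zeta> ** N \<zeta>) \<in> L2_circle"
    and "model_proj \<Theta>' (\<lambda>\<zeta>. \<Phi> \<zeta> *v bdry_vec (J f) \<zeta>)
       = J (model_proj \<Theta> (\<lambda>\<zeta>. (adj (N \<zeta>) ** \<Phi> \<zeta> ** N \<zeta>) *v bdry_vec f \<zeta>))"
proof -
  show L: "(\<lambda>\<zeta>. adj (N \<zeta>) ** \<Phi> \<zeta> ** N \<zeta>) \<in> L2_circle" by (rule N_symbol_L2[OF \<Phi>])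
  have gL: "(\<lambda>\<zeta>. \<Phi> \<zeta> *v bdry_vec (J f) \<zeta>) \<in> L2_circle"
    by (rule symbol_L2[OF \<Phi> J_in_K'[OF f] bounded_J[OF f b]])
  have "model_proj \<Theta> (\<lambda>\<zeta>. adj (N \<zeta>) *v (\<Phi> \<zeta> *v bdry_vec (J f) \<zeta>))
      = model_proj \<Theta> (\<lambda>\<zeta>. (adj (N \<zeta>) ** \<Phi> \<zeta> ** N \<zeta>) *v bdry_vec f \<zeta>)"
  proof (rule model_proj_cong[OF model_proj_crofoot(1)[OF gL] symbol_L2[OF L f b]])
    show "AE \<zeta> in \<mu>. adj (N \<zeta>) *v (\<Phi> \<zeta> *v bdry_vec (J f) \<zeta>)
        = (adj (N \<zeta>) ** \<Phi> \<zeta> ** N \<zeta>) *v bdry_vec f \<zeta>"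
      using bdry_J[OF f] by eventually_elim (simp add: matrix_vector_mul_assoc matrix_mul_assoc)
  qed
  then show "model_proj \<Theta>' (\<lambda>\<zeta>. \<Phi> \<zeta> *v bdry_vec (J f) \<zeta>)
       = J (model_proj \<Theta> (\<lambda>\<zeta>. (adj (N \<zeta>) ** \<Phi> \<zeta> ** N \<zeta>) *v bdry_vec f \<zeta>))"
    using model_proj_crofoot(2)[OF gL] by simp
qed

lemma truncated_toeplitz_pullback:
  assumes A: "A \<in> truncated_toeplitz \<Theta>'"
  shows "compose K (adjoint_op K K' J) (compose K A J) \<in> truncated_toeplitz \<Theta>"
proof -
  obtain \<Phi> :: "complex \<Rightarrow> complex^'d^'d" where bA: "bounded_op_on K' A" and \<Phi>: "\<Phi> \<in> L2_circle"
    and A\<Phi>: "\<And>f. f \<in> K' \<Longrightarrow> bounded (f ` ball 0 1) \<Longrightarrow> A f = model_proj \<Theta>' (\<lambda>\<zeta>. \<Phi> \<zeta> *v bdry_vec f \<zeta>)"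
    using A unfolding truncated_toeplitz_def by blast
  have AK: "A f \<in> K'" if "f \<in> K'" for f using bA that by (auto simp: bounded_op_on_def)
  have Aadd: "A (\<lambda>z. f z + h z) = (\<lambda>z. A f z + A h z)" if "f \<in> K'" "h \<in> K'" for f h
    using bA that by (simp add: bounded_op_on_def)
  have Ascale: "A (\<lambda>z. c *s f z) = (\<lambda>z. c *s A f z)" if "f \<in> K'" for f c
    using bA that by (simp add: bounded_op_on_def)
  obtain C where C: "\<And>f. f \<in> K' \<Longrightarrow> H2_norm (A f) \<le> C * H2_norm f"
    using bA unfolding bounded_op_on_def by blast
  define B where "B = compose K (adjoint_op K K' J) (compose K A J)"
  have B: "B f = J_inv (A (J f))" if "f \<in> K" for f
    using that by (simp add: B_def compose_def adjoint_J AK J_in_K')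
  have "bounded_op_on K B"
    unfolding bounded_op_on_def
  proof (intro conjI ballI allI)
    show "B \<in> K \<rightarrow>\<^sub>E K"
      by (auto simp: B AK J_in_K' J_inv_in_K PiE_iff extensional_def) (simp add: B_def compose_def)
    show "B (\<lambda>z. f z + h z) = (\<lambda>z. B f z + B h z)" if "f \<in> K" "h \<in> K" for f h
      using that by (simp add: B model_space_add[OF Theta_multiplier] J_add Aadd J_in_K' J_inv_add)
    show "B (\<lambda>z. c *s f z) = (\<lambda>z. c *s B f z)" if "f \<in> K" for c f
      using that by (simp add: B model_space_scale[OF Theta_multiplier] J_scale Ascale J_in_K' J_inv_scale)
    show "\<exists>C. \<forall>f\<in>K. H2_norm (B f) \<le> C * H2_norm f"
    proof (intro exI ballI)
      fix f assume f: "f \<in> K"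
      show "H2_norm (B f) \<le> C * H2_norm f"
        using C[OF J_in_K'[OF f]] by (simp add: B f H2_norm_J_inv AK J_in_K' H2_norm_J)
    qed
  qed
  moreover have "(\<lambda>\<zeta>. adj (N \<zeta>) ** \<Phi> \<zeta> ** N \<zeta>) \<in> L2_circle" by (rule N_symbol_L2[OF \<Phi>])
  moreover have "B f = model_proj \<Theta> (\<lambda>\<zeta>. (adj (N \<zeta>) ** \<Phi> \<zeta> ** N \<zeta>) *v bdry_vec f \<zeta>)"
    if f: "f \<in> K" and b: "bounded (f ` ball 0 1)" for f
  proof -
    note S = model_proj_symbol[OF \<Phi> f b]
    show ?thesis
      by (simp add: B f A\<Phi>[OF J_in_K'[OF f] bounded_J[OF f b]] S(2)
          J_inv_J[OF proj_K(1)[OF symbol_L2[OF S(1) f b]]])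
  qed
  ultimately show ?thesis unfolding B_def[symmetric] truncated_toeplitz_def by blast
qed

text \<open>Conversely, an operator on \<open>K\<close> with symbol \<open>\<Phi>\<close> arises from the one on \<open>K'\<close> with symbol
  \<open>R\<^sup>* \<Phi> R\<close>, since \<open>R N = I\<close>.\<close>

lemma truncated_toeplitz_pushforward:
  assumes A: "A \<in> truncated_toeplitz \<Theta>"
  shows "\<exists>A'\<in>truncated_toeplitz \<Theta>'. A = compose K (adjoint_op K K' J) (compose K A' J)"
proof -
  obtain \<Phi> :: "complex \<Rightarrow> complex^'d^'d" where bA: "bounded_op_on K A" and \<Phi>: "\<Phi> \<in> L2_circle"
    and A\<Phi>: "\<And>f. f \<in> K \<Longrightarrow> bounded (f ` ball 0 1) \<Longrightarrow> A f = model_proj \<Theta> (\<lambda>\<zeta>. \<Phi> \<zeta> *v bdry_vec f \<zeta>)"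
    using A unfolding truncated_toeplitz_def by blast
  have AK: "A f \<in> K" if "f \<in> K" for f using bA that by (auto simp: bounded_op_on_def)
  have Aadd: "A (\<lambda>z. f z + h z) = (\<lambda>z. A f z + A h z)" if "f \<in> K" "h \<in> K" for f h
    using bA that by (simp add: bounded_op_on_def)
  have Ascale: "A (\<lambda>z. c *s f z) = (\<lambda>z. c *s A f z)" if "f \<in> K" for f c
    using bA that by (simp add: bounded_op_on_def)
  obtain C where C: "\<And>f. f \<in> K \<Longrightarrow> H2_norm (A f) \<le> C * H2_norm f"
    using bA unfolding bounded_op_on_def by blast
  define B where "B = (\<lambda>f\<in>K'. J (A (J_inv f)))"
  have B: "B f = J (A (J_inv f))" if "f \<in> K'" for f using that by (simp add: B_def)
  have "bounded_op_on K' B"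
    unfolding bounded_op_on_def
  proof (intro conjI ballI allI)
    show "B \<in> K' \<rightarrow>\<^sub>E K'"
      by (auto simp: B AK J_in_K' J_inv_in_K PiE_iff extensional_def) (simp add: B_def)
    show "B (\<lambda>z. f z + h z) = (\<lambda>z. B f z + B h z)" if "f \<in> K'" "h \<in> K'" for f h
      using that by (simp add: B model_space_add[OF Theta'_multiplier] J_inv_add Aadd J_inv_in_K AK J_add)
    show "B (\<lambda>z. c *s f z) = (\<lambda>z. c *s B f z)" if "f \<in> K'" for c f
      using that by (simp add: B model_space_scale[OF Theta'_multiplier] J_inv_scale Ascale J_inv_in_K AK J_scale)
    show "\<exists>C. \<forall>f\<in>K'. H2_norm (B f) \<le> C * H2_norm f"
    proof (intro exI ballI)
      fix f assume f: "f \<in> K'"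
      show "H2_norm (B f) \<le> C * H2_norm f"
        using C[OF J_inv_in_K[OF f]] by (simp add: B f H2_norm_J AK J_inv_in_K H2_norm_J_inv)
    qed
  qed
  moreover have \<Phi>': "(\<lambda>\<zeta>. adj (R \<zeta>) ** \<Phi> \<zeta> ** R \<zeta>) \<in> L2_circle" by (rule R_symbol_L2[OF \<Phi>])
  moreover have "B f' = model_proj \<Theta>' (\<lambda>\<zeta>. (adj (R \<zeta>) ** \<Phi> \<zeta> ** R \<zeta>) *v bdry_vec f' \<zeta>)"
    if f': "f' \<in> K'" and b': "bounded (f' ` ball 0 1)" for f'
  proof -
    define f where "f = J_inv f'"
    have f: "f \<in> K" "J f = f'" and b: "bounded (f ` ball 0 1)"
      using J_inv_in_K J_J_inv bounded_J_inv f' b' by (auto simp: f_def)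
    note S = model_proj_symbol[OF \<Phi>' f(1) b]
    have "model_proj \<Theta> (\<lambda>\<zeta>. (adj (N \<zeta>) ** (adj (R \<zeta>) ** \<Phi> \<zeta> ** R \<zeta>) ** N \<zeta>) *v bdry_vec f \<zeta>)
        = model_proj \<Theta> (\<lambda>\<zeta>. \<Phi> \<zeta> *v bdry_vec f \<zeta>)"
    proof (rule model_proj_cong[OF symbol_L2[OF S(1) f(1) b] symbol_L2[OF \<Phi> f(1) b]])
      show "AE \<zeta> in \<mu>. (adj (N \<zeta>) ** (adj (R \<zeta>) ** \<Phi> \<zeta> ** R \<zeta>) ** N \<zeta>) *v bdry_vec f \<zeta>
          = \<Phi> \<zeta> *v bdry_vec f \<zeta>"
        using R_N
      proof eventually_elim
        case (elim \<zeta>)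
        then have RN: "R \<zeta> ** N \<zeta> = mat 1" by (simp add: matrix_eq matrix_vector_mul_assoc)
        then have "adj (N \<zeta>) ** adj (R \<zeta>) = mat 1" by (metis adj_mult adj_mat_1)
        then have "adj (N \<zeta>) ** (adj (R \<zeta>) ** \<Phi> \<zeta> ** R \<zeta>) ** N \<zeta> = \<Phi> \<zeta>"
          by (metis RN matrix_mul_assoc matrix_mul_lid matrix_mul_rid)
        then show ?case by simp
      qed
    qed
    then show ?thesis using S(2) by (simp add: B f' f f_def[symmetric] A\<Phi>[OF f(1) b])
  qed
  ultimately have "B \<in> truncated_toeplitz \<Theta>'" unfolding truncated_toeplitz_def by blast
  moreover have "A = compose K (adjoint_op K K' J) (compose K B J)"
  proof
    fix f
    show "A f = compose K (adjoint_op K K' J) (compose K B J) f"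
    proof (cases "f \<in> K")
      case True
      then show ?thesis by (simp add: compose_def B J_in_K' adjoint_J AK J_inv_J)
    next
      case False
      then show ?thesis using bA by (auto simp: compose_def bounded_op_on_def PiE_iff extensional_def)
    qed
  qed
  ultimately show ?thesis by blast
qed

end

theorem theorem3p10:
  fixes W :: "complex^'d^'d"
    and \<Theta> \<Theta>' :: "complex \<Rightarrow> complex^'d^'d"
    and J Jstar :: "(complex \<Rightarrow> complex^'d) \<Rightarrow> complex \<Rightarrow> complex^'d"
  assumes "strict_contraction W"
    and "pure_inner \<Theta>"
  defines "\<Theta>' \<equiv> crofoot_inner W \<Theta>"
    and "J \<equiv> crofoot W \<Theta>"
    and "Jstar \<equiv> adjoint_op (model_space \<Theta>) (model_space \<Theta>') J"
  shows "truncated_toeplitz \<Theta> =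
    {compose (model_space \<Theta>) Jstar (compose (model_space \<Theta>) A J) | A.
       A \<in> truncated_toeplitz \<Theta>'}"
proof -
  interpret crofoot_data W \<Theta>
    using assms(1,2) by unfold_locales (simp_all add: pure_inner_def)
  show ?thesis
    unfolding Jstar_def J_def \<Theta>'_def
    using truncated_toeplitz_pullback truncated_toeplitz_pushforward by blast
qed

end
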